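(* Let $H\in(1/2,1)$ and let $\mu^H$ be the probability measure on $[\tfrac12,1]$ with density $(1-H)2^{3-2H}(1-p)^{1-2H}$. Let $(X^{\mu^H,i})_{i\ge 1}$ be a sequence of independent processes each of law $P^{\mu^H}$, and let $c_H=\sqrt{\frac{H(2H-1)}{\Gamma(3-2H)}}$. Then $$\mathcal{L}^{\mathcal{D}}\lim_{N\to\infty}\ \mathcal{L}\lim_{M\to\infty}\ c_H\,\frac{X^{\mu^H,1}_{[Nt]}+\cdots+X^{\mu^H,M}_{[Nt]}}{N^H\sqrt{M}}=B_H(t),$$ i.e. for each fixed $N\geq 1$ the processes $\big(c_H\frac{X^{\mu^H,1}_{[Nt]}+\cdots+X^{\mu^H,M}_{[Nt]}}{N^H\sqrt M}\big)_{t\in[0,1]}$ converge as $M\to\infty$, in the sense of finite-dimensional distributions, to a process $Z_N$, and as $N\to\infty$ the processes $Z_N$ converge weakly, in the Skorohod topology on $D[0,1]$, to $(B_H(t))_{t\in[0,1]}$.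
   Context: For $p\in[0,1]$, the correlated random walk $X^p=(X^p_n)_{n\ge0}$ with persistence $p$ is the $\mathbb{Z}$-valued process such that: $X_0^p=0$, $P(X_1^p=1)=P(X_1^p=-1)=1/2$; for all $n\ge1$, $\varepsilon_n^p:=X_n^p-X_{n-1}^p$ equals $1$ or $-1$ a.s.; and for all $n\ge1$, $P(\varepsilon_{n+1}^p=\varepsilon_n^p\mid\sigma(X_k^p,0\le k\le n))=p$. Let $P^p$ be the law of $X^p$ on $\mathbb{Z}^{\mathbb{N}}$. For a probability measure $\mu$ on $[0,1]$, $P^\mu:=\int_0^1P^p\,d\mu(p)$ (annealed law: $p$ is drawn once according to $\mu$ for the whole walk). $[x]$ denotes the integer part of $x$. $B_H$ is the fractional Brownian motion with index $H$: the continuous centered Gaussian process with covariance $E[B_H(s)B_H(t)]=\frac12(s^{2H}+t^{2H}-|s-t|^{2H})$. $D[0,1]$ is the space of cadlag functions on $[0,1]$; $\mathcal{L}$ denotes convergence of finite-dimensional distributions and $\mathcal{L}^{\mathcal{D}}$ denotes weak convergence in the Skorohod topology on $D[0,1]$. *)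

theory Defs
  imports "HOL-Probability.Probability"
begin

definition walk_space :: "(nat \<Rightarrow> int) measure" where
  "walk_space = PiM UNIV (\<lambda>_. count_space UNIV)"

definition past :: "'a measure \<Rightarrow> (nat \<Rightarrow> 'a \<Rightarrow> int) \<Rightarrow> nat \<Rightarrow> 'a measure" where
  "past M X n = sigma (space M) {X k -` A \<inter> space M | k A. k \<le> n}"

definition walk_step :: "(nat \<Rightarrow> 'a \<Rightarrow> int) \<Rightarrow> nat \<Rightarrow> 'a \<Rightarrow> int" where
  "walk_step X n \<omega> = X n \<omega> - X (n - 1) \<omega>"

definition correlated_random_walk :: "'a measure \<Rightarrow> real \<Rightarrow> (nat \<Rightarrow> 'a \<Rightarrow> int) \<Rightarrow> bool" where
  "correlated_random_walk M p X \<longleftrightarrow>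
     prob_space M \<and>
     (\<forall>n. X n \<in> M \<rightarrow>\<^sub>M count_space UNIV) \<and>
     (AE \<omega> in M. X 0 \<omega> = 0) \<and>
     measure M {\<omega> \<in> space M. X 1 \<omega> = 1} = 1/2 \<and>
     measure M {\<omega> \<in> space M. X 1 \<omega> = -1} = 1/2 \<and>
     (\<forall>n\<ge>1. AE \<omega> in M. walk_step X n \<omega> = 1 \<or> walk_step X n \<omega> = -1) \<and>
     (\<forall>n\<ge>1. AE \<omega> in M.
        real_cond_exp M (past M X n)
          (indicator {\<omega> \<in> space M. walk_step X (n + 1) \<omega> = walk_step X n \<omega>}) \<omega> = p)"

text \<open>
  The defining properties determine the law on path space for every \<open>p \<in> [0, 1]\<close>;
  outside that interval \<open>crw_law p\<close> is unspecified.
\<close>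

definition crw_law :: "real \<Rightarrow> (nat \<Rightarrow> int) measure" where
  "crw_law p = (THE Q. sets Q = sets walk_space \<and> correlated_random_walk Q p (\<lambda>n x. x n))"

text \<open>
  The mixture is the Giry-monad composition. The underlying space of \<open>\<mu>\<close> has to be
  a subset of \<open>[0, 1]\<close> (as a space, not merely as a support).
\<close>

definition annealed_law :: "real measure \<Rightarrow> (nat \<Rightarrow> int) measure" where
  "annealed_law \<mu> = bind \<mu> crw_law"

text \<open>
  At \<open>p = 1\<close>, where the density is infinite, the formula evaluates to \<open>0\<close>; this is a null set.
\<close>

definition mu_H :: "real \<Rightarrow> real measure" where
  "mu_H H = density (restrict_space lborel {1/2..1})
     (\<lambda>p. ennreal ((1 - H) * 2 powr (3 - 2 * H) * (1 - p) powr (1 - 2 * H)))"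

definition c_H :: "real \<Rightarrow> real" where
  "c_H H = sqrt (H * (2 * H - 1) / Gamma (3 - 2 * H))"

text \<open>Degenerate Gaussian variables (\<open>s = 0\<close>) are allowed.\<close>

definition gaussian_rv :: "'a measure \<Rightarrow> ('a \<Rightarrow> real) \<Rightarrow> bool" where
  "gaussian_rv M Y \<longleftrightarrow> Y \<in> borel_measurable M \<and>
     (\<exists>m s. distr M borel Y = distr std_normal_distribution borel (\<lambda>x. m + s * x))"

definition gaussian_process :: "real set \<Rightarrow> 'a measure \<Rightarrow> (real \<Rightarrow> 'a \<Rightarrow> real) \<Rightarrow> bool" where
  "gaussian_process I M Y \<longleftrightarrow> prob_space M \<and>
     (\<forall>J a. finite J \<and> J \<subseteq> I \<longrightarrow> gaussian_rv M (\<lambda>\<omega>. \<Sum>t\<in>J. a t * Y t \<omega>))"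

definition fractional_brownian_motion ::
    "real \<Rightarrow> real set \<Rightarrow> 'a measure \<Rightarrow> (real \<Rightarrow> 'a \<Rightarrow> real) \<Rightarrow> bool" where
  "fractional_brownian_motion H I M B \<longleftrightarrow>
     gaussian_process I M B \<and>
     (\<forall>t\<in>I. (\<integral>\<omega>. B t \<omega> \<partial>M) = 0) \<and>
     (\<forall>s\<in>I. \<forall>t\<in>I. (\<integral>\<omega>. B s \<omega> * B t \<omega> \<partial>M) =
        (s powr (2 * H) + t powr (2 * H) - \<bar>s - t\<bar> powr (2 * H)) / 2) \<and>
     (\<forall>\<omega>\<in>space M. continuous_on I (\<lambda>t. B t \<omega>))"

definition cadlag :: "(real \<Rightarrow> real) set" where
  "cadlag = {x \<in> extensional {0..1}.
     (\<forall>t\<in>{0..<1}. (x \<longlongrightarrow> x t) (at_right t)) \<and>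
     (\<forall>t\<in>{0<..1}. \<exists>l. (x \<longlongrightarrow> l) (at_left t))}"

definition time_changes :: "(real \<Rightarrow> real) set" where
  "time_changes = {f. strict_mono_on {0..1} f \<and> continuous_on {0..1} f \<and> f ` {0..1} = {0..1}}"

definition skorohod_close :: "(real \<Rightarrow> real) \<Rightarrow> (real \<Rightarrow> real) \<Rightarrow> real set" where
  "skorohod_close x y =
     {e. 0 \<le> e \<and> (\<exists>f\<in>time_changes. \<forall>t\<in>{0..1}. \<bar>f t - t\<bar> \<le> e \<and> \<bar>x t - y (f t)\<bar> \<le> e)}"

text \<open>
  The value off \<open>cadlag\<close> is irrelevant; it is fixed to be \<open>0\<close> because \<^locale>\<open>Metric_space\<close>
  requires nonnegativity on the whole type.
\<close>

definition skorohod_dist :: "(real \<Rightarrow> real) \<Rightarrow> (real \<Rightarrow> real) \<Rightarrow> real" where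
  "skorohod_dist x y = (if x \<in> cadlag \<and> y \<in> cadlag then Inf (skorohod_close x y) else 0)"

definition skorohod_topology :: "(real \<Rightarrow> real) topology" where
  "skorohod_topology = Metric_space.mtopology cadlag skorohod_dist"

lemma cadlag_bounded:
  assumes "x \<in> cadlag"
  shows "\<exists>B. \<forall>t\<in>{0..1}. \<bar>x t\<bar> \<le> B"
proof -
  have loc: "\<exists>U. open U \<and> t \<in> U \<and> (\<exists>B. \<forall>s\<in>U \<inter> {0..1}. \<bar>x s\<bar> \<le> B)" if t: "t \<in> {0..1}" for t
  proof -
    have "\<exists>B d. d > 0 \<and> (\<forall>s\<in>{t<..<t+d} \<inter> {0..1}. \<bar>x s\<bar> \<le> B)"
    proof (cases "t = 1")
      case True
      then show ?thesis by (intro exI[of _ 0] exI[of _ 1]) auto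
    next
      case False
      then have "(x \<longlongrightarrow> x t) (at_right t)" using assms t by (auto simp: cadlag_def)
      then have "eventually (\<lambda>s. dist (x s) (x t) < 1) (at_right t)" by (rule tendstoD) simp
      then obtain b where b: "b > t" "\<And>s. s > t \<Longrightarrow> s < b \<Longrightarrow> dist (x s) (x t) < 1"
        unfolding eventually_at_right_field by blast
      have "\<bar>x s\<bar> \<le> \<bar>x t\<bar> + 1" if "s \<in> {t<..<t+(b-t)}" for s
        using b(2)[of s] that by (auto simp: dist_real_def)
      then show ?thesis using b(1) by (intro exI[of _ "\<bar>x t\<bar> + 1"] exI[of _ "b - t"]) auto
    qed
    then obtain B1 d1 where 1: "d1 > 0" "\<And>s. s \<in> {t<..<t+d1} \<inter> {0..1} \<Longrightarrow> \<bar>x s\<bar> \<le> B1" by blast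
    have "\<exists>B d. d > 0 \<and> (\<forall>s\<in>{t-d<..<t} \<inter> {0..1}. \<bar>x s\<bar> \<le> B)"
    proof (cases "t = 0")
      case True
      then show ?thesis by (intro exI[of _ 0] exI[of _ 1]) auto
    next
      case False
      then have "t \<in> {0<..1}" using t by simp
      then obtain l where "(x \<longlongrightarrow> l) (at_left t)" using assms unfolding cadlag_def by blast
      then have "eventually (\<lambda>s. dist (x s) l < 1) (at_left t)" by (rule tendstoD) simp
      then obtain b where b: "b < t" "\<And>s. s > b \<Longrightarrow> s < t \<Longrightarrow> dist (x s) l < 1"
        unfolding eventually_at_left_field by blast
      have "\<bar>x s\<bar> \<le> \<bar>l\<bar> + 1" if "s \<in> {t-(t-b)<..<t}" for s
        using b(2)[of s] that by (auto simp: dist_real_def)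
      then show ?thesis using b(1) by (intro exI[of _ "\<bar>l\<bar> + 1"] exI[of _ "t - b"]) auto
    qed
    then obtain B2 d2 where 2: "d2 > 0" "\<And>s. s \<in> {t-d2<..<t} \<inter> {0..1} \<Longrightarrow> \<bar>x s\<bar> \<le> B2" by blast
    have "\<bar>x s\<bar> \<le> max (max B1 B2) \<bar>x t\<bar>" if "s \<in> {t-d2<..<t+d1} \<inter> {0..1}" for s
      using 1(2)[of s] 2(2)[of s] that by (cases s t rule: linorder_cases) auto
    then show ?thesis using 1(1) 2(1)
      by (intro exI[of _ "{t-d2<..<t+d1}"] conjI exI[of _ "max (max B1 B2) \<bar>x t\<bar>"] ballI) auto
  qed
  then obtain U where U: "\<And>t. t \<in> {0..1} \<Longrightarrow> open (U t) \<and> t \<in> U t \<and> (\<exists>B. \<forall>s\<in>U t \<inter> {0..1}. \<bar>x s\<bar> \<le> B)"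
    by metis
  then obtain C where C: "\<And>t s. t \<in> {0..1} \<Longrightarrow> s \<in> U t \<Longrightarrow> s \<in> {0..1} \<Longrightarrow> \<bar>x s\<bar> \<le> C t"
    by (metis IntI)
  have "compact {0..1::real}" by simp
  then obtain D where D: "D \<subseteq> {0..1}" "finite D" "{0..1} \<subseteq> (\<Union>t\<in>D. U t)"
    by (rule compactE_image[of _ "{0..1}" U]) (use U in auto)
  have "\<bar>x s\<bar> \<le> (\<Sum>t\<in>D. \<bar>C t\<bar>)" if s: "s \<in> {0..1}" for s
  proof -
    obtain t where t: "t \<in> D" "s \<in> U t" using D s by blast
    have "\<bar>x s\<bar> \<le> \<bar>C t\<bar>" using C[of t s] t s D by force
    also have "\<dots> \<le> (\<Sum>t\<in>D. \<bar>C t\<bar>)" by (rule member_le_sum) (use t D in auto)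
    finally show ?thesis .
  qed
  then show ?thesis by blast
qed

lemma time_changes_id: "(\<lambda>t. t) \<in> time_changes"
  by (auto simp: time_changes_def strict_mono_on_def)

lemma time_changes_comp: "f \<in> time_changes \<Longrightarrow> g \<in> time_changes \<Longrightarrow> (\<lambda>t. g (f t)) \<in> time_changes"
proof -
  assume f: "f \<in> time_changes" and g: "g \<in> time_changes"
  have "strict_mono_on {0..1} (\<lambda>t. g (f t))"
  proof (rule strict_mono_onI)
    fix r s :: real assume rs: "r \<in> {0..1}" "s \<in> {0..1}" "r < s"
    have sm: "strict_mono_on {0..1} f" "strict_mono_on {0..1} g" and "f ` {0..1} = {0..1}"
      using f g by (simp_all add: time_changes_def)
    then have "f r \<in> {0..1}" "f s \<in> {0..1}" using rs(1,2) by blast+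
    then show "g (f r) < g (f s)"
      using strict_mono_onD[OF sm(2)] strict_mono_onD[OF sm(1) rs] by metis
  qed
  moreover have "continuous_on {0..1} (\<lambda>t. g (f t))"
  proof (rule continuous_on_compose2[of "{0..1}" g "{0..1}" f])
    show "continuous_on {0..1} g" "continuous_on {0..1} f" "f ` {0..1} \<subseteq> {0..1}"
      using f g by (simp_all add: time_changes_def)
  qed
  moreover have "(\<lambda>t. g (f t)) ` {0..1} = {0..1}"
    using f g image_image[of g f "{0..1}"] unfolding time_changes_def by simp
  ultimately show ?thesis by (simp add: time_changes_def)
qed

lemma time_changes_inv:
  assumes "f \<in> time_changes"
  obtains g where "g \<in> time_changes" "\<And>t. t \<in> {0..1} \<Longrightarrow> f (g t) = t" "\<And>t. t \<in> {0..1} \<Longrightarrow> g (f t) = t"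
proof
  let ?g = "the_inv_into {0..1} f"
  have sm: "strict_mono_on {0..1} f" and c: "continuous_on {0..1} f" and im: "f ` {0..1} = {0..1}"
    using assms by (auto simp: time_changes_def)
  have inj: "inj_on f {0..1}" using sm by (rule strict_mono_on_imp_inj_on)
  show gf: "\<And>t. t \<in> {0..1} \<Longrightarrow> ?g (f t) = t" by (rule the_inv_into_f_f[OF inj])
  show fg: "\<And>t. t \<in> {0..1} \<Longrightarrow> f (?g t) = t" by (rule f_the_inv_into_f[OF inj]) (simp add: im)
  have gim: "?g ` {0..1} = {0..1}" using the_inv_into_onto[OF inj] im by simp
  have "continuous_on {0..1} ?g" using continuous_on_inv_into[OF c _ inj] im by simp
  moreover have "strict_mono_on {0..1} ?g"
  proof (rule strict_mono_onI)
    fix r s :: real assume rs: "r \<in> {0..1}" "s \<in> {0..1}" "r < s"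
    have m: "?g r \<in> {0..1}" "?g s \<in> {0..1}" using rs gim by blast+
    show "?g r < ?g s"
    proof (rule ccontr)
      assume "\<not> ?g r < ?g s"
      then have "?g s \<le> ?g r" by simp
      then have "f (?g s) \<le> f (?g r)"
        using strict_mono_on_leD[OF sm m(2) m(1)] by simp
      then show False using rs fg by simp
    qed
  qed
  ultimately show "?g \<in> time_changes" using gim by (simp add: time_changes_def)
qed

lemma skorohod_close_sym: "e \<in> skorohod_close x y \<Longrightarrow> e \<in> skorohod_close y x"
proof -
  assume "e \<in> skorohod_close x y"
  then obtain f where e: "0 \<le> e" and f: "f \<in> time_changes"
    and h: "\<And>t. t \<in> {0..1} \<Longrightarrow> \<bar>f t - t\<bar> \<le> e \<and> \<bar>x t - y (f t)\<bar> \<le> e"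
    by (auto simp: skorohod_close_def)
  obtain g where g: "g \<in> time_changes" "\<And>t. t \<in> {0..1} \<Longrightarrow> f (g t) = t"
    using time_changes_inv[OF f] by metis
  have "\<bar>g t - t\<bar> \<le> e \<and> \<bar>y t - x (g t)\<bar> \<le> e" if t: "t \<in> {0..1}" for t
  proof -
    have "g t \<in> {0..1}" using g(1) t by (auto simp: time_changes_def)
    from h[OF this] show ?thesis using g(2)[OF t] by (simp add: abs_minus_commute)
  qed
  with e show ?thesis unfolding skorohod_close_def
    by (intro CollectI conjI bexI[OF _ g(1)] ballI) auto
qed

lemma skorohod_close_trans:
  assumes "e \<in> skorohod_close x y" "e' \<in> skorohod_close y z"
  shows "e + e' \<in> skorohod_close x z"
proof -
  obtain f where e: "0 \<le> e" and f: "f \<in> time_changes"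
    and h: "\<And>t. t \<in> {0..1} \<Longrightarrow> \<bar>f t - t\<bar> \<le> e \<and> \<bar>x t - y (f t)\<bar> \<le> e"
    using assms(1) by (auto simp: skorohod_close_def)
  obtain g where e': "0 \<le> e'" and g: "g \<in> time_changes"
    and k: "\<And>t. t \<in> {0..1} \<Longrightarrow> \<bar>g t - t\<bar> \<le> e' \<and> \<bar>y t - z (g t)\<bar> \<le> e'"
    using assms(2) by (auto simp: skorohod_close_def)
  have "\<bar>g (f t) - t\<bar> \<le> e + e' \<and> \<bar>x t - z (g (f t))\<bar> \<le> e + e'" if t: "t \<in> {0..1}" for t
  proof -
    have "f t \<in> {0..1}" using f t by (auto simp: time_changes_def)
    from h[OF t] k[OF this] show ?thesis by linarith
  qed
  then show ?thesis unfolding skorohod_close_def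
    using e e' by (intro CollectI conjI bexI[OF _ time_changes_comp[OF f g]] ballI) auto
qed

lemma skorohod_close_nonempty:
  assumes "x \<in> cadlag" "y \<in> cadlag"
  shows "skorohod_close x y \<noteq> {}"
proof -
  obtain B C where B: "\<And>t. t \<in> {0..1} \<Longrightarrow> \<bar>x t\<bar> \<le> B" and C: "\<And>t. t \<in> {0..1} \<Longrightarrow> \<bar>y t\<bar> \<le> C"
    using assms cadlag_bounded by meson
  have "\<bar>B\<bar> + \<bar>C\<bar> \<in> skorohod_close x y"
    unfolding skorohod_close_def
  proof (intro CollectI conjI bexI[OF _ time_changes_id] ballI)
    fix t :: real assume "t \<in> {0..1}"
    from B[OF this] C[OF this] show "\<bar>x t - y t\<bar> \<le> \<bar>B\<bar> + \<bar>C\<bar>" by linarith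
  qed auto
  then show ?thesis by blast
qed

lemma skorohod_close_bdd: "bdd_below (skorohod_close x y)"
  by (rule bdd_belowI[of _ 0]) (simp add: skorohod_close_def)

lemma skorohod_close_lt:
  assumes "x \<in> cadlag" "y \<in> cadlag" "skorohod_dist x y < e"
  obtains e' where "e' \<in> skorohod_close x y" "e' < e"
  using assms cInf_lessD[OF skorohod_close_nonempty[OF assms(1,2)]]
  by (auto simp: skorohod_dist_def)

lemma skorohod_dist_le:
  assumes "x \<in> cadlag" "y \<in> cadlag" "e \<in> skorohod_close x y"
  shows "skorohod_dist x y \<le> e"
  using assms by (auto simp: skorohod_dist_def intro!: cInf_lower skorohod_close_bdd)

lemma skorohod_dist_nonneg: "0 \<le> skorohod_dist x y"
  using skorohod_close_nonempty[of x y]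
  by (auto simp: skorohod_dist_def skorohod_close_def intro!: cInf_greatest)

lemma skorohod_dist_eq_0D:
  assumes x: "x \<in> cadlag" and y: "y \<in> cadlag" and d: "skorohod_dist x y = 0"
  shows "x = y"
proof
  fix t :: real
  consider "t \<notin> {0..1}" | "t = 1" | "t \<in> {0..<1}"
    by (metis atLeastAtMost_iff atLeastLessThan_iff less_le)
  then show "x t = y t"
  proof cases
    case 1
    then show ?thesis using x y by (simp add: cadlag_def extensional_def)
  next
    case 2
    have "\<bar>x 1 - y 1\<bar> \<le> e" if e: "e > 0" for e
    proof -
      obtain e' where e': "e' \<in> skorohod_close x y" "e' < e"
        using skorohod_close_lt[OF x y] d e by metis
      then obtain f where f: "f \<in> time_changes" and h: "\<bar>x 1 - y (f 1)\<bar> \<le> e'"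
        by (fastforce simp: skorohod_close_def)
      have sm: "strict_mono_on {0..1} f" and im: "f ` {0..1} = {0..1}"
        using f by (auto simp: time_changes_def)
      have "(1::real) \<in> f ` {0..1}" using im by simp
      then obtain s where s: "s \<in> {0..1}" "f s = 1" by (metis imageE)
      have "f 1 \<in> f ` {0..1}" by (rule imageI) simp
      then have "f 1 \<le> 1" using im by simp
      then have "s = 1" using s strict_mono_onD[OF sm s(1), of 1] by (cases "s < 1") simp_all
      then have "f 1 = 1" using s(2) by simp
      then show ?thesis using h e' by simp
    qed
    then have "\<bar>x 1 - y 1\<bar> \<le> 0" by (rule field_le_epsilon) simp
    then show ?thesis using 2 by simp
  next
    case 3
    have "\<bar>x t - y t\<bar> \<le> e" if e: "e > 0" for e
    proof -
      have "(x \<longlongrightarrow> x t) (at_right t)" "(y \<longlongrightarrow> y t) (at_right t)"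
        using x y 3 by (auto simp: cadlag_def)
      then have "eventually (\<lambda>s. dist (x s) (x t) < e/3 \<and> dist (y s) (y t) < e/3) (at_right t)"
        using e by (intro eventually_conj tendstoD) auto
      then obtain b where b: "b > t"
        "\<And>s. s > t \<Longrightarrow> s < b \<Longrightarrow> \<bar>x s - x t\<bar> < e/3 \<and> \<bar>y s - y t\<bar> < e/3"
        unfolding eventually_at_right_field dist_real_def by metis
      define r where "r = min ((b - t)/2) ((1 - t)/2)"
      have r: "r > 0" "t + r < 1" "t + 2*r \<le> b" using b 3 unfolding r_def by (auto simp: min_def field_simps)
      define s where "s = t + r"
      have s: "s \<in> {0..1}" "t < s" "s < b" using r 3 by (auto simp: s_def)
      obtain e' where e': "e' \<in> skorohod_close x y" "e' < min (e/3) r"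
        using skorohod_close_lt[OF x y, of "min (e/3) r"] d e r by auto
      then obtain f where h: "\<bar>f s - s\<bar> \<le> e'" "\<bar>x s - y (f s)\<bar> \<le> e'"
        using s unfolding skorohod_close_def by blast
      have "t < f s" "f s < b" using h e' r s_def by linarith+
      then show ?thesis using b(2)[of s] b(2)[of "f s"] s h e' by linarith
    qed
    then have "\<bar>x t - y t\<bar> \<le> 0" by (rule field_le_epsilon) simp
    then show ?thesis by simp
  qed
qed

lemma Metric_space_skorohod: "Metric_space cadlag skorohod_dist"
proof
  fix x y z
  show "0 \<le> skorohod_dist x y" by (rule skorohod_dist_nonneg)
  have "skorohod_close x y = skorohod_close y x" using skorohod_close_sym by blast
  then show "skorohod_dist x y = skorohod_dist y x" by (simp add: skorohod_dist_def)
  show "skorohod_dist x y = 0 \<longleftrightarrow> x = y" if xy: "x \<in> cadlag" "y \<in> cadlag"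
  proof
    assume "x = y"
    then have "0 \<in> skorohod_close x y"
      by (auto simp: skorohod_close_def intro!: bexI[OF _ time_changes_id])
    then show "skorohod_dist x y = 0"
      using skorohod_dist_le[OF xy] skorohod_dist_nonneg[of x y] by force
  qed (rule skorohod_dist_eq_0D[OF xy])
  show "skorohod_dist x z \<le> skorohod_dist x y + skorohod_dist y z"
    if m: "x \<in> cadlag" "y \<in> cadlag" "z \<in> cadlag"
  proof (rule field_le_epsilon)
    fix e :: real assume e: "0 < e"
    obtain a where a: "a \<in> skorohod_close x y" "a < skorohod_dist x y + e/2"
      using skorohod_close_lt[OF m(1,2), of "skorohod_dist x y + e/2"] e by auto
    obtain b where b: "b \<in> skorohod_close y z" "b < skorohod_dist y z + e/2"
      using skorohod_close_lt[OF m(2,3), of "skorohod_dist y z + e/2"] e by auto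
    have "skorohod_dist x z \<le> a + b"
      by (rule skorohod_dist_le[OF m(1,3) skorohod_close_trans[OF a(1) b(1)]])
    then show "skorohod_dist x z \<le> skorohod_dist x y + skorohod_dist y z + e" using a b by simp
  qed
qed

interpretation skorohod: Metric_space cadlag skorohod_dist
  by (rule Metric_space_skorohod)

definition borel_of :: "'a topology \<Rightarrow> 'a measure" where
  "borel_of T = sigma (topspace T) {U. openin T U}"

text \<open>
  The random elements may live on different probability spaces; their measurability is part of
  the notion.
\<close>

definition converges_in_law ::
    "'c topology \<Rightarrow> (nat \<Rightarrow> 'a measure) \<Rightarrow> (nat \<Rightarrow> 'a \<Rightarrow> 'c) \<Rightarrow> 'b measure \<Rightarrow> ('b \<Rightarrow> 'c) \<Rightarrow> bool" where
  "converges_in_law T M Y W Z \<longleftrightarrow>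
     (\<forall>n. prob_space (M n) \<and> Y n \<in> M n \<rightarrow>\<^sub>M borel_of T) \<and>
     prob_space W \<and> Z \<in> W \<rightarrow>\<^sub>M borel_of T \<and>
     (\<forall>f. continuous_map T euclideanreal f \<and> bounded (f ` topspace T) \<longrightarrow>
        (\<lambda>n. \<integral>\<omega>. f (Y n \<omega>) \<partial>M n) \<longlonglongrightarrow> (\<integral>\<omega>. f (Z \<omega>) \<partial>W))"

definition fdd_converges ::
    "real set \<Rightarrow> (nat \<Rightarrow> 'a measure) \<Rightarrow> (nat \<Rightarrow> real \<Rightarrow> 'a \<Rightarrow> real) \<Rightarrow> 'b measure \<Rightarrow> (real \<Rightarrow> 'b \<Rightarrow> real) \<Rightarrow> bool"
  where
  "fdd_converges I M Y W Z \<longleftrightarrow>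
     (\<forall>J. finite J \<and> J \<subseteq> I \<longrightarrow>
        converges_in_law (product_topology (\<lambda>_. euclideanreal) J)
          M (\<lambda>n \<omega>. \<lambda>t\<in>J. Y n t \<omega>) W (\<lambda>\<omega>. \<lambda>t\<in>J. Z t \<omega>))"

definition skorohod_converges ::
    "(nat \<Rightarrow> 'a measure) \<Rightarrow> (nat \<Rightarrow> real \<Rightarrow> 'a \<Rightarrow> real) \<Rightarrow> 'b measure \<Rightarrow> (real \<Rightarrow> 'b \<Rightarrow> real) \<Rightarrow> bool"
  where
  "skorohod_converges M Y W Z \<longleftrightarrow>
     converges_in_law skorohod_topology
       M (\<lambda>n \<omega>. \<lambda>t\<in>{0..1}. Y n t \<omega>) W (\<lambda>\<omega>. \<lambda>t\<in>{0..1}. Z t \<omega>)"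

end

theory Submission
  imports Defs
begin

text \<open>
  For fixed \<open>N\<close> the central limit theorem gives a centred Gaussian vector with the covariance of one
  annealed walk. Under \<open>\<mu>\<^sub>H\<close> the steps have correlation \<open>r(n) = \<integral> (2p - 1)\<^sup>n d\<mu>\<^sub>H\<close>, a Beta integral equal
  to \<open>n! / (3 - 2H)\<^sub>n\<close> with a rising factorial in the denominator; summing twice gives a closed form
  for the variance, asymptotic to \<open>N\<^bsup>2H\<^esup> / c\<^sub>H\<^sup>2\<close>, and stationarity of the increments turns this into
  the covariance of fractional Brownian motion. Since \<open>2H > 1\<close>, second moments alone bound the
  oscillation of the limiting walks, by dyadic chaining. Because the limit has continuous paths,
  discretising at the times \<open>j/k\<close> then reduces Skorohod convergence to convergence of
  finite-dimensional distributions, and it is enough to test against bounded Lipschitz functions.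
\<close>

section \<open>The Skorohod metric and convergence in law\<close>

text \<open>\<open>crw_law\<close> is a definite description, so no moment can be computed before
  the law is shown to exist and to be unique. The witness is an explicit function of
  \<open>p\<close> and of independent uniform variables, jointly measurable; hence the mixture is
  the image of a product measure, and Fubini reduces annealed moments to those for fixed
  \<open>p\<close>, where each further step multiplies the correlation by the mean
  \<open>2 * p - 1\<close> of an independent sign.

  The intermediate processes are existentially quantified, so a convenient realisation may be
  chosen: finite linear combinations of independent standard normals, with coefficients read off
  from the walk, whose positions up to time \<open>N\<close> take finitely many values.

  In the chaining, passing from a block to its double adds the bounds of both halves, a factor 2.
  The variance over the doubled block grows by \<open>q = 2 powr (2 * H) > 2\<close>, which beats
  this factor. Over all cells of the \<open>k\<close>-grid the mean squared oscillation is then of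
  order \<open>k powr (1 - 2 * H)\<close>, uniformly in \<open>N \<ge> k\<close>, so that
  \<open>k\<close> can be fixed before \<open>N\<close> tends to infinity.\<close>

lemma skorohod_dist_le_sup:
  assumes "x \<in> cadlag" "y \<in> cadlag" "0 \<le> e" "\<And>t. t \<in> {0..1} \<Longrightarrow> \<bar>x t - y t\<bar> \<le> e"
  shows "skorohod_dist x y \<le> e"
  by (rule skorohod_dist_le)
    (use assms in \<open>auto simp: skorohod_close_def intro!: bexI[OF _ time_changes_id]\<close>)

text \<open>Cell \<open>[j/k, (j+1)/k)\<close> carries the value \<open>y j\<close>, and
  \<open>t = 1\<close> reads \<open>y k\<close>. With \<open>k = N\<close> this is the rescaled
  walk, with fixed \<open>k\<close> its discretisation on the grid; taking the whole sequence
  \<open>y\<close> as argument lets measurability be inherited from a continuous map.\<close>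

definition step_path :: "nat \<Rightarrow> (nat \<Rightarrow> real) \<Rightarrow> real \<Rightarrow> real" where
  "step_path k y = (\<lambda>t\<in>{0..1}. y (nat \<lfloor>real k * t\<rfloor>))"

lemma step_path_cadlag: "step_path k y \<in> cadlag"
proof (cases "k = 0")
  case True
  have "(step_path k y \<longlongrightarrow> l) F" if "l = y 0" "eventually (\<lambda>s. s \<in> {0..1}) F" for F l
    by (rule tendsto_eventually, rule eventually_mono[OF that(2)]) (use that True in \<open>simp add: step_path_def\<close>)
  moreover have "eventually (\<lambda>s. s \<in> {0..1}) (at_right t)" if "t \<in> {0..<1}" for t :: real
    unfolding eventually_at_right_field using that by (intro exI[of _ 1]) auto
  moreover have "eventually (\<lambda>s. s \<in> {0..1}) (at_left t)" if "t \<in> {0<..1}" for t :: real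
    unfolding eventually_at_left_field using that by (intro exI[of _ 0]) auto
  ultimately show ?thesis using True
    unfolding cadlag_def by (auto simp: step_path_def intro!: exI[of _ "y 0"])
next
  case False
  have "(step_path k y \<longlongrightarrow> step_path k y t) (at_right t)" if t: "t \<in> {0..<1}" for t
  proof (rule tendsto_eventually, unfold eventually_at_right_field, intro exI conjI allI impI)
    let ?b = "min 1 ((of_int \<lfloor>real k * t\<rfloor> + 1) / real k)"
    show "t < ?b" using t False
      by (auto simp: field_simps) linarith
    fix s assume "t < s" "s < ?b"
    then have s: "s \<in> {0..1}" and "real k * t \<le> real k * s" "real k * s < of_int \<lfloor>real k * t\<rfloor> + 1"
      using t False by (auto simp: field_simps)
    then have "\<lfloor>real k * s\<rfloor> = \<lfloor>real k * t\<rfloor>" by linarith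
    then show "step_path k y s = step_path k y t" using s t by (simp add: step_path_def)
  qed
  \<comment> \<open>At a grid point the left limit is the value of the cell that ends there, hence
    the ceiling minus one.\<close>
  moreover have "(step_path k y \<longlongrightarrow> y (nat (\<lceil>real k * t\<rceil> - 1))) (at_left t)" if t: "t \<in> {0<..1}" for t
  proof (rule tendsto_eventually, unfold eventually_at_left_field, intro exI conjI allI impI)
    let ?b = "max 0 ((of_int \<lceil>real k * t\<rceil> - 1) / real k)"
    show "?b < t" using t False
      by (auto simp: field_simps) linarith
    fix s assume "?b < s" "s < t"
    then have s: "s \<in> {0..1}" and "real k * s < real k * t" "real k * s > of_int \<lceil>real k * t\<rceil> - 1"
      using t False by (auto simp: field_simps)
    then have "\<lfloor>real k * s\<rfloor> = \<lceil>real k * t\<rceil> - 1" by linarith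
    then show "step_path k y s = y (nat (\<lceil>real k * t\<rceil> - 1))" using s t by (simp add: step_path_def)
  qed
  ultimately show ?thesis by (fastforce simp: cadlag_def step_path_def)
qed

lemma continuous_on_restrict_cadlag:
  fixes x :: "real \<Rightarrow> real"
  assumes "continuous_on {0..1} x"
  shows "restrict x {0..1} \<in> cadlag"
proof -
  have c: "continuous_on {0..1} (restrict x {0..1})"
    by (rule continuous_on_eq[OF assms]) simp
  have lim: "(restrict x {0..1} \<longlongrightarrow> restrict x {0..1} t) (at t within {0..1})" if "t \<in> {0..1}" for t
    using c that unfolding continuous_on by blast
  have "(restrict x {0..1} \<longlongrightarrow> restrict x {0..1} t) (at_right t)" if "t \<in> {0..<1}" for t
    using tendsto_within_subset[OF lim[of t], of "{t..1}"] that
      at_within_Icc_at_right[of t 1] by auto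
  moreover have "(restrict x {0..1} \<longlongrightarrow> restrict x {0..1} t) (at_left t)" if "t \<in> {0<..1}" for t
    using tendsto_within_subset[OF lim[of t], of "{0..t}"] that
      at_within_Icc_at_left[of 0 t] by auto
  ultimately show ?thesis unfolding cadlag_def by blast
qed

text \<open>Only the coordinates \<open>0..k\<close> matter, and a uniform bound on them bounds the
  distance, so a neighbourhood restricting finitely many coordinates suffices. Every random path
  below is measurable by this lemma or as a limit of such paths.\<close>

lemma continuous_map_step_path: "continuous_map euclidean skorohod_topology (step_path k)"
  unfolding skorohod_topology_def skorohod.continuous_map_to_metric
proof (intro ballI allI impI)
  fix y :: "nat \<Rightarrow> real" and e :: real assume e: "e > 0"
  let ?U = "\<Inter>j\<in>{..k}. (\<lambda>z. z j) -` ball (y j) (e/2)"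
  have "open ((\<lambda>z::nat \<Rightarrow> real. z j) -` ball (y j) (e/2))" for j
    by (intro open_vimage continuous_on_product_coordinates open_ball)
  then have "open ?U" by (intro open_INT) auto
  moreover have "y \<in> ?U" using e by simp
  moreover have "step_path k z \<in> skorohod.mball (step_path k y) e" if z: "z \<in> ?U" for z
  proof -
    have "skorohod_dist (step_path k y) (step_path k z) \<le> e/2"
    proof (rule skorohod_dist_le_sup[OF step_path_cadlag step_path_cadlag])
      fix t :: real assume t: "t \<in> {0..1}"
      have "real k * t \<le> real k" using t by (simp add: mult_left_le)
      then have "nat \<lfloor>real k * t\<rfloor> \<in> {..k}" using t by (simp add: floor_le_iff nat_le_iff)
      then have "z \<in> (\<lambda>z. z (nat \<lfloor>real k * t\<rfloor>)) -` ball (y (nat \<lfloor>real k * t\<rfloor>)) (e/2)" using z by blast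
      then show "\<bar>step_path k y t - step_path k z t\<bar> \<le> e/2" using t
        by (simp add: step_path_def dist_real_def)
    qed (use e in simp)
    then show ?thesis using e step_path_cadlag by simp
  qed
  ultimately show "\<exists>U. openin euclidean U \<and> y \<in> U \<and> (\<forall>z\<in>U. step_path k z \<in> skorohod.mball (step_path k y) e)"
    by (intro exI[of _ ?U]) auto
qed

section \<open>Borel sets of a topology and measurable maps into it\<close>

lemma space_borel_of [simp]: "space (borel_of T) = topspace T"
  unfolding borel_of_def by (rule space_measure_of) (auto dest: openin_subset)

lemma sets_borel_of: "sets (borel_of T) = sigma_sets (topspace T) {U. openin T U}"
  unfolding borel_of_def by (rule sets_measure_of) (auto dest: openin_subset)

lemma openin_sets_borel_of: "openin T U \<Longrightarrow> U \<in> sets (borel_of T)"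
  unfolding sets_borel_of by (rule sigma_sets.Basic) simp

lemma measurable_borel_ofI:
  assumes "\<And>x. x \<in> space M \<Longrightarrow> f x \<in> topspace T"
    and "\<And>U. openin T U \<Longrightarrow> f -` U \<inter> space M \<in> sets M"
  shows "f \<in> M \<rightarrow>\<^sub>M borel_of T"
  unfolding borel_of_def
  by (rule measurable_measure_of) (use assms in \<open>auto dest: openin_subset\<close>)

lemma sets_borel_of_euclidean [measurable_cong]: "sets (borel_of euclidean) = sets borel"
  unfolding sets_borel_of sets_borel by simp

lemma continuous_map_borel_of:
  assumes "continuous_map T T' g"
  shows "g \<in> borel_of T \<rightarrow>\<^sub>M borel_of T'"
proof (rule measurable_borel_ofI)
  fix x assume "x \<in> space (borel_of T)"
  then show "g x \<in> topspace T'" using continuous_map_funspace[OF assms] by auto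
next
  fix U assume "openin T' U"
  then have "openin T {x \<in> topspace T. g x \<in> U}" by (rule openin_continuous_map_preimage[OF assms])
  moreover have "{x \<in> topspace T. g x \<in> U} = g -` U \<inter> space (borel_of T)" by auto
  ultimately show "g -` U \<inter> space (borel_of T) \<in> sets (borel_of T)"
    by (metis openin_sets_borel_of)
qed

lemma continuous_map_borel_of_real:
  assumes "continuous_map T euclideanreal f"
  shows "f \<in> borel_measurable (borel_of T)"
  using continuous_map_borel_of[OF assms] measurable_cong_sets[OF refl sets_borel_of_euclidean] by blast

text \<open>For sequences of reals the product sigma-algebra is the Borel one, so measurable
  coordinates suffice; other spaces are reached by a continuous map.\<close>

lemma measurable_euclidean_continuous_map:
  fixes Y :: "'a \<Rightarrow> nat \<Rightarrow> real"
  assumes "\<And>j. (\<lambda>w. Y w j) \<in> borel_measurable M" "continuous_map euclidean T g"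
  shows "(\<lambda>w. g (Y w)) \<in> M \<rightarrow>\<^sub>M borel_of T"
proof -
  have "Y \<in> borel_measurable M"
    by (rule measurable_coordinatewise_then_product) (rule assms(1))
  then have "Y \<in> M \<rightarrow>\<^sub>M borel_of euclidean"
    using measurable_cong_sets[OF refl sets_borel_of_euclidean] by blast
  from measurable_compose[OF this continuous_map_borel_of[OF assms(2)]] show ?thesis .
qed

section \<open>Random elements of a metric space and Lipschitz test functions\<close>

context Metric_space
begin

text \<open>\<open>h w\<close> lies in \<open>U\<close> iff for some \<open>m\<close> the points
  \<open>g k w\<close> are eventually in \<open>V m\<close>, which is a countable combination of
  measurable sets. Used for the paths of fractional Brownian motion, as limits of their
  discretisations.\<close>

lemma borel_of_measurable_LIMSEQ:
  assumes g: "\<And>k. g k \<in> W \<rightarrow>\<^sub>M borel_of mtopology" and h: "\<And>w. w \<in> space W \<Longrightarrow> h w \<in> M"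
    and lim: "\<And>w. w \<in> space W \<Longrightarrow> (\<lambda>k. d (g k w) (h w)) \<longlonglongrightarrow> 0"
  shows "h \<in> W \<rightarrow>\<^sub>M borel_of mtopology"
proof (rule measurable_borel_ofI)
  fix w assume "w \<in> space W" then show "h w \<in> topspace mtopology" using h by simp
next
  fix U assume U: "openin mtopology U"
  \<comment> \<open>The radius is half of what fits into \<open>U\<close>, so that a limit of points
    of \<open>V m\<close> is still inside \<open>U\<close>.\<close>
  define V where "V m = (\<Union>x\<in>{x\<in>M. mball x (2 * inverse (real (Suc m))) \<subseteq> U}. mball x (inverse (real (Suc m))))" for m
  have V: "openin mtopology (V m)" for m unfolding V_def by blast
  have gM: "g k w \<in> M" if "w \<in> space W" for k w
    using measurable_space[OF g that] by simp
  have "h -` U \<inter> space W = (\<Union>m. \<Union>K. \<Inter>k\<in>{K..}. g k -` V m \<inter> space W)"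
  proof (intro equalityI subsetI)
    fix w assume w: "w \<in> h -` U \<inter> space W"
    then obtain r where r: "r > 0" "mball (h w) r \<subseteq> U" using U by (auto simp: openin_mtopology)
    obtain m where m: "inverse (real (Suc m)) < r/2" using reals_Archimedean[of "r/2"] r by auto
    have "h w \<in> M" "mball (h w) (2 * inverse (real (Suc m))) \<subseteq> U"
      using h w r m mball_subset_concentric[of "2 * inverse (real (Suc m))" r "h w"] by auto
    moreover have "eventually (\<lambda>k. d (g k w) (h w) < inverse (real (Suc m))) sequentially"
      using order_tendstoD(2)[OF lim, of w "inverse (real (Suc m))"] w by auto
    then obtain K where "\<forall>k\<ge>K. d (g k w) (h w) < inverse (real (Suc m))"
      unfolding eventually_sequentially by blast
    ultimately have "\<forall>k\<ge>K. g k w \<in> mball (h w) (inverse (real (Suc m)))" using gM w h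
      by (auto simp: commute)
    then have "\<forall>k\<ge>K. g k w \<in> V m" unfolding V_def
      using \<open>h w \<in> M\<close> \<open>mball (h w) (2 * inverse (real (Suc m))) \<subseteq> U\<close> by blast
    then show "w \<in> (\<Union>m. \<Union>K. \<Inter>k\<in>{K..}. g k -` V m \<inter> space W)" using w by blast
  next
    fix w assume "w \<in> (\<Union>m. \<Union>K. \<Inter>k\<in>{K..}. g k -` V m \<inter> space W)"
    then obtain m K where mK: "\<And>k. k \<ge> K \<Longrightarrow> g k w \<in> V m" and w: "w \<in> space W" by auto
    have "eventually (\<lambda>k. d (g k w) (h w) < inverse (real (Suc m))) sequentially"
      using order_tendstoD(2)[OF lim, of w "inverse (real (Suc m))"] w by auto
    then obtain k where k: "k \<ge> K" "d (g k w) (h w) < inverse (real (Suc m))"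
      unfolding eventually_sequentially by (meson nat_le_linear order_trans)
    from mK[OF k(1)] obtain x where x: "x \<in> M" "mball x (2 * inverse (real (Suc m))) \<subseteq> U"
      "d x (g k w) < inverse (real (Suc m))" "g k w \<in> M" unfolding V_def by auto
    have "d x (h w) \<le> d x (g k w) + d (g k w) (h w)"
      using triangle x h w by blast
    then have "h w \<in> mball x (2 * inverse (real (Suc m)))" using x k h w by auto
    then show "w \<in> h -` U \<inter> space W" using x w by auto
  qed
  also have "\<dots> \<in> sets W"
  proof -
    have "g k -` V m \<inter> space W \<in> sets W" for k m
      by (rule measurable_sets[OF g openin_sets_borel_of[OF V]])
    then have "(\<Inter>k\<in>{K..}. g k -` V m \<inter> space W) \<in> sets W" for K :: nat and m
      by (intro sets.countable_INT') auto
    then show ?thesis by blast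
  qed
  finally show "h -` U \<inter> space W \<in> sets W" .
qed

lemma continuous_map_lipschitz:
  assumes "\<And>x y. x \<in> M \<Longrightarrow> y \<in> M \<Longrightarrow> \<bar>f x - f y\<bar> \<le> L * d x y"
  shows "continuous_map mtopology euclideanreal f"
  unfolding continuous_map_def
proof (intro conjI allI impI)
  fix U :: "real set" assume "openin euclideanreal U"
  then have U: "open U" by simp
  show "openin mtopology {x \<in> topspace mtopology. f x \<in> U}"
    unfolding openin_mtopology
  proof (intro conjI allI impI)
    fix x assume x: "x \<in> {x \<in> topspace mtopology. f x \<in> U}"
    then obtain e where e: "e > 0" "ball (f x) e \<subseteq> U" using U openE[of U "f x"] by blast
    have "mball x (e / (\<bar>L\<bar> + 1)) \<subseteq> {x \<in> topspace mtopology. f x \<in> U}"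
    proof
      fix y assume y: "y \<in> mball x (e / (\<bar>L\<bar> + 1))"
      have "\<bar>f x - f y\<bar> \<le> L * d x y" using assms x y by auto
      also have "\<dots> \<le> (\<bar>L\<bar> + 1) * d x y" by (intro mult_right_mono) auto
      also have "\<dots> < e" using y by (auto simp: field_simps)
      finally show "y \<in> {x \<in> topspace mtopology. f x \<in> U}" using e y by (auto simp: dist_real_def)
    qed
    then show "\<exists>r>0. mball x r \<subseteq> {x \<in> topspace mtopology. f x \<in> U}"
      using e by (intro exI[of _ "e / (\<bar>L\<bar> + 1)"]) auto
  qed auto
qed auto

text \<open>The Pasch-Hausdorff envelope of \<open>f\<close> (infimal convolution with
  \<open>m\<close> times the distance): for bounded \<open>f\<close>, the largest
  \<open>m\<close>-Lipschitz function below it.\<close>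

definition lipschitz_minorant :: "('a \<Rightarrow> real) \<Rightarrow> nat \<Rightarrow> 'a \<Rightarrow> real" where
  "lipschitz_minorant f m x = (INF y\<in>M. f y + real m * d x y)"

text \<open>Choosing \<open>y = x\<close> gives the upper bound, the triangle inequality the
  Lipschitz constant. For convergence at \<open>x\<close>, near points have values close to
  \<open>f x\<close> by continuity, and far points are penalised by at least the full range
  \<open>2 * b\<close> once \<open>m\<close> is large.\<close>

lemma lipschitz_minorant:
  assumes b: "\<And>x. x \<in> M \<Longrightarrow> \<bar>f x\<bar> \<le> b"
  shows "\<And>x. x \<in> M \<Longrightarrow> lipschitz_minorant f m x \<le> f x"
    and "\<And>x. x \<in> M \<Longrightarrow> \<bar>lipschitz_minorant f m x\<bar> \<le> b"
    and "\<And>x y. x \<in> M \<Longrightarrow> y \<in> M \<Longrightarrow> \<bar>lipschitz_minorant f m x - lipschitz_minorant f m y\<bar> \<le> real m * d x y"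
    and "\<And>x. continuous_map mtopology euclideanreal f \<Longrightarrow> x \<in> M \<Longrightarrow> (\<lambda>m. lipschitz_minorant f m x) \<longlonglongrightarrow> f x"
proof -
  let ?g = "lipschitz_minorant f"
  have bd: "bdd_below ((\<lambda>y. f y + real m * d x y) ` M)" for x m
  proof (rule bdd_belowI2[of _ "-b"])
    fix y assume "y \<in> M" then show "-b \<le> f y + real m * d x y" using b[of y] nonneg[of x y]
      by (smt (verit) mult_nonneg_nonneg of_nat_0_le_iff)
  qed
  have lower: "-b \<le> ?g m x" if "x \<in> M" for x m
    unfolding lipschitz_minorant_def
  proof (rule cINF_greatest)
    fix y assume "y \<in> M" then show "-b \<le> f y + real m * d x y" using b[of y] nonneg[of x y]
      by (smt (verit) mult_nonneg_nonneg of_nat_0_le_iff)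
  qed (use that in auto)
  have le: "?g m x \<le> f y + real m * d x y" if "y \<in> M" for x y m
    unfolding lipschitz_minorant_def by (rule cINF_lower[OF bd that])
  show up: "?g m x \<le> f x" if "x \<in> M" for x m using le[OF that, of m x] that by simp
  show "\<bar>?g m x\<bar> \<le> b" if "x \<in> M" for x m
    using up[OF that] lower[OF that] b[OF that] by (smt (verit))
  have half: "?g m x \<le> ?g m y + real m * d x y" if "x \<in> M" "y \<in> M" for x y m
  proof -
    have "?g m x - real m * d x y \<le> (INF z\<in>M. f z + real m * d y z)"
    proof (rule cINF_greatest)
      fix z assume z: "z \<in> M"
      have "real m * d x z \<le> real m * (d x y + d y z)" using triangle that z by (intro mult_left_mono) auto
      then show "?g m x - real m * d x y \<le> f z + real m * d y z"
        using le[OF z, of m x] by (simp add: algebra_simps)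
    qed (use that in auto)
    then show ?thesis by (simp add: lipschitz_minorant_def[of f m y])
  qed
  show "\<bar>?g m x - ?g m y\<bar> \<le> real m * d x y" if "x \<in> M" "y \<in> M" for x y m
    using half[OF that, of m] half[OF that(2,1), of m] by (simp add: commute abs_le_iff)
  show "(\<lambda>m. ?g m x) \<longlonglongrightarrow> f x" if f: "continuous_map mtopology euclideanreal f" and x: "x \<in> M" for x
  proof (rule LIMSEQ_I)
    fix e :: real assume e: "e > 0"
    have "openin mtopology {y \<in> topspace mtopology. f y \<in> {f x - e/2<..}}"
      by (rule openin_continuous_map_preimage[OF f]) simp
    then obtain r where r: "r > 0" "mball x r \<subseteq> {y \<in> topspace mtopology. f y \<in> {f x - e/2<..}}"
      using x e unfolding openin_mtopology by auto
    obtain m0 :: nat where m0: "2 * \<bar>b\<bar> / r < real m0" using reals_Archimedean2 by blast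
    have "norm (?g m x - f x) < e" if m: "m \<ge> m0" for m
    proof -
      have "f x - e/2 \<le> ?g m x"
        unfolding lipschitz_minorant_def
      proof (rule cINF_greatest)
        fix y assume y: "y \<in> M"
        show "f x - e/2 \<le> f y + real m * d x y"
        proof (cases "d x y < r")
          case True
          then have "f y > f x - e/2" using r x y by auto
          then show ?thesis using nonneg[of x y] by (smt (verit) mult_nonneg_nonneg of_nat_0_le_iff)
        next
          case False
          have "2 * \<bar>b\<bar> \<le> real m0 * r" using m0 r by (simp add: field_simps)
          also have "\<dots> \<le> real m * d x y" using False m r by (intro mult_mono) auto
          finally show ?thesis using b[OF x] b[OF y] e by linarith
        qed
      qed (use x in auto)
      then show ?thesis using up[OF x, of m] e by (simp add: abs_less_iff)
    qed
    then show "\<exists>m0. \<forall>m\<ge>m0. norm (?g m x - f x) < e" by blast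
  qed
qed

text \<open>Integrals of a Lipschitz minorant bound the lower limit for a continuous
  \<open>f\<close>, and dominated convergence brings this bound up to the integral of
  \<open>f\<close>. Applied to \<open>- f\<close>, the same argument bounds the upper limit.\<close>

lemma converges_in_law_lipschitzI:
  fixes N :: "nat \<Rightarrow> 'b measure" and W :: "'c measure"
  assumes N: "\<And>n. prob_space (N n)" and Y: "\<And>n. Y n \<in> N n \<rightarrow>\<^sub>M borel_of mtopology"
    and W: "prob_space W" and Z: "Z \<in> W \<rightarrow>\<^sub>M borel_of mtopology"
    and lip: "\<And>f b L. L \<ge> 0 \<Longrightarrow> (\<And>x. x \<in> M \<Longrightarrow> \<bar>f x\<bar> \<le> b) \<Longrightarrow>
      (\<And>x y. x \<in> M \<Longrightarrow> y \<in> M \<Longrightarrow> \<bar>f x - f y\<bar> \<le> L * d x y) \<Longrightarrow>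
      (\<lambda>n. \<integral>w. f (Y n w) \<partial>N n) \<longlonglongrightarrow> (LINT w|W. f (Z w))"
  shows "converges_in_law mtopology N Y W Z"
proof -
  have YM: "Y n w \<in> M" if "w \<in> space (N n)" for n w using measurable_space[OF Y that] by simp
  have ZM: "Z w \<in> M" if "w \<in> space W" for w using measurable_space[OF Z that] by simp
  have lower: "eventually (\<lambda>n. (LINT w|N n. f (Y n w)) > (LINT w|W. f (Z w)) - e) sequentially"
    if f: "continuous_map mtopology euclideanreal f" and b: "\<And>x. x \<in> M \<Longrightarrow> \<bar>f x\<bar> \<le> b" and e: "e > 0" for f b e
  proof -
    note lm = lipschitz_minorant[of f b, OF b]
    let ?g = "lipschitz_minorant f"
    have gc: "continuous_map mtopology euclideanreal (?g m)" for m
      using continuous_map_lipschitz[OF lm(3)] by blast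
    have mY: "(\<lambda>w. h (Y n w)) \<in> borel_measurable (N n)"
      if "continuous_map mtopology euclideanreal h" for n and h :: "'a \<Rightarrow> real"
      using measurable_compose[OF Y continuous_map_borel_of_real[OF that]] .
    have mZ: "(\<lambda>w. h (Z w)) \<in> borel_measurable W"
      if "continuous_map mtopology euclideanreal h" for h :: "'a \<Rightarrow> real"
      using measurable_compose[OF Z continuous_map_borel_of_real[OF that]] .
    interpret W: prob_space W by (rule W)
    have "(\<lambda>m. \<integral>w. ?g m (Z w) \<partial>W) \<longlonglongrightarrow> (LINT w|W. f (Z w))"
    proof (rule integral_dominated_convergence[where w = "\<lambda>_. b"])
      show "AE w in W. (\<lambda>m. ?g m (Z w)) \<longlonglongrightarrow> f (Z w)" using lm(4)[OF _ f] ZM by auto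
      show "AE w in W. norm (?g m (Z w)) \<le> b" for m using lm(2) ZM by auto
    qed (use mZ f gc in auto)
    from order_tendstoD(1)[OF this, of "(LINT w|W. f (Z w)) - e/2"]
    obtain m where m: "(LINT w|W. ?g m (Z w)) > (LINT w|W. f (Z w)) - e/2"
      using e eventually_happens'[OF sequentially_bot] by fastforce
    have "(\<lambda>n. \<integral>w. ?g m (Y n w) \<partial>N n) \<longlonglongrightarrow> (LINT w|W. ?g m (Z w))"
      by (rule lip[of "real m" _ b]) (use lm in auto)
    then have "eventually (\<lambda>n. (LINT w|N n. ?g m (Y n w)) > (LINT w|W. f (Z w)) - e) sequentially"
      by (rule order_tendstoD) (use m e in simp)
    then show ?thesis
    proof eventually_elim
      case (elim n)
      interpret prob_space "N n" by (rule N)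
      have "(LINT w|N n. ?g m (Y n w)) \<le> (LINT w|N n. f (Y n w))"
      proof (rule integral_mono)
        show "integrable (N n) (\<lambda>w. ?g m (Y n w))"
          by (rule integrable_const_bound[of _ b]) (use lm YM mY gc in auto)
        show "integrable (N n) (\<lambda>w. f (Y n w))"
          by (rule integrable_const_bound[of _ b]) (use b YM mY f in auto)
      qed (use lm YM in auto)
      then show ?case using elim by simp
    qed
  qed
  have "(\<lambda>n. \<integral>w. f (Y n w) \<partial>N n) \<longlonglongrightarrow> (LINT w|W. f (Z w))"
    if f: "continuous_map mtopology euclideanreal f" and bd: "bounded (f ` topspace mtopology)" for f
  proof -
    obtain b where b: "\<And>x. x \<in> M \<Longrightarrow> \<bar>f x\<bar> \<le> b" using bd by (auto simp: bounded_iff)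
    have f': "continuous_map mtopology euclideanreal (\<lambda>x. - f x)"
      using f by (rule continuous_map_minus)
    show ?thesis
    proof (rule LIMSEQ_I)
      fix e :: real assume e: "e > 0"
      have "eventually (\<lambda>n. norm ((LINT w|N n. f (Y n w)) - (LINT w|W. f (Z w))) < e) sequentially"
        using lower[OF f b e] lower[OF f' _ e, of b] b by (auto elim: eventually_elim2 simp: abs_less_iff)
      then show "\<exists>n0. \<forall>n\<ge>n0. norm ((LINT w|N n. f (Y n w)) - (LINT w|W. f (Z w))) < e"
        by (simp add: eventually_sequentially)
    qed
  qed
  then show ?thesis unfolding converges_in_law_def using N Y W Z by auto
qed

end

section \<open>Levy continuity in several dimensions\<close>

text \<open>A real substitute for complex exponentials: the phase \<open>b\<close> covers sines and
  constants, and product-to-sum formulas make the set an algebra, so the real Stone-Weierstrass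
  theorem applies.\<close>

inductive_set trig_span :: "'i set \<Rightarrow> (('i \<Rightarrow> real) \<Rightarrow> real) set" for J where
  cos: "(\<lambda>x. c * cos ((\<Sum>j\<in>J. a j * x j) + b)) \<in> trig_span J"
| add: "f \<in> trig_span J \<Longrightarrow> g \<in> trig_span J \<Longrightarrow> (\<lambda>x. f x + g x) \<in> trig_span J"

lemma trig_span_mult:
  assumes "f \<in> trig_span J" "g \<in> trig_span J"
  shows "(\<lambda>x. f x * g x) \<in> trig_span J"
proof -
  have prod_to_sum: "(c * c' / 2) * cos (u + v) + (c * c' / 2) * cos (u - v) = c * cos u * (c' * cos v)"
    for c c' u v :: real
    by (simp add: cos_add cos_diff field_simps)
  from assms(1) show ?thesis
  proof induction
    case (cos c a b)
    from assms(2) show ?case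
    proof induction
      case (cos c' a' b')
      have "(\<lambda>x. (c * c' / 2) * cos ((\<Sum>j\<in>J. (a j + a' j) * x j) + (b + b')) +
           (c * c' / 2) * cos ((\<Sum>j\<in>J. (a j - a' j) * x j) + (b - b'))) \<in> trig_span J"
        by (intro trig_span.intros)
      also have "(\<lambda>x. (c * c' / 2) * cos ((\<Sum>j\<in>J. (a j + a' j) * x j) + (b + b')) +
           (c * c' / 2) * cos ((\<Sum>j\<in>J. (a j - a' j) * x j) + (b - b'))) =
         (\<lambda>x. c * cos ((\<Sum>j\<in>J. a j * x j) + b) * (c' * cos ((\<Sum>j\<in>J. a' j * x j) + b')))"
      proof
        fix x
        let ?u = "(\<Sum>j\<in>J. a j * x j) + b" and ?v = "(\<Sum>j\<in>J. a' j * x j) + b'"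
        have u: "(\<Sum>j\<in>J. (a j + a' j) * x j) + (b + b') = ?u + ?v"
          by (simp add: algebra_simps sum.distrib)
        have v: "(\<Sum>j\<in>J. (a j - a' j) * x j) + (b - b') = ?u - ?v"
          by (simp add: algebra_simps sum_subtractf)
        show "(c * c' / 2) * cos ((\<Sum>j\<in>J. (a j + a' j) * x j) + (b + b')) +
           (c * c' / 2) * cos ((\<Sum>j\<in>J. (a j - a' j) * x j) + (b - b')) = c * cos ?u * (c' * cos ?v)"
          unfolding u v by (rule prod_to_sum)
      qed
      finally show ?case .
    next
      case (add f g)
      then show ?case by (simp add: distrib_left trig_span.add)
    qed
  next
    case (add f g)
    then show ?case by (simp add: distrib_right trig_span.add)
  qed
qed

lemma trig_span_const: "(\<lambda>x. c) \<in> trig_span J"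
  using trig_span.cos[of c "\<lambda>_. 0" J 0] by simp

lemma trig_span_sin:
  assumes "finite J" "j \<in> J"
  shows "(\<lambda>x. sin (k * x j)) \<in> trig_span J"
proof -
  have "(\<Sum>i\<in>J. (if i = j then k else 0) * x i) = k * x j" for x
  proof -
    have "(\<Sum>i\<in>J. (if i = j then k else 0) * x i) = (\<Sum>i\<in>J. if i = j then k * x i else 0)"
      by (intro sum.cong) auto
    then show ?thesis using assms by simp
  qed
  then have "(\<lambda>x. 1 * cos ((\<Sum>i\<in>J. (if i = j then k else 0) * x i) + (- pi/2))) = (\<lambda>x. sin (k * x j))"
    by (simp add: cos_diff)
  then show ?thesis using trig_span.cos[of 1 "\<lambda>i. if i = j then k else 0" J "-pi/2"] by simp
qed

text \<open>
  Polynomials in the \<open>sin (k x\<^sub>j)\<close> are trigonometric sums; precomposing with \<open>arcsin\<close> turns the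
  approximation of \<open>f\<close> on the box into Stone--Weierstrass on a compact cube, with a bound that is
  valid on the whole space.
\<close>

lemma trig_span_approx:
  fixes f :: "('i::countable \<Rightarrow> real) \<Rightarrow> real"
  assumes J: "finite J" and f: "continuous_on UNIV f"
    and dep: "\<And>x y. (\<And>j. j \<in> J \<Longrightarrow> x j = y j) \<Longrightarrow> f x = f y"
    and B: "\<And>x. \<bar>f x\<bar> \<le> B" and L: "L > 0" and e: "e > 0"
  obtains h where "h \<in> trig_span J" "\<And>x. \<bar>h x\<bar> \<le> B + e"
    "\<And>x. (\<And>j. j \<in> J \<Longrightarrow> \<bar>x j\<bar> \<le> L) \<Longrightarrow> \<bar>f x - h x\<bar> \<le> e"
proof -
  \<comment> \<open>With this frequency the box of half-width \<open>L\<close> goes to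
    \<open>[-pi/2, pi/2]\<close>, the range on which \<open>arcsin\<close> inverts
    \<open>sin\<close>.\<close>
  define k where "k = pi / (2 * L)"
  have k: "k > 0" using L by (simp add: k_def)
  \<comment> \<open>Coordinates outside \<open>J\<close> are frozen at 0, so that the coordinates in
    \<open>J\<close> separate the points of \<open>S\<close>.\<close>
  define S :: "('i \<Rightarrow> real) set" where "S = PiE UNIV (\<lambda>j. if j \<in> J then {-1..1} else {0})"
  have S: "compact S"
  proof -
    have "compactin (product_topology (\<lambda>_::'i. euclideanreal) UNIV) S"
      unfolding S_def compactin_PiE by (auto simp: compactin_euclidean_iff)
    then show ?thesis by (simp add: euclidean_product_topology)
  qed
  have S_range: "y j \<in> {-1..1}" if "y \<in> S" for y j
    using PiE_mem[OF that[unfolded S_def] UNIV_I, of j] by (auto split: if_splits)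
  define u where "u x = (\<lambda>j. if j \<in> J then sin (k * x j) else 0)" for x :: "'i \<Rightarrow> real"
  have uS: "u x \<in> S" for x by (auto simp: u_def S_def)
  define P where "P g \<longleftrightarrow> continuous_on S g \<and> (\<lambda>x. g (u x)) \<in> trig_span J" for g
  define F where "F y = f (\<lambda>j. arcsin (y j) / k)" for y
  have Fc: "continuous_on S F"
    unfolding F_def
  proof (rule continuous_on_compose2[OF f])
    have "continuous_on S (\<lambda>y. arcsin (y j) / k)" for j
      using k S_range
      by (intro continuous_on_divide continuous_on_arcsin continuous_on_const
          continuous_on_subset[OF continuous_on_product_coordinates]) force+
    then show "continuous_on S (\<lambda>y j. arcsin (y j) / k)"
      by (rule continuous_on_coordinatewise_then_product)
  qed simp
  have "\<exists>g. P g \<and> (\<forall>y\<in>S. \<bar>F y - g y\<bar> < e)"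
  proof (rule Stone_Weierstrass_HOL[OF S])
    show "P (\<lambda>x. c)" for c by (simp add: P_def trig_span_const)
    show "P (\<lambda>x. g x + g' x)" if "P g \<and> P g'" for g g'
      using that by (auto simp: P_def intro: continuous_on_add trig_span.add)
    show "P (\<lambda>x. g x * g' x)" if "P g \<and> P g'" for g g'
      using that by (auto simp: P_def intro: continuous_on_mult trig_span_mult)
    show "\<exists>g. P g \<and> g x \<noteq> g y" if "x \<in> S \<and> y \<in> S \<and> x \<noteq> y" for x y
    proof -
      obtain j where j: "x j \<noteq> y j" using \<open>x \<in> S \<and> y \<in> S \<and> x \<noteq> y\<close> by auto
      have "j \<in> J"
      proof (rule ccontr)
        assume "j \<notin> J"
        then have "x j = 0" "y j = 0" using that by (auto simp: S_def PiE_iff dest!: spec[of _ j])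
        then show False using j by simp
      qed
      then have "P (\<lambda>y. y j)" using trig_span_sin[OF J, of j k]
        by (auto simp: P_def u_def intro: continuous_on_subset[OF continuous_on_product_coordinates])
      then show ?thesis using j by blast
    qed
  qed (use e Fc in \<open>auto simp: P_def\<close>)
  then obtain g where g: "(\<lambda>x. g (u x)) \<in> trig_span J" and gF: "\<And>y. y \<in> S \<Longrightarrow> \<bar>F y - g y\<bar> < e"
    by (auto simp: P_def)
  show ?thesis
  proof (rule that[OF g])
    fix x
    show "\<bar>g (u x)\<bar> \<le> B + e" using gF[OF uS[of x]] B[of "\<lambda>j. arcsin (u x j) / k"] by (simp add: F_def)
    assume x: "\<And>j. j \<in> J \<Longrightarrow> \<bar>x j\<bar> \<le> L"
    have "F (u x) = f x" unfolding F_def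
    proof (rule dep)
      fix j assume j: "j \<in> J"
      have "\<bar>k * x j\<bar> \<le> pi / 2" using x[OF j] L by (simp add: k_def abs_mult field_simps)
      then show "arcsin (u x j) / k = x j" using j k by (simp add: u_def arcsin_sin abs_le_iff)
    qed
    then show "\<bar>f x - g (u x)\<bar> \<le> e" using gF[OF uS[of x]] by simp
  qed
qed

lemma trig_span_integrable:
  assumes "h \<in> trig_span J" "prob_space M" "\<And>j. j \<in> J \<Longrightarrow> Y j \<in> borel_measurable M"
  shows "integrable M (\<lambda>w. h (\<lambda>j. Y j w))"
  using assms(1)
proof induction
  case (cos c a b)
  interpret prob_space M by fact
  note [measurable] = assms(3)
  have "(\<lambda>w. c * cos ((\<Sum>j\<in>J. a j * Y j w) + b)) \<in> borel_measurable M" by measurable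
  then show ?case
    by (intro integrable_const_bound[of _ "\<bar>c\<bar>"]) (auto simp: abs_mult mult_left_le)
qed auto

lemma trig_span_tendsto:
  fixes M :: "nat \<Rightarrow> 'a measure" and W :: "'b measure"
  assumes "h \<in> trig_span J"
    and M: "\<And>n. prob_space (M n)" "\<And>n j. j \<in> J \<Longrightarrow> Y n j \<in> borel_measurable (M n)"
    and W: "prob_space W" "\<And>j. j \<in> J \<Longrightarrow> Z j \<in> borel_measurable W"
    and lim: "\<And>a b. (\<lambda>n. \<integral>w. cos ((\<Sum>j\<in>J. a j * Y n j w) + b) \<partial>M n)
      \<longlonglongrightarrow> (LINT w|W. cos ((\<Sum>j\<in>J. a j * Z j w) + b))"
  shows "(\<lambda>n. \<integral>w. h (\<lambda>j. Y n j w) \<partial>M n) \<longlonglongrightarrow> (LINT w|W. h (\<lambda>j. Z j w))"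
  using assms(1)
proof induction
  case (cos c a b)
  then show ?case using tendsto_mult[OF tendsto_const lim] by simp
next
  case (add f g)
  then show ?case
    using tendsto_add[OF add.IH]
    by (simp add: trig_span_integrable[OF add.hyps(1) M] trig_span_integrable[OF add.hyps(2) M]
        trig_span_integrable[OF add.hyps(1) W] trig_span_integrable[OF add.hyps(2) W])
qed

text \<open>Chebyshev in pointwise form: outside the box some
  \<open>(x j)\<^sup>2 / L\<^sup>2\<close> exceeds 1 and pays for the crude bound
  \<open>2 * B + 1\<close>, so the integrated error is controlled by second moments.
  \<open>N\<close> is arbitrary, to serve the approximating laws and the limit alike.\<close>

lemma trig_span_integral_approx:
  fixes N :: "'a measure" and f :: "(nat \<Rightarrow> real) \<Rightarrow> real"
  assumes J: "finite J" and f: "continuous_on UNIV f" and h: "h \<in> trig_span J" "\<And>x. \<bar>h x\<bar> \<le> B + e"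
    "\<And>x. (\<And>j. j \<in> J \<Longrightarrow> \<bar>x j\<bar> \<le> L) \<Longrightarrow> \<bar>f x - h x\<bar> \<le> e"
    and B: "\<And>x. \<bar>f x\<bar> \<le> B" and L: "L > 0" and e: "e > 0"
    and L2: "(2 * B + 1) * (real (card J) * (D / L\<^sup>2)) \<le> e"
    and N: "prob_space N" "\<And>j. X j \<in> borel_measurable N" "\<And>j. j \<in> J \<Longrightarrow> integrable N (\<lambda>w. (X j w)\<^sup>2)"
      "\<And>j. j \<in> J \<Longrightarrow> (LINT w|N. (X j w)\<^sup>2) \<le> D"
  shows "\<bar>(LINT w|N. f (\<lambda>j. X j w)) - (LINT w|N. h (\<lambda>j. X j w))\<bar> \<le> 2 * e"
proof -
  let ?f = "\<lambda>w. f (\<lambda>j. X j w)"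
  let ?h = "\<lambda>w. h (\<lambda>j. X j w)"
  let ?Q = "\<lambda>x. (2 * B + 1) * (\<Sum>j\<in>J. (x j)\<^sup>2 / L\<^sup>2)"
  have B0: "B \<ge> 0" using B[of undefined] by linarith
  have pt: "\<bar>f x - h x\<bar> \<le> e + ?Q x" for x
  proof (cases "\<forall>j\<in>J. \<bar>x j\<bar> \<le> L")
    case True
    moreover have "?Q x \<ge> 0"
      using B0 by (intro mult_nonneg_nonneg sum_nonneg) auto
    ultimately show ?thesis using h(3)[of x] by (smt (verit))
  next
    case False
    then obtain j where j: "j \<in> J" "\<bar>x j\<bar> > L" by auto
    have "1 \<le> (x j)\<^sup>2 / L\<^sup>2" using j L power_mono[of L "\<bar>x j\<bar>" 2] by simp
    also have "\<dots> \<le> (\<Sum>j\<in>J. (x j)\<^sup>2 / L\<^sup>2)" using J j by (intro member_le_sum) auto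
    finally have "(2 * B + 1) * 1 \<le> ?Q x"
      using B0 by (intro mult_left_mono) auto
    then have "e + (2 * B + 1) * 1 \<le> e + ?Q x"
      by (rule add_left_mono)
    moreover have "\<bar>f x - h x\<bar> \<le> e + (2 * B + 1) * 1"
      using order_trans[OF abs_triangle_ineq4 add_mono[OF B h(2)], of x x] by simp
    ultimately show ?thesis by (rule order_trans[rotated])
  qed
  interpret prob_space N by fact
  have "(\<lambda>w. ?f w) \<in> borel_measurable N"
    by (rule borel_measurable_continuous_on[OF f] measurable_coordinatewise_then_product N(2))+
  then have fi: "integrable N (\<lambda>w. ?f w)"
    by (intro integrable_const_bound[of _ B]) (use B in auto)
  have hi: "integrable N (\<lambda>w. ?h w)" by (rule trig_span_integrable[OF h(1) N(1,2)])
  have si: "integrable N (\<lambda>w. e + (2 * B + 1) * (\<Sum>j\<in>J. (X j w)\<^sup>2 / L\<^sup>2))"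
    using N(3) by auto
  have "\<bar>(LINT w|N. ?f w) - (LINT w|N. ?h w)\<bar>
      = \<bar>\<integral>w. ?f w - ?h w \<partial>N\<bar>" using fi hi by simp
  also have "\<dots> \<le> (LINT w|N. \<bar>?f w - ?h w\<bar>)" by (rule integral_abs_bound)
  also have "\<dots> \<le> (LINT w|N. e + (2 * B + 1) * (\<Sum>j\<in>J. (X j w)\<^sup>2 / L\<^sup>2))"
    using fi hi si pt by (intro integral_mono) auto
  also have "\<dots> = e + (2 * B + 1) * (\<Sum>j\<in>J. (LINT w|N. (X j w)\<^sup>2) / L\<^sup>2)"
    using N(3) by (simp add: prob_space)
  also have "\<dots> \<le> e + (2 * B + 1) * (\<Sum>j\<in>J. D / L\<^sup>2)"
    using N(4) B0 by (intro add_left_mono mult_left_mono sum_mono divide_right_mono) auto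
  also have "\<dots> \<le> 2 * e" using L2 by simp
  finally show ?thesis .
qed

text \<open>Bounded second moments make one box serve every \<open>n\<close>; on it \<open>f\<close>
  is replaced by a trigonometric sum, for which convergence is the hypothesis on shifted
  cosines.\<close>

lemma levy_continuity_multivariate:
  fixes M :: "nat \<Rightarrow> 'a measure" and W :: "'b measure" and f :: "(nat \<Rightarrow> real) \<Rightarrow> real"
  assumes J: "finite J" and f: "continuous_on UNIV f"
    and dep: "\<And>x y. (\<And>j. j \<in> J \<Longrightarrow> x j = y j) \<Longrightarrow> f x = f y"
    and B: "\<And>x. \<bar>f x\<bar> \<le> B"
    and M: "\<And>n. prob_space (M n)" "\<And>n j. Y n j \<in> borel_measurable (M n)"
    and W: "prob_space W" "\<And>j. Z j \<in> borel_measurable W"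
    and Y2: "\<And>n j. j \<in> J \<Longrightarrow> integrable (M n) (\<lambda>w. (Y n j w)\<^sup>2)"
      "\<And>n j. j \<in> J \<Longrightarrow> (LINT w|M n. (Y n j w)\<^sup>2) \<le> C"
    and Z2: "\<And>j. j \<in> J \<Longrightarrow> integrable W (\<lambda>w. (Z j w)\<^sup>2)"
    and lim: "\<And>a b. (\<lambda>n. \<integral>w. cos ((\<Sum>j\<in>J. a j * Y n j w) + b) \<partial>M n)
      \<longlonglongrightarrow> (LINT w|W. cos ((\<Sum>j\<in>J. a j * Z j w) + b))"
  shows "(\<lambda>n. \<integral>w. f (\<lambda>j. Y n j w) \<partial>M n) \<longlonglongrightarrow> (LINT w|W. f (\<lambda>j. Z j w))"
proof (rule LIMSEQ_I)
  let ?f = "\<lambda>n. \<integral>w. f (\<lambda>j. Y n j w) \<partial>M n"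
  let ?h = "\<lambda>h n. \<integral>w. h (\<lambda>j. Y n j w) \<partial>M n"
  let ?W = "\<lambda>h. \<integral>w. h (\<lambda>j. Z j w) \<partial>W"
  fix r :: real assume r: "r > 0"
  \<comment> \<open>The final estimate collects \<open>2 * e\<close> on either side and
    \<open>e\<close> in the middle, so \<open>5 * e\<close> must stay below
    \<open>r\<close>.\<close>
  define e where "e = min 1 (r/6)"
  have e: "e > 0" "e \<le> 1" "5 * e < r" using r by (auto simp: e_def min_def)
  have B0: "B \<ge> 0" using B[of undefined] by linarith
  define D where "D = max \<bar>C\<bar> (Max (insert 0 ((\<lambda>j. \<integral>w. (Z j w)\<^sup>2 \<partial>W) ` J)))"
  have D0: "D \<ge> 0" "C \<le> D" by (auto simp: D_def)
  have DZ: "(LINT w|W. (Z j w)\<^sup>2) \<le> D" if "j \<in> J" for j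
    using that J by (auto simp: D_def le_max_iff_disj intro!: disjI2 Max_ge)
  \<comment> \<open>Makes the Chebyshev tail at most \<open>e\<close>; adding 1 keeps
    \<open>L\<close> positive when the root is 0.\<close>
  define L where "L = sqrt ((2 * B + 1) * real (card J) * D / e) + 1"
  have "sqrt ((2 * B + 1) * real (card J) * D / e) \<ge> 0" using B0 D0 e by simp
  then have L: "L > 0" unfolding L_def by linarith
  have L2: "(2 * B + 1) * (real (card J) * (D / L\<^sup>2)) \<le> e"
  proof -
    have n: "(2 * B + 1) * real (card J) * D / e \<ge> 0" using B0 D0 e by simp
    have "(2 * B + 1) * real (card J) * D / e = (sqrt ((2 * B + 1) * real (card J) * D / e))\<^sup>2"
      using n by simp
    also have "\<dots> \<le> L\<^sup>2" by (rule power_mono) (use n in \<open>auto simp: L_def\<close>)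
    finally show ?thesis using e L by (simp add: field_simps)
  qed
  obtain h where h: "h \<in> trig_span J" "\<And>x. \<bar>h x\<bar> \<le> B + e"
    "\<And>x. (\<And>j. j \<in> J \<Longrightarrow> \<bar>x j\<bar> \<le> L) \<Longrightarrow> \<bar>f x - h x\<bar> \<le> e"
    using trig_span_approx[OF J f dep B L e(1)] by metis
  have "(\<lambda>n. \<integral>w. h (\<lambda>j. Y n j w) \<partial>M n) \<longlonglongrightarrow> ?W h"
    by (rule trig_span_tendsto[OF h(1) M W lim])
  from LIMSEQ_D[OF this e(1)] obtain n0 where n0: "\<And>n. n \<ge> n0 \<Longrightarrow> \<bar>?h h n - ?W h\<bar> < e"
    unfolding real_norm_def by blast
  have "norm (?f n - ?W f) < r" if "n \<ge> n0" for n
  proof -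
    have DY: "(LINT w|M n. (Y n j w)\<^sup>2) \<le> D" if "j \<in> J" for j using Y2(2)[OF that, of n] D0 by simp
    have "\<bar>?f n - ?h h n\<bar> \<le> 2 * e"
      by (rule trig_span_integral_approx[OF J f h B L e(1) L2 M(1) M(2) Y2(1) DY])
    moreover have "\<bar>?W f - ?W h\<bar> \<le> 2 * e"
      by (rule trig_span_integral_approx[OF J f h B L e(1) L2 W Z2 DZ])
    ultimately show ?thesis using n0[OF that] e(3) unfolding real_norm_def by argo
  qed
  then show "\<exists>n0. \<forall>n\<ge>n0. norm (?f n - ?W f) < r" by blast
qed

text \<open>The index type may be uncountable (below it is the time axis), whereas the preceding
  lemma concerns real sequences; \<open>J\<close> is therefore enumerated and the remaining
  coordinates are set to 0.\<close>

lemma converges_in_law_product: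
  fixes M :: "nat \<Rightarrow> 'a measure" and W :: "'b measure" and J :: "'i set"
  assumes J: "finite J"
    and M: "\<And>n. prob_space (M n)" "\<And>n j. j \<in> J \<Longrightarrow> Y n j \<in> borel_measurable (M n)"
    and W: "prob_space W" "\<And>j. j \<in> J \<Longrightarrow> Z j \<in> borel_measurable W"
    and Y2: "\<And>n j. j \<in> J \<Longrightarrow> integrable (M n) (\<lambda>w. (Y n j w)\<^sup>2)"
      "\<And>n j. j \<in> J \<Longrightarrow> (LINT w|M n. (Y n j w)\<^sup>2) \<le> C"
    and Z2: "\<And>j. j \<in> J \<Longrightarrow> integrable W (\<lambda>w. (Z j w)\<^sup>2)"
    and lim: "\<And>a b. (\<lambda>n. \<integral>w. cos ((\<Sum>j\<in>J. a j * Y n j w) + b) \<partial>M n)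
      \<longlonglongrightarrow> (LINT w|W. cos ((\<Sum>j\<in>J. a j * Z j w) + b))"
  shows "converges_in_law (product_topology (\<lambda>_. euclideanreal) J)
    M (\<lambda>n w. \<lambda>j\<in>J. Y n j w) W (\<lambda>w. \<lambda>j\<in>J. Z j w)"
proof -
  let ?T = "product_topology (\<lambda>_. euclideanreal) J"
  obtain s where s: "bij_betw s {..<card J} J"
    using ex_bij_betw_nat_finite[OF J] atLeast0LessThan by auto
  define q where "q = inv_into {..<card J} s"
  have q: "q j \<in> {..<card J}" "s (q j) = j" if "j \<in> J" for j
    using s that unfolding q_def
    by (metis bij_betw_imp_surj_on inv_into_into, metis bij_betw_imp_surj_on f_inv_into_f)
  have sJ: "s i \<in> J" if "i \<in> {..<card J}" for i using s that by (auto dest: bij_betwE)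
  have qs: "q (s i) = i" if "i < card J" for i
    using s that unfolding q_def by (simp add: bij_betw_imp_inj_on)
  define F :: "(nat \<Rightarrow> real) \<Rightarrow> 'i \<Rightarrow> real" where "F y = (\<lambda>j\<in>J. y (q j))" for y
  have F: "continuous_map euclidean ?T F"
    by (rule continuous_map_coordinatewise_then_product)
      (auto simp: F_def continuous_on_product_coordinates)
  define Y' where "Y' n i = (if i < card J then Y n (s i) else (\<lambda>_. 0))" for n i
  define Z' where "Z' i = (if i < card J then Z (s i) else (\<lambda>_. 0))" for i
  have Y'm: "Y' n i \<in> borel_measurable (M n)" for n i using M(2) sJ by (simp add: Y'_def)
  have Z'm: "Z' i \<in> borel_measurable W" for i using W(2) sJ by (simp add: Z'_def)
  have YY': "(\<lambda>j\<in>J. Y n j w) = F (\<lambda>i. Y' n i w)" for n w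
    using q by (auto simp: F_def Y'_def restrict_def)
  have ZZ': "(\<lambda>j\<in>J. Z j w) = F (\<lambda>i. Z' i w)" for w
    using q by (auto simp: F_def Z'_def restrict_def)
  have meas: "(\<lambda>w. \<lambda>j\<in>J. Y n j w) \<in> M n \<rightarrow>\<^sub>M borel_of ?T" for n
    unfolding YY' by (rule measurable_euclidean_continuous_map[OF Y'm F])
  have measZ: "(\<lambda>w. \<lambda>j\<in>J. Z j w) \<in> W \<rightarrow>\<^sub>M borel_of ?T"
    unfolding ZZ' by (rule measurable_euclidean_continuous_map[OF Z'm F])
  have "(\<lambda>n. \<integral>w. f (\<lambda>j\<in>J. Y n j w) \<partial>M n) \<longlonglongrightarrow> (LINT w|W. f (\<lambda>j\<in>J. Z j w))"
    if f: "continuous_map ?T euclideanreal f" and bd: "bounded (f ` topspace ?T)" for f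
  proof -
    obtain B where B: "\<And>x. x \<in> topspace ?T \<Longrightarrow> \<bar>f x\<bar> \<le> B" using bd by (auto simp: bounded_iff)
    have FT: "F y \<in> topspace ?T" for y by (auto simp: F_def)
    show ?thesis unfolding YY' ZZ'
    proof (rule levy_continuity_multivariate[where f = "\<lambda>y. f (F y)" and J = "{..<card J}" and B = B and C = C])
      show "continuous_on UNIV (\<lambda>y. f (F y))"
        using continuous_map_compose[OF F f] by (simp add: o_def)
      show "f (F x) = f (F y)" if "\<And>j. j \<in> {..<card J} \<Longrightarrow> x j = y j" for x y
        using q that by (auto simp: F_def restrict_def intro!: arg_cong[of _ _ f])
      have sumeq: "(\<Sum>i\<in>{..<card J}. a i * g (s i)) = (\<Sum>j\<in>J. a (q j) * g j)" for a and g :: "'i \<Rightarrow> real"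
        using sum.reindex_bij_betw[OF s, of "\<lambda>j. a (q j) * g j"] qs by simp
      show "(\<lambda>n. \<integral>w. cos ((\<Sum>i\<in>{..<card J}. a i * Y' n i w) + b) \<partial>M n)
        \<longlonglongrightarrow> (LINT w|W. cos ((\<Sum>i\<in>{..<card J}. a i * Z' i w) + b))" for a b
      proof -
        have "(\<Sum>i\<in>{..<card J}. a i * Y' n i w) = (\<Sum>j\<in>J. a (q j) * Y n j w)" for n w
          unfolding sumeq[of a "\<lambda>j. Y n j w", symmetric] by (simp add: Y'_def)
        moreover have "(\<Sum>i\<in>{..<card J}. a i * Z' i w) = (\<Sum>j\<in>J. a (q j) * Z j w)" for w
          unfolding sumeq[of a "\<lambda>j. Z j w", symmetric] by (simp add: Z'_def)
        ultimately show ?thesis using lim[of "\<lambda>j. a (q j)" b] by simp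
      qed
      show "integrable (M n) (\<lambda>w. (Y' n i w)\<^sup>2)" "(LINT w|M n. (Y' n i w)\<^sup>2) \<le> C"
        if "i \<in> {..<card J}" for n i using Y2 sJ that by (auto simp: Y'_def)
      show "integrable W (\<lambda>w. (Z' i w)\<^sup>2)" if "i \<in> {..<card J}" for i
        using Z2 sJ that by (auto simp: Z'_def)
    qed (use B FT M(1) W(1) Y'm Z'm in auto)
  qed
  then show ?thesis unfolding converges_in_law_def using M(1) W(1) meas measZ by blast
qed

section \<open>The law of the correlated random walk\<close>

lemma indep_vars_PiM_coordinates:
  assumes "\<And>i. i \<in> UNIV \<Longrightarrow> prob_space (M i)"
  shows "prob_space.indep_vars (PiM UNIV M) M (\<lambda>i w. w i) UNIV"
proof -
  interpret P: prob_space "PiM UNIV M" by (rule prob_space_PiM) (rule assms)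
  have "(\<lambda>x::'a \<Rightarrow> 'b. \<lambda>i\<in>UNIV. x i) = (\<lambda>x. x)" by (simp add: restrict_def)
  then show ?thesis
    using assms by (subst P.indep_vars_iff_distr_eq_PiM) (auto simp: distr_PiM_component)
qed

section \<open>The walk driven by independent uniform variables\<close>

abbreviation "is_crw Q p \<equiv> correlated_random_walk Q p (\<lambda>n x. x n)"

abbreviation "coord_past Q \<equiv> past Q (\<lambda>n x. x n)"

definition noise :: "(nat \<Rightarrow> real) measure" where
  "noise = PiM UNIV (\<lambda>_. uniform_measure lborel {0..1})"

lemma prob_space_uniform: "prob_space (uniform_measure lborel {0..1::real})"
  by (rule prob_space_uniform_measure) auto

lemma prob_space_noise: "prob_space noise"
  unfolding noise_def by (intro prob_space_PiM prob_space_uniform)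

lemma sets_noise [measurable_cong]: "sets noise = sets (PiM UNIV (\<lambda>_. borel))"
  unfolding noise_def by (intro sets_PiM_cong) auto

lemma space_noise [simp]: "space noise = UNIV"
  unfolding noise_def space_PiM by auto

lemma measure_noise_le:
  assumes "p \<in> {0..1}" shows "measure noise {u. u n \<le> p} = p"
proof -
  have "measure noise {u. u n \<le> p} = measure (distr noise (uniform_measure lborel {0..1}) (\<lambda>u. u n)) {..p}"
    by (subst measure_distr) (auto simp: vimage_def)
  also have "distr noise (uniform_measure lborel {0..1}) (\<lambda>u. u n) = uniform_measure lborel {0..1::real}"
    unfolding noise_def by (rule distr_PiM_component) (auto intro: prob_space_uniform)
  also have "measure \<dots> {..p} = measure lborel ({0..1} \<inter> {..p}) / measure lborel {0..1::real}"
    by (rule measure_uniform_measure) auto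
  also have "{0..1} \<inter> {..p} = {0..p}" using assms by auto
  finally show ?thesis using assms by simp
qed

text \<open>Disjoint blocks of coordinates of a product measure are independent. Dependence of
  \<open>f\<close> on the coordinates below \<open>n\<close> is expressed by an equation that sets
  the others to 0. Serves both the conditional probability and the moments of the
  increments.\<close>

lemma noise_indep:
  fixes f :: "(nat \<Rightarrow> real) \<Rightarrow> real" and g :: "real \<Rightarrow> real"
  assumes f [measurable]: "f \<in> borel_measurable noise" and g [measurable]: "g \<in> borel_measurable borel"
    and dep: "\<And>u. f u = f (\<lambda>i. if i < n then u i else 0)"
    and bf: "\<And>u. \<bar>f u\<bar> \<le> B" and bg: "\<And>x. \<bar>g x\<bar> \<le> B"
  shows "(LINT u|noise. f u * g (u n)) = (LINT u|noise. f u) * (LINT u|noise. g (u n))"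
proof -
  interpret prob_space noise by (rule prob_space_noise)
  have m [measurable]: "(\<lambda>u. u n) \<in> borel_measurable noise" by measurable
  have "indep_vars (\<lambda>_. uniform_measure lborel {0..1}) (\<lambda>i u. u i) UNIV"
    unfolding noise_def by (rule indep_vars_PiM_coordinates) (rule prob_space_uniform)
  then have "indep_vars (\<lambda>_. borel) (\<lambda>i u. u i) UNIV"
    by (rule indep_vars_compose2[where Y = "\<lambda>_ x. x"]) (rule measurable_ident_sets, simp)
  then have "indep_var (PiM {..<n} (\<lambda>_. borel)) (\<lambda>u. restrict (\<lambda>i. u i) {..<n})
      (PiM {n} (\<lambda>_. borel)) (\<lambda>u. restrict (\<lambda>i. u i) {n})"
    by (rule indep_var_restrict) auto
  moreover define f' where "f' v = f (\<lambda>i. if i < n then v i else 0)" for v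
  have "f' \<in> borel_measurable (PiM {..<n} (\<lambda>_. borel))"
    unfolding f'_def
  proof (rule measurable_compose[OF _ f], subst measurable_cong_sets[OF refl sets_noise],
      rule measurable_PiM_single')
    fix i show "(\<lambda>v. if i < n then v i else 0) \<in> borel_measurable (PiM {..<n} (\<lambda>_. borel))"
      by (cases "i < n") auto
  qed auto
  ultimately have "indep_var borel (f' \<circ> (\<lambda>u. restrict (\<lambda>i. u i) {..<n})) borel ((\<lambda>v. g (v n)) \<circ> (\<lambda>u. restrict (\<lambda>i. u i) {n}))"
    by (rule indep_var_compose) measurable
  moreover have "f' \<circ> (\<lambda>u. restrict (\<lambda>i. u i) {..<n}) = f"
    using dep by (auto simp: f'_def fun_eq_iff cong: if_cong)
  moreover have "(\<lambda>v. g (v n)) \<circ> (\<lambda>u. restrict (\<lambda>i. u i) {n}) = (\<lambda>u. g (u n))" by auto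
  ultimately have "indep_var borel f borel (\<lambda>u. g (u n))" by simp
  then show ?thesis
    by (rule indep_var_lebesgue_integral)
      (auto intro!: integrable_const_bound[of _ B] simp: bf bg)
qed

text \<open>\<open>u 0\<close> decides the first sign, each later uniform whether the sign is kept.
  Numbering starts at 0, so \<open>crw_inc p u n\<close> is the step from time \<open>n\<close> to
  \<open>n + 1\<close>. The same uniforms are used for every \<open>p\<close>, which makes joint
  measurability meaningful.\<close>

primrec crw_inc :: "real \<Rightarrow> (nat \<Rightarrow> real) \<Rightarrow> nat \<Rightarrow> int" where
  "crw_inc p u 0 = (if u 0 \<le> 1/2 then 1 else -1)"
| "crw_inc p u (Suc n) = (if u (Suc n) \<le> p then crw_inc p u n else - crw_inc p u n)"

definition crw_path :: "real \<Rightarrow> (nat \<Rightarrow> real) \<Rightarrow> nat \<Rightarrow> int" where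
  "crw_path p u n = (\<Sum>i<n. crw_inc p u i)"

lemma crw_inc_cases: "crw_inc p u n = 1 \<or> crw_inc p u n = -1"
  by (induction n) auto

lemma crw_inc_cong: "(\<And>i. i \<le> n \<Longrightarrow> u i = v i) \<Longrightarrow> crw_inc p u n = crw_inc p v n"
  by (induction n) auto

lemma crw_path_cong: "(\<And>i. i < n \<Longrightarrow> u i = v i) \<Longrightarrow> k \<le> n \<Longrightarrow> crw_path p u k = crw_path p v k"
  unfolding crw_path_def by (intro sum.cong crw_inc_cong) auto

lemma measurable_crw_inc_pair [measurable]:
  "(\<lambda>(p, u). crw_inc p u n) \<in> borel \<Otimes>\<^sub>M noise \<rightarrow>\<^sub>M count_space UNIV"
proof (induction n)
  case (Suc n)
  then have [measurable]: "(\<lambda>x. crw_inc (fst x) (snd x) n) \<in> borel \<Otimes>\<^sub>M noise \<rightarrow>\<^sub>M count_space UNIV"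
    by (simp add: split_beta')
  show ?case by (simp add: split_beta')
next
  case 0
  show ?case by (simp add: split_beta')
qed

lemma measurable_crw_path_pair:
  "(\<lambda>(p, u). crw_path p u) \<in> borel \<Otimes>\<^sub>M noise \<rightarrow>\<^sub>M walk_space"
  unfolding walk_space_def split_beta'
proof (rule measurable_PiM_single')
  fix n
  have [measurable]: "(\<lambda>x. crw_inc (fst x) (snd x) i) \<in> borel \<Otimes>\<^sub>M noise \<rightarrow>\<^sub>M count_space UNIV" for i
    using measurable_crw_inc_pair[of i] by (simp add: split_beta')
  show "(\<lambda>x. crw_path (fst x) (snd x) n) \<in> borel \<Otimes>\<^sub>M noise \<rightarrow>\<^sub>M count_space UNIV"
    unfolding crw_path_def
  proof (induction n)
    case (Suc n)
    note [measurable] = this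
    show ?case by simp
  qed simp
qed auto

lemma measurable_crw_path [measurable]: "crw_path p \<in> noise \<rightarrow>\<^sub>M walk_space"
  using measurable_Pair2[OF measurable_crw_path_pair, of p] by simp

lemma measurable_crw_inc [measurable]: "(\<lambda>u. crw_inc p u n) \<in> noise \<rightarrow>\<^sub>M count_space UNIV"
  using measurable_Pair2[OF measurable_crw_inc_pair, of p] by simp

lemma space_walk_space [simp]: "space walk_space = UNIV"
  unfolding walk_space_def space_PiM by auto

lemma measurable_walk_coord [measurable]: "(\<lambda>x. x n) \<in> walk_space \<rightarrow>\<^sub>M count_space UNIV"
  unfolding walk_space_def by measurable

lemma crw_step: "walk_step (\<lambda>n u. crw_path p u n) (Suc n) u = crw_inc p u n"
  by (simp add: walk_step_def crw_path_def)

section \<open>Uniqueness of the law through cylinder probabilities\<close>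

text \<open>Indexing by the prefix as a list turns induction over time into reverse list induction;
  the empty prefix gives the whole space.\<close>

definition cylinder :: "int list \<Rightarrow> (nat \<Rightarrow> int) set" where
  "cylinder l = {x. \<forall>k<length l. x k = l ! k}"

lemma sets_past_coord:
  assumes "space Q = UNIV"
  shows "sets (coord_past Q n) = sigma_sets UNIV {(\<lambda>x. x k) -` A | k A. k \<le> n}"
  unfolding past_def assms by simp

lemma space_past [simp]: "space (past Q X n) = space Q"
  unfolding past_def by (rule space_measure_of) auto

lemma sets_past_subset:
  assumes "sets Q = sets walk_space"
  shows "sets (coord_past Q n) \<subseteq> sets Q"
proof -
  have sp: "space Q = UNIV" using sets_eq_imp_space_eq[OF assms] by simp
  have "(\<lambda>x. x k) -` A \<in> sets walk_space" for k and A :: "int set"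
    using measurable_sets[OF measurable_walk_coord, of A k] by simp
  then have "{(\<lambda>x. x k) -` A | k A. k \<le> n} \<subseteq> sets walk_space" by auto
  from sets.sigma_sets_subset[OF this] show ?thesis unfolding sets_past_coord[OF sp] assms by simp
qed

text \<open>True of the generators and preserved by complements and countable unions. With it the
  indicator of a past event becomes a function of finitely many uniforms.\<close>

lemma past_prefix_determined:
  assumes "A \<in> sigma_sets UNIV {(\<lambda>x::nat \<Rightarrow> int. x k) -` A | k A. k \<le> n}"
    and "\<And>k. k \<le> n \<Longrightarrow> x k = y k"
  shows "x \<in> A \<longleftrightarrow> y \<in> A"
  using assms by induction auto

lemma cylinder_in_past:
  assumes "space Q = UNIV" "length l \<le> Suc n"
  shows "cylinder l \<in> sets (coord_past Q n)"
proof (cases "l = []")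
  case True
  then show ?thesis using sets.top[of "coord_past Q n"] assms by (simp add: cylinder_def)
next
  case False
  have "cylinder l = (\<Inter>k\<in>{..<length l}. (\<lambda>x. x k) -` {l ! k})" by (auto simp: cylinder_def)
  also have "\<dots> \<in> sets (coord_past Q n)"
  proof (rule sets.finite_INT)
    fix k assume "k \<in> {..<length l}"
    then have "k \<le> n" using assms(2) by simp
    then show "(\<lambda>x. x k) -` {l ! k} \<in> sets (coord_past Q n)"
      unfolding sets_past_coord[OF assms(1)] by (intro sigma_sets.Basic) blast
  qed (use False in auto)
  finally show ?thesis .
qed

lemma cylinder_in_walk_space [measurable]: "cylinder l \<in> sets walk_space"
  using cylinder_in_past[of walk_space l "length l"] sets_past_subset[OF refl] by auto

text \<open>Integrating the conditional probability over a past event turns the almost sure identity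
  into an equation between probabilities, which can be iterated.\<close>

lemma crw_cond_exp_measure:
  assumes Q: "sets Q = sets walk_space" and crw: "is_crw Q p"
    and n: "n \<ge> 1" and A: "A \<in> sets (coord_past Q n)"
  shows "measure Q (A \<inter> {x. x (n + 1) - x n = x n - x (n - 1)}) = p * measure Q A"
proof -
  interpret prob_space Q using crw by (simp add: correlated_random_walk_def)
  have sp: "space Q = UNIV" using sets_eq_imp_space_eq[OF Q] by simp
  note [measurable_cong] = Q
  have [measurable]: "(\<lambda>x. x k) \<in> Q \<rightarrow>\<^sub>M count_space UNIV" for k by measurable
  interpret finite_measure_subalgebra Q "coord_past Q n"
    by unfold_locales (use sets_past_subset[OF Q] in \<open>auto simp: subalgebra_def\<close>)
  let ?E = "{x \<in> space Q. walk_step (\<lambda>n x. x n) (n + 1) x = walk_step (\<lambda>n x. x n) n x}"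
  have E: "?E = {x. x (n + 1) - x n = x n - x (n - 1)}" by (simp add: walk_step_def sp)
  have Em: "?E \<in> sets Q" unfolding walk_step_def by measurable
  have AQ: "A \<in> sets Q" using A sets_past_subset[OF Q] by auto
  have "(\<integral>x\<in>A. indicator ?E x \<partial>Q) = (\<integral>x\<in>A. real_cond_exp Q (coord_past Q n) (indicator ?E) x \<partial>Q)"
    by (rule real_cond_exp_intA[OF _ A]) (rule integrable_real_indicator[OF Em], simp add: less_top[symmetric])
  also have "\<dots> = (\<integral>x\<in>A. p \<partial>Q)"
    using crw n AQ unfolding correlated_random_walk_def
    by (intro set_lebesgue_integral_cong_AE) (auto simp: borel_measurable_cond_exp2)
  also have "\<dots> = p * measure Q A" using AQ by (simp add: set_lebesgue_integral_def)
  also have "(\<integral>x\<in>A. indicator ?E x \<partial>Q) = (LINT x|Q. indicator (A \<inter> ?E) x)"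
    unfolding set_lebesgue_integral_def by (intro Bochner_Integration.integral_cong) (auto simp: indicator_def)
  also have "\<dots> = measure Q (A \<inter> ?E)" using AQ Em by simp
  finally show ?thesis unfolding E by simp
qed

text \<open>The walk continues with probability \<open>p\<close>, reverses with
  \<open>1 - p\<close>, and every other continuation is null because steps are almost surely 1 or
  -1. What matters is that the factor depends only on \<open>p\<close> and the listed positions, not
  on \<open>Q\<close>.\<close>

lemma crw_cylinder_step:
  assumes Q: "sets Q = sets walk_space" and crw: "is_crw Q p"
    and n: "n \<ge> 1" and l: "length l = Suc n"
  shows "measure Q (cylinder (l @ [b])) = measure Q (cylinder l) *
    (if \<bar>l ! n - l ! (n - 1)\<bar> \<noteq> 1 then 0 else if b - l ! n = l ! n - l ! (n - 1) then p
     else if b - l ! n = l ! (n - 1) - l ! n then 1 - p else 0)"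
proof -
  interpret prob_space Q using crw by (simp add: correlated_random_walk_def)
  have sp: "space Q = UNIV" using sets_eq_imp_space_eq[OF Q] by simp
  note [measurable_cong] = Q
  have [measurable]: "(\<lambda>x. x k) \<in> Q \<rightarrow>\<^sub>M count_space UNIV" for k by measurable
  have [measurable]: "cylinder m \<in> sets Q" for m using cylinder_in_walk_space Q by simp
  have AE_step: "AE x in Q. \<bar>x k - x (k - 1)\<bar> = 1" if "k \<ge> 1" for k
  proof -
    have "AE x in Q. walk_step (\<lambda>n x. x n) k x = 1 \<or> walk_step (\<lambda>n x. x n) k x = -1"
      using crw that unfolding correlated_random_walk_def by blast
    then show ?thesis by eventually_elim (auto simp: walk_step_def)
  qed
  have AE_step1: "AE x in Q. \<bar>x (Suc n) - x n\<bar> = 1" using AE_step[of "n + 1"] by simp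
  let ?E = "{x. x (n + 1) - x n = x n - x (n - 1)}"
  have [measurable]: "?E \<in> sets Q"
  proof -
    have "{x \<in> space Q. x (n + 1) - x n = x n - x (n - 1)} \<in> sets Q" by measurable
    then show ?thesis by (simp only: sp UNIV_I simp_thms)
  qed
  have cyl: "x \<in> cylinder (l @ [b]) \<longleftrightarrow> x \<in> cylinder l \<and> x (Suc n) = b" for x
    by (auto simp: cylinder_def l nth_append less_Suc_eq)
  have val: "x n = l ! n" "x (n - 1) = l ! (n - 1)" if "x \<in> cylinder l" for x
    using that l by (auto simp: cylinder_def)
  have zero: "measure Q B = 0" if "AE x in Q. x \<notin> B" "B \<in> sets Q" for B
    using that by (simp add: measure_eq_0_null_sets AE_iff_null_sets)
  have step: "measure Q (cylinder l \<inter> ?E) = p * measure Q (cylinder l)"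
    by (rule crw_cond_exp_measure[OF Q crw n cylinder_in_past]) (use sp l in auto)
  consider "\<bar>l ! n - l ! (n - 1)\<bar> \<noteq> 1" | "\<bar>l ! n - l ! (n - 1)\<bar> = 1" "b - l ! n = l ! n - l ! (n - 1)"
    | "\<bar>l ! n - l ! (n - 1)\<bar> = 1" "b - l ! n = l ! (n - 1) - l ! n" "b - l ! n \<noteq> l ! n - l ! (n - 1)"
    | "\<bar>l ! n - l ! (n - 1)\<bar> = 1" "b - l ! n \<noteq> l ! (n - 1) - l ! n" "b - l ! n \<noteq> l ! n - l ! (n - 1)"
    by blast
  then show ?thesis
  proof cases
    case 1
    have "AE x in Q. x \<notin> cylinder (l @ [b])" using AE_step[OF n]
      by eventually_elim (use 1 val cyl in auto)
    then show ?thesis using 1 zero[of "cylinder (l @ [b])"] by simp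
  next
    case 2
    have "x \<in> cylinder (l @ [b]) \<longleftrightarrow> x \<in> cylinder l \<inter> ?E" for x
    proof (cases "x \<in> cylinder l")
      case True
      show ?thesis unfolding cyl using 2(2) val[OF True] True by auto
    qed (simp add: cyl)
    then have "cylinder (l @ [b]) = cylinder l \<inter> ?E" by blast
    then show ?thesis using 2 step by simp
  next
    \<comment> \<open>A reversal is, up to a null set, the complement of a repetition inside the
      cylinder.\<close>
    case 3
    have "measure Q (cylinder (l @ [b])) = measure Q (cylinder l - ?E)"
    proof (rule measure_eq_AE)
      show "AE x in Q. x \<in> cylinder (l @ [b]) \<longleftrightarrow> x \<in> cylinder l - ?E"
        using AE_step1 AE_step[OF n]
      proof eventually_elim
        case (elim x)
        show ?case
        proof (cases "x \<in> cylinder l")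
          case True
          then show ?thesis unfolding cyl using elim 3 val[OF True] by auto
        qed (simp add: cyl)
      qed
    qed measurable
    also have "\<dots> = measure Q (cylinder l) - measure Q (cylinder l \<inter> ?E)"
      by (rule finite_measure_Diff') measurable
    finally show ?thesis using 3 step by (simp add: algebra_simps)
  next
    case 4
    have "AE x in Q. x \<notin> cylinder (l @ [b])" using AE_step1 AE_step[OF n]
    proof eventually_elim
      case (elim x)
      show ?case
      proof (cases "x \<in> cylinder l")
        case True
        then show ?thesis unfolding cyl using elim 4 val[OF True] by auto
      qed (simp add: cyl)
    qed
    then show ?thesis using 4 zero[of "cylinder (l @ [b])"] by simp
  qed
qed

text \<open>Prefixes of one or two entries are fixed by the start at 0 and the symmetric first step;
  longer ones follow from the transition factor, which looks at two previous positions.\<close>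

lemma crw_cylinder_unique:
  assumes Q: "sets Q = sets walk_space" "is_crw Q p"
    and Q': "sets Q' = sets walk_space" "is_crw Q' p"
  shows "measure Q (cylinder l) = measure Q' (cylinder l)"
proof (induction l rule: rev_induct)
  case Nil
  have "measure R (cylinder []) = 1" if "sets R = sets walk_space" "is_crw R p" for R
    using that sets_eq_imp_space_eq[OF that(1)] prob_space.prob_space[of R]
    by (simp add: correlated_random_walk_def cylinder_def)
  then show ?case using Q Q' by simp
next
  case (snoc b l)
  consider "length l = 0" | "length l = 1" | n where "n \<ge> 1" "length l = Suc n"
    by (metis One_nat_def Suc_le_eq gr0I old.nat.exhaust)
  then show ?case
  proof cases
    case 1
    have "measure R (cylinder [b]) = (if b = 0 then 1 else 0)"
      if R: "sets R = sets walk_space" "is_crw R p" for R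
    proof -
      interpret prob_space R using R by (simp add: correlated_random_walk_def)
      have [measurable]: "cylinder [b] \<in> sets R" using cylinder_in_walk_space R(1) by simp
      have "AE x in R. x 0 = 0" using R(2) by (simp add: correlated_random_walk_def)
      then have "AE x in R. x \<in> cylinder [b] \<longleftrightarrow> x \<in> (if b = 0 then space R else {})"
        by eventually_elim (use sets_eq_imp_space_eq[OF R(1)] in \<open>auto simp: cylinder_def\<close>)
      from measure_eq_AE[OF this] show ?thesis by (simp add: prob_space split: if_splits)
    qed
    then show ?thesis using 1 Q Q' by simp
  next
    case 2
    then obtain a where a: "l = [a]" by (metis One_nat_def Suc_length_conv length_0_conv)
    have "measure R (cylinder [a, b]) = (if a = 0 \<and> \<bar>b\<bar> = 1 then 1/2 else 0)"
      if R: "sets R = sets walk_space" "is_crw R p" for R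
    proof -
      interpret prob_space R using R by (simp add: correlated_random_walk_def)
      note [measurable_cong] = R(1)
      have sp: "space R = UNIV" using sets_eq_imp_space_eq[OF R(1)] by simp
      have [measurable]: "cylinder [a,b] \<in> sets R" using cylinder_in_walk_space R(1) by simp
      have "AE x in R. x 0 = 0" using R(2) by (simp add: correlated_random_walk_def)
      moreover have "AE x in R. walk_step (\<lambda>n x. x n) 1 x = 1 \<or> walk_step (\<lambda>n x. x n) 1 x = -1"
        using R(2) unfolding correlated_random_walk_def by blast
      ultimately have "AE x in R. x \<in> cylinder [a, b] \<longleftrightarrow> x \<in> (if a = 0 \<and> \<bar>b\<bar> = 1 then {x \<in> space R. x 1 = b} else {})"
        by eventually_elim (auto simp: cylinder_def walk_step_def sp less_Suc_eq nth_Cons')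
      from measure_eq_AE[OF this] have "measure R (cylinder [a, b]) = measure R (if a = 0 \<and> \<bar>b\<bar> = 1 then {x \<in> space R. x 1 = b} else {})"
        by simp
      moreover have "measure R {x \<in> space R. x 1 = b} = 1/2" if "\<bar>b\<bar> = 1"
      proof -
        have "b = 1 \<or> b = -1" using that by linarith
        then show ?thesis using R(2) unfolding correlated_random_walk_def by auto
      qed
      ultimately show ?thesis by auto
    qed
    then show ?thesis using a Q Q' by simp
  next
    case 3
    then show ?thesis
      using crw_cylinder_step[OF Q 3] crw_cylinder_step[OF Q' 3] snoc by simp
  qed
qed

text \<open>Each coordinate condition is a union of cylinders over finite integer lists, of which
  there are only countably many. The empty set is adjoined because incompatible prefixes have empty
  intersection and the generator has to be stable under intersections.\<close>

lemma sets_walk_space_cylinders: "sets walk_space = sigma_sets UNIV (insert {} (range cylinder))"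
proof
  have "sets walk_space = sigma_sets UNIV {{x. x i \<in> A} |i A. True}"
    unfolding walk_space_def sets_PiM_single by simp
  also have "\<dots> \<subseteq> sigma_sets UNIV (insert {} (range cylinder))"
  proof (rule sigma_sets_mono, safe)
    fix i :: nat and A :: "int set"
    have "{x. x i \<in> A} = (\<Union>l\<in>{l. length l = Suc i \<and> l ! i \<in> A}. cylinder l)"
    proof (intro equalityI subsetI)
      fix x assume "x \<in> {x. x i \<in> A}"
      then have "map x [0..<Suc i] \<in> {l. length l = Suc i \<and> l ! i \<in> A}" "x \<in> cylinder (map x [0..<Suc i])"
        by (auto simp: cylinder_def simp del: upt_Suc)
      then show "x \<in> (\<Union>l\<in>{l. length l = Suc i \<and> l ! i \<in> A}. cylinder l)" by blast
    qed (auto simp: cylinder_def)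
    also have "\<dots> \<in> sigma_sets UNIV (insert {} (range cylinder))"
      by (intro sigma_sets_UNION) (auto intro!: countable_image uncountable_def intro: sigma_sets.Basic)
    finally show "{x. x i \<in> A} \<in> sigma_sets UNIV (insert {} (range cylinder))" .
  qed
  finally show "sets walk_space \<subseteq> sigma_sets UNIV (insert {} (range cylinder))" .
  show "sigma_sets UNIV (insert {} (range cylinder)) \<subseteq> sets walk_space"
  proof -
    have "insert {} (range cylinder) \<subseteq> sets walk_space" by auto
    from sets.sigma_sets_subset[OF this] show ?thesis by simp
  qed
qed

lemma cylinder_Int: "cylinder l \<inter> cylinder l' \<in> insert {} (range cylinder)"
proof -
  have *: "cylinder l \<inter> cylinder l' \<in> insert {} (range cylinder)" if "length l \<le> length l'" for l l'
  proof (cases "cylinder l \<inter> cylinder l' = {}")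
    case False
    then obtain x where "x \<in> cylinder l" "x \<in> cylinder l'" by blast
    then have "cylinder l \<inter> cylinder l' = cylinder l'" using that by (auto simp: cylinder_def)
    then show ?thesis by simp
  qed simp
  show ?thesis using *[of l l'] *[of l' l] by (cases "length l \<le> length l'") (auto simp: Int_commute)
qed

lemma crw_law_unique:
  assumes Q: "sets Q = sets walk_space" "is_crw Q p"
    and Q': "sets Q' = sets walk_space" "is_crw Q' p"
  shows "Q = Q'"
proof (rule measure_eqI_generator_eq[where E = "insert {} (range cylinder)" and \<Omega> = UNIV and A = "\<lambda>_. UNIV"])
  interpret Q: prob_space Q using Q by (simp add: correlated_random_walk_def)
  interpret Q': prob_space Q' using Q' by (simp add: correlated_random_walk_def)
  show "Int_stable (insert {} (range cylinder))"
    using cylinder_Int by (auto simp: Int_stable_def)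
  show "emeasure Q X = emeasure Q' X" if "X \<in> insert {} (range cylinder)" for X
    using that crw_cylinder_unique[OF Q Q'] by (auto simp: Q.emeasure_eq_measure Q'.emeasure_eq_measure)
  show "sets Q = sigma_sets UNIV (insert {} (range cylinder))" "sets Q' = sigma_sets UNIV (insert {} (range cylinder))"
    using Q Q' sets_walk_space_cylinders by auto
  have "cylinder [] = UNIV" by (simp add: cylinder_def)
  then show "range (\<lambda>_::nat. UNIV) \<subseteq> insert {} (range cylinder)" by (auto intro: range_eqI[of _ _ "[]"])
  show "emeasure Q UNIV \<noteq> \<infinity>" using Q.emeasure_finite[of UNIV] by simp
qed auto

section \<open>Existence of the law, and its mixture\<close>

text \<open>Step \<open>n + 1\<close> repeats step \<open>n\<close> exactly when
  \<open>u n \<le> p\<close>, while the past up to time \<open>n\<close> is a function of the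
  uniforms before \<open>u n\<close>; independence then gives the constant conditional probability
  \<open>p\<close>.\<close>

lemma crw_path_correlated:
  assumes p: "p \<in> {0..1}"
  shows "is_crw (distr noise walk_space (crw_path p)) p"
    (is "correlated_random_walk ?Q p _")
proof -
  interpret N: prob_space noise by (rule prob_space_noise)
  interpret Q: prob_space ?Q by (rule N.prob_space_distr) measurable
  have inc0: "measure noise {u. u 0 \<le> 1/2} = 1/2" by (rule measure_noise_le) simp
  have S [measurable]: "{u. u n \<le> q} \<in> sets noise" for n q
  proof -
    have "{u \<in> space noise. u n \<le> q} \<in> sets noise" by measurable
    then show ?thesis by simp
  qed
  have W [measurable]: "{x. x k = c} \<in> sets walk_space" for k and c :: int
  proof -
    have "{x \<in> space walk_space. x k = c} \<in> sets walk_space" by measurable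
    then show ?thesis by simp
  qed
  have one: "measure ?Q {x \<in> space ?Q. x 1 = 1} = 1/2"
  proof -
    have "measure ?Q {x \<in> space ?Q. x 1 = 1} = measure noise {u. u 0 \<le> 1/2}"
      by (subst measure_distr) (auto simp: crw_path_def intro!: arg_cong[where f = "measure noise"])
    then show ?thesis using inc0 by simp
  qed
  have mone: "measure ?Q {x \<in> space ?Q. x 1 = -1} = 1/2"
  proof -
    have "measure ?Q {x \<in> space ?Q. x 1 = -1} = measure noise (space noise - {u. u 0 \<le> 1/2})"
      by (subst measure_distr) (auto simp: crw_path_def intro!: arg_cong[where f = "measure noise"])
    also have "\<dots> = 1 - measure noise {u. u 0 \<le> 1/2}" by (rule N.prob_compl) measurable
    also have "\<dots> = 1 - 1/2" by (simp only: inc0)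
    finally show ?thesis by simp
  qed
  have steps: "AE x in ?Q. walk_step (\<lambda>n x. x n) n x = 1 \<or> walk_step (\<lambda>n x. x n) n x = -1" if n: "n \<ge> 1" for n
  proof (subst AE_distr_iff)
    obtain m where m: "n = Suc m" using n by (cases n) auto
    show "AE u in noise. walk_step (\<lambda>n x. x n) n (crw_path p u) = 1 \<or> walk_step (\<lambda>n x. x n) n (crw_path p u) = -1"
      using crw_inc_cases[of p _ m] crw_step[of p m] by (auto simp: m walk_step_def)
    show "{x \<in> space walk_space. walk_step (\<lambda>n x. x n) n x = 1 \<or> walk_step (\<lambda>n x. x n) n x = - 1} \<in> sets walk_space"
      unfolding walk_step_def by measurable
  qed measurable
  have cond: "AE x in ?Q. real_cond_exp ?Q (coord_past ?Q n)
      (indicator {x \<in> space ?Q. walk_step (\<lambda>n x. x n) (n + 1) x = walk_step (\<lambda>n x. x n) n x}) x = p"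
    if n: "n \<ge> 1" for n
  proof -
    let ?F = "coord_past ?Q n"
    let ?E = "{x \<in> space ?Q. walk_step (\<lambda>n x. x n) (n + 1) x = walk_step (\<lambda>n x. x n) n x}"
    obtain m where m: "n = Suc m" using n by (cases n) auto
    have sub: "sets ?F \<subseteq> sets ?Q" by (rule sets_past_subset) simp
    interpret finite_measure_subalgebra ?Q ?F
      by unfold_locales (use sub in \<open>auto simp: subalgebra_def\<close>)
    have Em: "?E \<in> sets ?Q" unfolding walk_step_def by measurable
    have E: "crw_path p u \<in> ?E \<longleftrightarrow> u n \<le> p" for u
    proof -
      have "crw_path p u \<in> ?E \<longleftrightarrow> crw_inc p u (Suc m) = crw_inc p u m"
        unfolding crw_step[symmetric] by (simp add: m walk_step_def)
      then show ?thesis using crw_inc_cases[of p u m] by (auto simp: m)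
    qed
    show ?thesis
    proof (rule real_cond_exp_charact)
      fix A assume A: "A \<in> sets ?F"
      then have AQ: "A \<in> sets ?Q" using sub by auto
      have [measurable]: "A \<in> sets walk_space" using AQ by simp
      have det: "x \<in> A \<longleftrightarrow> y \<in> A" if "\<And>k. k \<le> n \<Longrightarrow> x k = y k" for x y
      proof (rule past_prefix_determined)
        show "A \<in> sigma_sets UNIV {(\<lambda>x. x k) -` A | k A. k \<le> n}"
          using A sets_past_coord[of ?Q n] by simp
      qed (rule that)
      have "(\<integral>x\<in>A. indicator ?E x \<partial>?Q) = (LINT x|?Q. indicat_real A x * indicat_real ?E x)"
        by (simp add: set_lebesgue_integral_def)
      also have "\<dots> = (LINT u|noise. indicat_real A (crw_path p u) * indicat_real ?E (crw_path p u))"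
        by (rule integral_distr) (use Em in measurable)
      also have "\<dots> = (LINT u|noise. indicat_real A (crw_path p u) * indicat_real {..p} (u n))"
        using E by (intro Bochner_Integration.integral_cong) (auto simp: indicator_def)
      also have "\<dots> = (LINT u|noise. indicat_real A (crw_path p u)) * (LINT u|noise. indicat_real {..p} (u n))"
      proof (rule noise_indep[where B = 1])
        show "indicator A (crw_path p u) = (indicator A (crw_path p (\<lambda>i. if i < n then u i else 0)) :: real)" for u
        proof -
          have "crw_path p u \<in> A \<longleftrightarrow> crw_path p (\<lambda>i. if i < n then u i else 0) \<in> A"
            by (rule det, rule crw_path_cong) auto
          then show ?thesis by (simp add: indicator_def)
        qed
      qed (auto simp: indicator_def)
      also have "(LINT u|noise. indicat_real {..p} (u n)) = (LINT u|noise. indicat_real {u. u n \<le> p} u)"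
        by (intro Bochner_Integration.integral_cong) (auto simp: indicator_def)
      also have "\<dots> = p" using measure_noise_le[OF p, of n] by simp
      also have "(LINT u|noise. indicat_real A (crw_path p u)) = (LINT x|?Q. indicat_real A x)"
        by (rule integral_distr[symmetric]) measurable
      also have "\<dots> * p = (\<integral>x\<in>A. p \<partial>?Q)" by (simp add: set_lebesgue_integral_def)
      finally show "(\<integral>x\<in>A. indicator ?E x \<partial>?Q) = (\<integral>x\<in>A. p \<partial>?Q)" .
    qed (use Em in \<open>auto intro!: integrable_real_indicator simp: less_top[symmetric]\<close>)
  qed
  have zero: "AE x in ?Q. x 0 = 0"
    by (subst AE_distr_iff) (auto simp: crw_path_def)
  show ?thesis unfolding correlated_random_walk_def
    using Q.prob_space_axioms zero one mone steps cond by auto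
qed

lemma crw_law_eq:
  assumes "p \<in> {0..1}"
  shows "crw_law p = distr noise walk_space (crw_path p)"
  unfolding crw_law_def
  using crw_path_correlated[OF assms] crw_law_unique by (intro the_equality) auto

text \<open>By \<open>crw_law_eq\<close> the kernel is the image of \<open>noise\<close> under a map
  jointly measurable in \<open>p\<close> and \<open>u\<close>, so composition of kernels becomes
  integration over a product. \<open>I\<close> stays inside \<open>[0, 1]\<close> since
  \<open>crw_law\<close> is unspecified elsewhere.\<close>

lemma annealed_law_eq:
  assumes \<mu>: "sets \<mu> = sets (restrict_space borel I)" and I: "I \<subseteq> {0..1}" "I \<noteq> {}" and fin: "finite_measure \<mu>"
  shows "annealed_law \<mu> = distr (\<mu> \<Otimes>\<^sub>M noise) walk_space (\<lambda>(p, u). crw_path p u)"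
proof -
  interpret N: prob_space noise by (rule prob_space_noise)
  interpret \<mu>: finite_measure \<mu> by (rule fin)
  have sp: "space \<mu> = I" using sets_eq_imp_space_eq[OF \<mu>] by (simp add: space_restrict_space)
  have id: "(\<lambda>p. p) \<in> \<mu> \<rightarrow>\<^sub>M borel"
    using measurable_cong_sets[OF \<mu> refl] measurable_restrict_space1[OF measurable_ident, of borel I] by (auto simp: id_def)
  have path: "(\<lambda>(p, u). crw_path p u) \<in> \<mu> \<Otimes>\<^sub>M noise \<rightarrow>\<^sub>M walk_space"
    using measurable_compose[OF measurable_Pair[OF measurable_compose[OF measurable_fst id] measurable_snd]
        measurable_crw_path_pair]
    by (simp add: split_beta')
  have ker: "(\<lambda>p. distr noise walk_space (crw_path p)) \<in> \<mu> \<rightarrow>\<^sub>M subprob_algebra walk_space"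
    by (rule measurable_distr2[where M = noise])
      (use path N.subprob_space_axioms in \<open>auto simp: space_subprob_algebra N.prob_space_axioms intro!: measurable_const prob_space_imp_subprob_space\<close>)
  have law: "crw_law \<in> \<mu> \<rightarrow>\<^sub>M subprob_algebra walk_space"
    by (rule measurable_cong[THEN iffD1, OF _ ker]) (use I sp crw_law_eq in auto)
  have "annealed_law \<mu> = bind \<mu> (\<lambda>p. distr noise walk_space (crw_path p))"
    unfolding annealed_law_def by (rule bind_cong) (use I sp crw_law_eq in auto)
  also have "\<dots> = distr (\<mu> \<Otimes>\<^sub>M noise) walk_space (\<lambda>(p, u). crw_path p u)" (is "?L = ?R")
  proof (rule measure_eqI)
    have sL: "sets ?L = sets walk_space" by (rule sets_bind) (use sp I in auto)
    then show "sets ?L = sets ?R" by simp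
    fix A assume "A \<in> sets ?L"
    then have A [measurable]: "A \<in> sets walk_space" using sL by simp
    have "emeasure ?L A = (\<integral>\<^sup>+p. emeasure (distr noise walk_space (crw_path p)) A \<partial>\<mu>)"
      by (rule emeasure_bind[OF _ ker A]) (use sp I in auto)
    also have "\<dots> = (\<integral>\<^sup>+p. emeasure noise (Pair p -` ((\<lambda>(p, u). crw_path p u) -` A \<inter> space (\<mu> \<Otimes>\<^sub>M noise))) \<partial>\<mu>)"
      by (intro nn_integral_cong, subst emeasure_distr)
        (auto simp: space_pair_measure intro!: arg_cong[where f = "emeasure noise"])
    also have "\<dots> = emeasure (\<mu> \<Otimes>\<^sub>M noise) ((\<lambda>(p, u). crw_path p u) -` A \<inter> space (\<mu> \<Otimes>\<^sub>M noise))"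
      by (rule N.emeasure_pair_measure_alt[symmetric]) (rule measurable_sets[OF path A])
    also have "\<dots> = emeasure ?R A" by (rule emeasure_distr[symmetric, OF path A])
    finally show "emeasure ?L A = emeasure ?R A" .
  qed
  finally show ?thesis .
qed

section \<open>Correlations of the annealed walk\<close>

definition walk_corr :: "real \<Rightarrow> nat \<Rightarrow> real" where
  "walk_corr H n = fact n / pochhammer (3 - 2 * H) n"

definition walk_var :: "real \<Rightarrow> nat \<Rightarrow> real" where
  "walk_var H n = (\<Sum>i<n. \<Sum>j<n. walk_corr H (nat \<bar>int i - int j\<bar>))"

definition walk_cov :: "real \<Rightarrow> nat \<Rightarrow> nat \<Rightarrow> real" where
  "walk_cov H m n = (\<Sum>i<m. \<Sum>j<n. walk_corr H (nat \<bar>int i - int j\<bar>))"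

lemma walk_corr_0 [simp]: "walk_corr H 0 = 1"
  by (simp add: walk_corr_def)

lemma walk_var_0 [simp]: "walk_var H 0 = 0"
  by (simp add: walk_var_def)

lemma walk_corr_nonneg: "H < 1 \<Longrightarrow> walk_corr H n \<ge> 0"
  unfolding walk_corr_def by (intro divide_nonneg_pos pochhammer_pos) auto

text \<open>The ratio of consecutive terms with denominators cleared; the summation formulas below
  rest on this and on the value at 0.\<close>

lemma walk_corr_Suc:
  assumes "H < 1"
  shows "(real n + (3 - 2 * H)) * walk_corr H (Suc n) = (real n + 1) * walk_corr H n"
proof -
  define a where "a = 3 - 2 * H"
  have "pochhammer a n > 0" "a + real n > 0"
    using assms by (auto simp: a_def intro!: pochhammer_pos add_pos_nonneg)
  then have "a + real n \<noteq> 0" by simp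
  then have "(a + real n) * ((real n + 1) * fact n / (pochhammer a n * (a + real n))) = (real n + 1) * (fact n / pochhammer a n)"
    by simp
  then show ?thesis unfolding walk_corr_def a_def[symmetric] pochhammer_Suc fact_Suc
    by (simp add: add.commute)
qed

text \<open>Telescoping: by the recurrence, \<open>(2 * H - 1) * walk_corr H (Suc n)\<close> is the
  difference of consecutive values of \<open>(real n + 1) * walk_corr H n\<close>.\<close>

lemma walk_corr_sum:
  assumes "1/2 < H" "H < 1"
  shows "(2 * H - 1) * (\<Sum>k<Suc n. walk_corr H k) = (real n + 1) * walk_corr H n - (2 - 2 * H)"
proof (induction n)
  case (Suc n)
  have "(2 * H - 1) * (\<Sum>k<Suc (Suc n). walk_corr H k) =
      (real n + 1) * walk_corr H n - (2 - 2 * H) + (2 * H - 1) * walk_corr H (Suc n)"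
    using Suc.IH by (simp only: sum.lessThan_Suc[of _ "Suc n"] distrib_left)
  also have "\<dots> = (real (Suc n) + 1) * walk_corr H (Suc n) - (2 - 2 * H)"
    using walk_corr_Suc[OF assms(2), of n] by (simp add: algebra_simps)
  finally show ?case .
qed simp

text \<open>Enlarging the square of index pairs by one adds a row and a column with lags
  \<open>1..n\<close> each, and the diagonal entry 1.\<close>

lemma walk_var_Suc: "walk_var H (Suc n) = walk_var H n + 2 * (\<Sum>k<Suc n. walk_corr H k) - 1"
proof -
  have "(\<Sum>i<n. walk_corr H (n - i)) = (\<Sum>i<n. walk_corr H (Suc (n - Suc i)))"
    by (intro sum.cong) (auto simp: Suc_diff_Suc)
  also have "\<dots> = (\<Sum>k<n. walk_corr H (Suc k))" by (rule sum.nat_diff_reindex)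
  also have "\<dots> = (\<Sum>k<Suc n. walk_corr H k) - 1" by (simp only: sum.lessThan_Suc_shift walk_corr_0)
  finally have s: "(\<Sum>i<n. walk_corr H (n - i)) = (\<Sum>k<Suc n. walk_corr H k) - 1" .
  have "(\<Sum>i<n. walk_corr H (nat \<bar>int i - int n\<bar>)) = (\<Sum>i<n. walk_corr H (n - i))"
    by (intro sum.cong arg_cong[where f = "walk_corr H"]) auto
  moreover have "(\<Sum>j<n. walk_corr H (nat \<bar>int n - int j\<bar>)) = (\<Sum>i<n. walk_corr H (n - i))"
    by (intro sum.cong arg_cong[where f = "walk_corr H"]) auto
  ultimately show ?thesis using s by (simp add: walk_var_def sum.distrib)
qed

text \<open>The prefactor is the numerator of \<open>c_H\<close> squared. In the induction the new
  correlations contribute \<open>2 * H\<close>, completing \<open>real n + (2 - 2 * H)\<close> to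
  \<open>real n + 2\<close>, after which the recurrence shifts the index.\<close>

lemma walk_var_closed:
  assumes "1/2 < H" "H < 1"
  shows "H * (2 * H - 1) * walk_var H n =
    (real n + 1) * (real n + (2 - 2 * H)) * walk_corr H n - (2 - 2 * H) - real n * H * (3 - 2 * H)"
proof (induction n)
  case 0
  show ?case by (simp add: walk_var_def)
next
  case (Suc n)
  have "H * (2 * H - 1) * walk_var H (Suc n) = H * (2 * H - 1) * walk_var H n
      + 2 * H * ((2 * H - 1) * (\<Sum>k<Suc n. walk_corr H k)) - H * (2 * H - 1)"
    unfolding walk_var_Suc by (simp add: algebra_simps)
  also have "\<dots> = (real n + 1) * (real n + (2 - 2 * H)) * walk_corr H n - (2 - 2 * H) - real n * H * (3 - 2 * H)
      + 2 * H * ((real n + 1) * walk_corr H n - (2 - 2 * H)) - H * (2 * H - 1)"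
    unfolding Suc.IH walk_corr_sum[OF assms] ..
  also have "\<dots> = (real n + 2) * ((real n + 1) * walk_corr H n) - (2 - 2 * H) - (real n + 1) * H * (3 - 2 * H)"
    by (simp add: algebra_simps)
  also have "\<dots> = (real n + 2) * ((real n + (3 - 2 * H)) * walk_corr H (Suc n)) - (2 - 2 * H) - (real n + 1) * H * (3 - 2 * H)"
    unfolding walk_corr_Suc[OF assms(2)] ..
  finally show ?case by (simp add: algebra_simps)
qed

text \<open>Essentially the Gauss product for \<open>Gamma (3 - 2 * H)\<close>: the Pochhammer
  symbol in \<open>Gamma_series\<close> has one factor more than that in \<open>walk_corr\<close>,
  hence the correction \<open>(3 - 2 * H) / n + 1\<close>, which tends to 1.\<close>

lemma walk_corr_asymptotics:
  assumes "1/2 < H" "H < 1"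
  shows "(\<lambda>n. walk_corr H n * real n powr (2 - 2 * H)) \<longlonglongrightarrow> Gamma (3 - 2 * H)"
proof -
  have "(\<lambda>n. Gamma_series (3 - 2 * H) n * ((3 - 2 * H) / real n + 1)) \<longlonglongrightarrow> Gamma (3 - 2 * H) * (0 + 1)"
    by (intro tendsto_intros lim_const_over_n)
  moreover have "eventually (\<lambda>n. Gamma_series (3 - 2 * H) n * ((3 - 2 * H) / real n + 1) =
      walk_corr H n * real n powr (2 - 2 * H)) sequentially"
    using eventually_gt_at_top[of 0]
  proof eventually_elim
    case (elim n)
    define a where "a = 3 - 2 * H"
    have p: "pochhammer a n > 0" "a + real n > 0"
      using assms by (auto simp: a_def intro!: pochhammer_pos add_pos_nonneg)
    have "exp ((3 - 2 * H) * ln (real n)) = real n powr (1 + (2 - 2 * H))"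
      using elim by (simp add: powr_def)
    also have "\<dots> = real n * real n powr (2 - 2 * H)"
      using elim powr_add[of "real n" 1 "2 - 2 * H"] by simp
    finally have e: "exp (a * ln (real n)) = real n * real n powr (2 - 2 * H)" unfolding a_def .
    have "Gamma_series a n * (a / real n + 1) = fact n / pochhammer a n * real n powr (2 - 2 * H)"
    proof -
      have "F * (m * X) / (P * s) * (s / m) = F / P * X" if "s \<noteq> 0" "m \<noteq> 0" for F m X P s :: real
        using that by simp
      then have "fact n * (real n * real n powr (2 - 2 * H)) / (pochhammer a n * (a + real n)) * ((a + real n) / real n)
          = fact n / pochhammer a n * real n powr (2 - 2 * H)" using p(2) elim by auto
      moreover have "a / real n + 1 = (a + real n) / real n" using elim by (simp add: add_divide_distrib)
      ultimately show ?thesis by (simp add: Gamma_series_def e pochhammer_Suc)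
    qed
    then show ?case by (simp add: a_def walk_corr_def)
  qed
  ultimately show ?thesis by (simp add: Lim_transform_eventually)
qed

text \<open>In the closed form only the term of order \<open>n * n * walk_corr H n\<close> survives
  division by \<open>n powr (2 * H)\<close>; the constant and linear terms vanish because
  \<open>2 * H > 1\<close>. The surviving limit \<open>Gamma (3 - 2 * H)\<close> explains the
  denominator in \<open>c_H\<close>.\<close>

lemma walk_var_asymptotics:
  assumes H: "1/2 < H" "H < 1"
  shows "(\<lambda>n. (c_H H)\<^sup>2 * walk_var H n / real n powr (2 * H)) \<longlonglongrightarrow> 1"
proof -
  have G: "Gamma (3 - 2 * H) > 0" using H by (intro Gamma_real_pos) simp
  have c: "(c_H H)\<^sup>2 = H * (2 * H - 1) / Gamma (3 - 2 * H)"
    unfolding c_H_def using H G by (intro real_sqrt_pow2) auto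
  have p1: "(\<lambda>n. real n powr (- (2 * H))) \<longlonglongrightarrow> 0"
    using H by (intro tendsto_neg_powr filterlim_real_sequentially) auto
  have p2: "(\<lambda>n. real n powr (- (2 * H - 1))) \<longlonglongrightarrow> 0"
    using H by (intro tendsto_neg_powr filterlim_real_sequentially) auto
  have "(\<lambda>n. (1 + 1 / real n) * (1 + (2 - 2 * H) / real n) * (walk_corr H n * real n powr (2 - 2 * H))
      - (2 - 2 * H) * real n powr (- (2 * H)) - H * (3 - 2 * H) * real n powr (- (2 * H - 1)))
    \<longlonglongrightarrow> (1 + 0) * (1 + 0) * Gamma (3 - 2 * H) - (2 - 2 * H) * 0 - H * (3 - 2 * H) * 0"
    by (intro tendsto_intros lim_const_over_n walk_corr_asymptotics[OF H] p1 p2)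
  moreover have "eventually (\<lambda>n. (1 + 1 / real n) * (1 + (2 - 2 * H) / real n) * (walk_corr H n * real n powr (2 - 2 * H))
      - (2 - 2 * H) * real n powr (- (2 * H)) - H * (3 - 2 * H) * real n powr (- (2 * H - 1)) =
      H * (2 * H - 1) * walk_var H n / real n powr (2 * H)) sequentially"
    using eventually_gt_at_top[of 0]
  proof eventually_elim
    case (elim n)
    let ?q = "real n powr (2 * H)"
    have q: "?q > 0" using elim by simp
    have e1: "real n powr (2 - 2 * H) = real n * real n / ?q"
      using elim by (simp add: powr_diff power2_eq_square[symmetric])
    have e2: "real n powr (- (2 * H)) = 1 / ?q" by (simp add: powr_minus_divide)
    have e3: "real n powr (- (2 * H - 1)) = real n / ?q"
      using elim powr_diff[of "real n" 1 "2 * H"] by simp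
    have "(1 + 1 / real n) * (1 + (2 - 2 * H) / real n) * (walk_corr H n * (real n * real n / ?q))
      = (real n + 1) * (real n + (2 - 2 * H)) * walk_corr H n / ?q"
      using elim by (simp add: field_simps)
    moreover have "A / ?q - b * (1 / ?q) - h * c * (m / ?q) = (A - b - m * h * c) / ?q" for A b h c m :: real
      by (simp add: diff_divide_distrib mult_ac)
    ultimately show ?case unfolding e1 e2 e3 walk_var_closed[OF H] by simp
  qed
  ultimately have "(\<lambda>n. H * (2 * H - 1) * walk_var H n / real n powr (2 * H)) \<longlonglongrightarrow> Gamma (3 - 2 * H)"
    by (subst (asm) tendsto_cong) auto
  from tendsto_divide[OF this tendsto_const, of "Gamma (3 - 2 * H)"]
  show ?thesis using G by (simp add: c mult.commute[of "Gamma _"])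
qed

text \<open>Polarisation and stationarity: the square of index pairs from \<open>m\<close> to
  \<open>n\<close> is a translate of one starting at 0. The right side already has the shape of the
  covariance of fractional Brownian motion.\<close>

lemma walk_cov_eq:
  "walk_cov H m n = (walk_var H m + walk_var H n - walk_var H (nat \<bar>int m - int n\<bar>)) / 2"
proof -
  let ?r = "\<lambda>i j. walk_corr H (nat \<bar>int i - int j\<bar>)"
  have sym: "?r i j = ?r j i" for i j by (simp add: abs_minus_commute)
  have main: "walk_cov H m n = (walk_var H m + walk_var H n - walk_var H (n - m)) / 2" if mn: "m \<le> n" for m n
  proof -
    have split: "(\<Sum>i<n. f i) = (\<Sum>i<m. f i) + (\<Sum>i=m..<n. f i)" for f :: "nat \<Rightarrow> real"
      using sum.atLeastLessThan_concat[of 0 m n f] mn by (simp add: atLeast0LessThan)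
    have sh: "(\<Sum>i=m..<n. f i) = (\<Sum>i<n-m. f (i + m))" for f :: "nat \<Rightarrow> real"
      using sum.shift_bounds_nat_ivl[of f 0 m "n - m"] mn by (simp add: atLeast0LessThan)
    have "(\<Sum>i=m..<n. \<Sum>j=m..<n. ?r i j) = walk_var H (n - m)"
      unfolding sh walk_var_def by simp
    moreover have "(\<Sum>i=m..<n. \<Sum>j<m. ?r i j) = (\<Sum>i<m. \<Sum>j=m..<n. ?r i j)"
      by (subst sum.swap) (simp add: sym)
    ultimately show ?thesis
      unfolding walk_cov_def walk_var_def[of H n] walk_var_def[of H m] split by (simp add: sum.distrib)
  qed
  have "walk_cov H m n = walk_cov H n m"
    unfolding walk_cov_def by (subst sum.swap) (simp add: sym)
  moreover have "nat \<bar>int m - int n\<bar> = (if m \<le> n then n - m else m - n)" by auto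
  ultimately show ?thesis
    using main[of m n] main[of n m] by (cases "m \<le> n") simp_all
qed

text \<open>A convergent sequence is bounded, and at \<open>n = 0\<close> both sides vanish. Unlike
  the asymptotics, this controls every \<open>n\<close>.\<close>

lemma walk_var_bound:
  assumes "1/2 < H" "H < 1"
  obtains C where "C \<ge> 0" "\<And>n. (c_H H)\<^sup>2 * walk_var H n \<le> C * real n powr (2 * H)"
proof -
  have "Bseq (\<lambda>n. (c_H H)\<^sup>2 * walk_var H n / real n powr (2 * H))"
    using walk_var_asymptotics[OF assms] by (intro convergent_imp_Bseq convergentI)
  then obtain C where C: "C > 0" "\<And>n. \<bar>(c_H H)\<^sup>2 * walk_var H n / real n powr (2 * H)\<bar> \<le> C"
    unfolding Bseq_def by auto
  have "(c_H H)\<^sup>2 * walk_var H n \<le> C * real n powr (2 * H)" for n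
  proof (cases "n = 0")
    case False
    then have "real n powr (2 * H) > 0" by simp
    then show ?thesis using C(2)[of n] by (simp add: field_simps abs_le_iff)
  qed simp
  then show ?thesis using that[of C] C by auto
qed

section \<open>Moments of the mixing measure and of the annealed walk\<close>

text \<open>The substitution \<open>p = (1 + q) / 2\<close> sends \<open>2 * p - 1\<close> to
  \<open>q\<close> and the density to \<open>(2 - 2 * H) * (1 - q) powr (1 - 2 * H)\<close> on
  \<open>[0, 1]\<close>, which leaves a Beta integral. The case \<open>n = 0\<close> shows that the
  total mass is 1.\<close>

lemma nn_integral_mu_H:
  assumes H: "1/2 < H" "H < 1"
  shows "(\<integral>\<^sup>+p. ennreal ((2 * p - 1) ^ n) \<partial>mu_H H) = ennreal (walk_corr H n)"
proof -
  let ?d = "\<lambda>p. (1 - H) * 2 powr (3 - 2 * H) * (1 - p) powr (1 - 2 * H)"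
  have d0: "?d p \<ge> 0" for p using H by simp
  have "(\<integral>\<^sup>+p. ennreal ((2 * p - 1) ^ n) \<partial>mu_H H) =
    (\<integral>\<^sup>+p. ennreal (?d p) * ennreal ((2 * p - 1) ^ n) \<partial>restrict_space lborel {1/2..1})"
    unfolding mu_H_def by (rule nn_integral_density; intro measurable_restrict_space1; measurable)
  also have "\<dots> = (\<integral>\<^sup>+p. ennreal (?d p) * ennreal ((2 * p - 1) ^ n) * indicator {1/2..1} p \<partial>lborel)"
    by (rule nn_integral_restrict_space) simp
  also have "\<dots> = ennreal \<bar>1/2\<bar> * (\<integral>\<^sup>+q. ennreal (?d (1/2 + 1/2 * q)) * ennreal ((2 * (1/2 + 1/2 * q) - 1) ^ n) * indicator {1/2..1} (1/2 + 1/2 * q) \<partial>lborel)"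
    by (rule nn_integral_real_affine) auto
  also have "\<dots> = (\<integral>\<^sup>+q. ennreal (1/2) * (ennreal (?d (1/2 + 1/2 * q)) * ennreal ((2 * (1/2 + 1/2 * q) - 1) ^ n) * indicator {1/2..1} (1/2 + 1/2 * q)) \<partial>lborel)"
    by (subst nn_integral_cmult) auto
  also have "\<dots> = (\<integral>\<^sup>+q. ennreal (2 - 2 * H) * (ennreal (q powr (real (Suc n) - 1) * (1 - q) powr ((2 - 2 * H) - 1)) * indicator {0..1} q) \<partial>lborel)"
  proof (rule nn_integral_cong_AE)
    show "AE q in lborel. ennreal (1/2) * (ennreal (?d (1/2 + 1/2 * q)) * ennreal ((2 * (1/2 + 1/2 * q) - 1) ^ n) * indicator {1/2..1} (1/2 + 1/2 * q))
      = ennreal (2 - 2 * H) * (ennreal (q powr (real (Suc n) - 1) * (1 - q) powr ((2 - 2 * H) - 1)) * indicator {0..1} q)"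
      \<comment> \<open>At \<open>q = 0\<close> the two sides differ for \<open>n = 0\<close>, since
        \<open>0 powr 0 = 0\<close> but \<open>0 ^ 0 = 1\<close>.\<close>
      using AE_lborel_singleton[of 0]
    proof eventually_elim
      case (elim q)
      show ?case
      proof (cases "q \<in> {0..1}")
        case True
        then have q: "q > 0" "q \<le> 1" using elim by auto
        have "(1 - (1/2 + 1/2 * q)) powr (1 - 2 * H) = ((1 - q) / 2) powr (1 - 2 * H)"
          by (simp add: field_simps)
        also have "\<dots> = (1 - q) powr (1 - 2 * H) / 2 powr (1 - 2 * H)"
          using q by (simp add: powr_divide)
        finally have "?d (1/2 + 1/2 * q) = (1 - H) * (2 powr (3 - 2 * H) / 2 powr (1 - 2 * H)) * (1 - q) powr (1 - 2 * H)"
          by simp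
        also have "2 powr (3 - 2 * H) / 2 powr (1 - 2 * H) = (2::real) powr 2"
          by (simp add: powr_diff[symmetric])
        finally have d: "?d (1/2 + 1/2 * q) = 4 * (1 - H) * (1 - q) powr (1 - 2 * H)" by simp
        have "q powr (real (Suc n) - 1) = q ^ n" using q by (simp add: powr_realpow)
        moreover have "(2 * (1/2 + 1/2 * q) - 1) ^ n = q ^ n" by (simp add: field_simps)
        moreover have "1/2 + 1/2 * q \<in> {1/2..1}" using q by auto
        moreover have "ennreal (1/2) * (ennreal D * ennreal E) = ennreal (1/2 * (D * E))" if "D \<ge> 0" for D E
          by (subst ennreal_mult', simp, subst ennreal_mult'[OF that], rule refl)
        moreover have "4 * (1 - H) * (1 - q) powr (1 - 2 * H) \<ge> 0" "2 - 2 * H \<ge> 0" using H by auto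
        moreover have "1/2 * (4 * (1 - H) * P * Q) = (2 - 2 * H) * (Q * P)" for P Q by (simp add: algebra_simps)
        ultimately show ?thesis using True H unfolding d
          by (simp only: indicator_simps mult_1_right ennreal_mult'[symmetric])
            simp
      next
        case False
        then have "1/2 + 1/2 * q \<notin> {1/2..1}" by auto
        then show ?thesis using False by simp
      qed
    qed
  qed
  also have "\<dots> = ennreal (2 - 2 * H) * (\<integral>\<^sup>+q. ennreal (q powr (real (Suc n) - 1) * (1 - q) powr ((2 - 2 * H) - 1)) * indicator {0..1} q \<partial>lborel)"
    by (rule nn_integral_cmult) auto
  also have "(\<integral>\<^sup>+q. ennreal (q powr (real (Suc n) - 1) * (1 - q) powr ((2 - 2 * H) - 1)) * indicator {0..1} q \<partial>lborel)
     = ennreal (Beta (real (Suc n)) (2 - 2 * H))"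
    using H by (intro nn_integral_has_integral_lebesgue' has_integral_Beta_real) auto
  also have "ennreal (2 - 2 * H) * \<dots> = ennreal ((2 - 2 * H) * Beta (real (Suc n)) (2 - 2 * H))"
    using H by (simp add: ennreal_mult')
  also have "(2 - 2 * H) * Beta (real (Suc n)) (2 - 2 * H) = walk_corr H n"
  proof -
    have p: "3 - 2 * H > 0" using H by simp
    have g1: "(2 - 2 * H) * Gamma (2 - 2 * H) = Gamma (3 - 2 * H)"
    proof -
      have "2 - 2 * H \<notin> \<int>\<^sub>\<le>\<^sub>0" using H by (auto dest: nonpos_Ints_nonpos)
      from Gamma_plus1[OF this] show ?thesis by simp
    qed
    have g2: "Gamma (real (Suc n)) = fact n" using Gamma_fact[of n, where 'a = real] by (simp add: add_ac)
    have g3: "pochhammer (3 - 2 * H) n = Gamma (3 - 2 * H + real n) / Gamma (3 - 2 * H)"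
      using p by (intro pochhammer_Gamma) (auto elim!: nonpos_Ints_cases)
    have g4: "real (Suc n) + (2 - 2 * H) = 3 - 2 * H + real n" by simp
    have "(2 - 2 * H) * Beta (real (Suc n)) (2 - 2 * H) =
        Gamma (real (Suc n)) * ((2 - 2 * H) * Gamma (2 - 2 * H)) / Gamma (real (Suc n) + (2 - 2 * H))"
      by (simp only: Beta_def times_divide_eq_right mult.left_commute)
    then show ?thesis unfolding g1 g2 g4 walk_corr_def g3 by simp
  qed
  finally show ?thesis .
qed

lemma sets_mu_H: "sets (mu_H H) = sets (restrict_space borel {1/2..1})"
  unfolding mu_H_def by (simp add: sets_restrict_space)

lemma space_mu_H [simp]: "space (mu_H H) = {1/2..1}"
  unfolding mu_H_def by (simp add: space_restrict_space)

lemma measurable_mu_H: "(\<lambda>p. p) \<in> mu_H H \<rightarrow>\<^sub>M borel"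
  using measurable_cong_sets[OF sets_mu_H refl] measurable_restrict_space1[OF measurable_ident, of borel "{1/2..1}"]
  by (auto simp: id_def)

lemma prob_space_mu_H: "1/2 < H \<Longrightarrow> H < 1 \<Longrightarrow> prob_space (mu_H H)"
  using nn_integral_mu_H[of H 0] by (intro prob_spaceI) simp

lemma integral_mu_H:
  assumes H: "1/2 < H" "H < 1"
  shows "(LINT p|mu_H H. (2 * p - 1) ^ n) = walk_corr H n"
proof -
  have "(LINT p|mu_H H. (2 * p - 1) ^ n) = enn2real (\<integral>\<^sup>+p. ennreal ((2 * p - 1) ^ n) \<partial>mu_H H)"
    by (rule integral_eq_nn_integral) (auto intro: measurable_compose[OF measurable_mu_H])
  also have "\<dots> = walk_corr H n"
    using assms by (simp add: nn_integral_mu_H walk_corr_nonneg)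
  finally show ?thesis .
qed

text \<open>Each new increment is the old one times an independent sign of mean
  \<open>2 * p - 1\<close>, and what precedes it is a function of earlier uniforms, so the factors
  split off one by one. The mean is 0 because the first sign is symmetric.\<close>

lemma crw_inc_moments:
  assumes p: "p \<in> {0..1}"
  shows "(LINT u|noise. real_of_int (crw_inc p u i)) = 0"
    and "(LINT u|noise. real_of_int (crw_inc p u i) * real_of_int (crw_inc p u (i + n))) = (2 * p - 1) ^ n"
proof -
  let ?e = "\<lambda>k u. real_of_int (crw_inc p u k)"
  interpret prob_space noise by (rule prob_space_noise)
  have sgn: "(LINT u|noise. (if u m \<le> q then 1 else -1 :: real)) = 2 * q - 1" if "q \<in> {0..1}" for m q
  proof -
    have S: "{u. u m \<le> q} \<in> sets noise"
    proof -
      have "{u \<in> space noise. u m \<le> q} \<in> sets noise" by measurable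
      then show ?thesis by simp
    qed
    have "(LINT u|noise. (if u m \<le> q then 1 else -1 :: real)) = (LINT u|noise. 2 * indicat_real {u. u m \<le> q} u - 1)"
      by (intro Bochner_Integration.integral_cong) auto
    also have "\<dots> = 2 * q - 1"
      using S measure_noise_le[OF that, of m] by (simp add: prob_space[unfolded space_noise] less_top[symmetric])
    finally show ?thesis .
  qed
  have bd: "\<bar>?e k u\<bar> = 1" for u k using crw_inc_cases[of p u k] by auto
  have step: "(LINT u|noise. f u * (if u m \<le> p then 1 else -1)) = (LINT u|noise. f u) * (2 * p - 1)"
    if "f \<in> borel_measurable noise" "\<And>u. f u = f (\<lambda>i. if i < m then u i else 0)" "\<And>u. \<bar>f u\<bar> \<le> 1" for f m
    using noise_indep[of f "\<lambda>x. if x \<le> p then 1 else -1" m 1] that sgn[OF p, of m] by simp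
  show "(LINT u|noise. ?e i u) = 0"
  proof (induction i)
    case 0
    have "?e 0 u = (if u 0 \<le> 1/2 then 1 else -1)" for u by simp
    then show ?case using sgn[of "1/2" 0] by simp
  next
    case (Suc i)
    have "(LINT u|noise. ?e (Suc i) u) = (LINT u|noise. ?e i u * (if u (Suc i) \<le> p then 1 else -1))"
      by (intro Bochner_Integration.integral_cong) auto
    also have "\<dots> = (LINT u|noise. ?e i u) * (2 * p - 1)"
      by (rule step) (auto simp: bd intro!: crw_inc_cong)
    finally show ?case using Suc by simp
  qed
  show "(LINT u|noise. ?e i u * ?e (i + n) u) = (2 * p - 1) ^ n"
  proof (induction n)
    case 0
    have "?e i u * ?e i u = 1" for u
      using crw_inc_cases[of p u i] by auto
    then show ?case by (simp add: prob_space[unfolded space_noise])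
  next
    case (Suc n)
    have "(LINT u|noise. ?e i u * ?e (i + Suc n) u) =
      (LINT u|noise. ?e i u * ?e (i + n) u * (if u (Suc (i + n)) \<le> p then 1 else -1))"
      by (intro Bochner_Integration.integral_cong) auto
    also have "\<dots> = (LINT u|noise. ?e i u * ?e (i + n) u) * (2 * p - 1)"
      by (rule step) (auto simp: bd abs_mult intro!: arg_cong2[where f = "(*)"] arg_cong[where f = real_of_int] crw_inc_cong)
    finally show ?case using Suc by simp
  qed
qed

lemma annealed_law_mu_H:
  assumes "1/2 < H" "H < 1"
  shows "annealed_law (mu_H H) = distr (mu_H H \<Otimes>\<^sub>M noise) walk_space (\<lambda>(p, u). crw_path p u)"
proof -
  interpret prob_space "mu_H H" by (rule prob_space_mu_H[OF assms])
  show ?thesis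
    by (rule annealed_law_eq[OF sets_mu_H]) (auto intro: finite_measure_axioms)
qed

text \<open>Fubini on the product of \<open>mu_H H\<close> and \<open>noise\<close> averages the
  moments for fixed \<open>p\<close>, and the average of \<open>2 * p - 1\<close> to the power of
  the lag is \<open>walk_corr\<close>. The bound by \<open>n\<close> later supplies integrability
  and finitely many values.\<close>

lemma annealed_moments:
  assumes H: "1/2 < H" "H < 1"
  defines "A \<equiv> annealed_law (mu_H H)"
  shows "prob_space A" "sets A = sets walk_space"
    and "AE x in A. \<bar>x n\<bar> \<le> int n"
    and "(LINT x|A. real_of_int (x n)) = 0"
    and "(LINT x|A. real_of_int (x m) * real_of_int (x n)) = walk_cov H m n"
proof -
  let ?P = "mu_H H \<Otimes>\<^sub>M noise"
  let ?e = "\<lambda>x i. real_of_int (crw_inc (fst x) (snd x) i)"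
  interpret \<mu>: prob_space "mu_H H" by (rule prob_space_mu_H[OF H])
  interpret N: prob_space noise by (rule prob_space_noise)
  interpret P: pair_prob_space "mu_H H" noise ..
  have A: "A = distr ?P walk_space (\<lambda>(p, u). crw_path p u)"
    unfolding A_def by (rule annealed_law_mu_H[OF H])
  have to_borel: "(\<lambda>x. (fst x, snd x)) \<in> ?P \<rightarrow>\<^sub>M borel \<Otimes>\<^sub>M noise"
    by (intro measurable_Pair measurable_compose[OF measurable_fst measurable_mu_H] measurable_snd)
  have path: "(\<lambda>(p, u). crw_path p u) \<in> ?P \<rightarrow>\<^sub>M walk_space"
    using measurable_compose[OF to_borel measurable_crw_path_pair] by (simp add: split_beta')
  have inc [measurable]: "(\<lambda>x. crw_inc (fst x) (snd x) i) \<in> ?P \<rightarrow>\<^sub>M count_space UNIV" for i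
    using measurable_compose[OF to_borel measurable_crw_inc_pair] by (simp add: split_beta')
  show "prob_space A" unfolding A by (rule P.prob_space_distr[OF path])
  show "sets A = sets walk_space" unfolding A by simp
  have incb: "\<bar>real_of_int (crw_inc p u k)\<bar> = 1" for p u k using crw_inc_cases[of p u k] by auto
  have "\<bar>crw_path p u n\<bar> \<le> int n" for p u n
  proof -
    have "\<bar>crw_path p u n\<bar> \<le> (\<Sum>i<n. \<bar>crw_inc p u i\<bar>)" unfolding crw_path_def by (rule sum_abs)
    moreover have "\<bar>crw_inc p u i\<bar> = 1" for i using crw_inc_cases[of p u i] by auto
    ultimately show ?thesis by simp
  qed
  moreover have "{x \<in> space walk_space. \<bar>x n\<bar> \<le> int n} \<in> sets walk_space" by measurable
  ultimately show "AE x in A. \<bar>x n\<bar> \<le> int n"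
    unfolding A by (subst AE_distr_iff[OF path]) (auto split: prod.split)
  have fub: "(LINT x|?P. F (fst x) (snd x)) = (LINT p|mu_H H. (LINT u|noise. F p u))"
    and intF: "integrable ?P (\<lambda>x. F (fst x) (snd x))"
    if "(\<lambda>x. F (fst x) (snd x)) \<in> borel_measurable ?P" "\<And>p u. \<bar>F p u\<bar> \<le> 1"
    for F :: "real \<Rightarrow> (nat \<Rightarrow> real) \<Rightarrow> real"
  proof -
    show i: "integrable ?P (\<lambda>x. F (fst x) (snd x))"
      by (rule P.integrable_const_bound[of _ 1]) (use that in auto)
    show "(LINT x|?P. F (fst x) (snd x)) = (LINT p|mu_H H. (LINT u|noise. F p u))"
      using P.integral_fst'[OF i] by simp
  qed
  have i1: "integrable ?P (\<lambda>x. ?e x i)"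
    "(LINT x|?P. ?e x i) = 0" for i
  proof -
    show "integrable ?P (\<lambda>x. ?e x i)"
      by (rule intF) (auto simp: incb)
    have "(LINT x|?P. ?e x i) =
      (\<integral>p. (LINT u|noise. real_of_int (crw_inc p u i)) \<partial>mu_H H)"
      by (rule fub) (auto simp: incb)
    also have "\<dots> = (LINT p|mu_H H. 0)"
      by (intro Bochner_Integration.integral_cong crw_inc_moments) auto
    finally show "(LINT x|?P. ?e x i) = 0" by simp
  qed
  have i2: "integrable ?P (\<lambda>x. ?e x i * ?e x j)"
    for i j by (rule intF) (auto simp: incb abs_mult)
  have i3: "(LINT x|?P. ?e x i * ?e x j) = walk_corr H (j - i)"
    if ij: "i \<le> j" for i j
  proof -
    have "(LINT x|?P. ?e x i * ?e x j) =
      (\<integral>p. (LINT u|noise. real_of_int (crw_inc p u i) * real_of_int (crw_inc p u j)) \<partial>mu_H H)"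
      by (rule fub) (auto simp: incb abs_mult)
    also have "\<dots> = (LINT p|mu_H H. (2 * p - 1) ^ (j - i))"
      using crw_inc_moments(2)[of _ i "j - i"] ij by (intro Bochner_Integration.integral_cong) auto
    finally show ?thesis using integral_mu_H[OF H] by simp
  qed
  have i4: "(LINT x|?P. ?e x i * ?e x j) = walk_corr H (nat \<bar>int i - int j\<bar>)"
    for i j
  proof (cases "i \<le> j")
    case True
    then show ?thesis using i3[OF True] by (simp add: nat_diff_distrib abs_if)
  next
    case False
    then have "nat \<bar>int i - int j\<bar> = i - j" by auto
    then show ?thesis using i3[of j i] False by (simp add: mult.commute)
  qed
  have "(LINT x|A. real_of_int (x n)) = (LINT x|?P. real_of_int (crw_path (fst x) (snd x) n))"
    unfolding A by (subst integral_distr[OF path]) (auto simp: split_beta')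
  also have "\<dots> = 0" using i1 by (simp add: crw_path_def)
  finally show "(LINT x|A. real_of_int (x n)) = 0" .
  have "(LINT x|A. real_of_int (x m) * real_of_int (x n)) =
    (LINT x|?P. real_of_int (crw_path (fst x) (snd x) m) * real_of_int (crw_path (fst x) (snd x) n))"
    unfolding A by (subst integral_distr[OF path]) (auto simp: split_beta')
  also have "\<dots> = walk_cov H m n"
    using i2 i4 by (simp add: crw_path_def walk_cov_def sum_product)
  finally show "(LINT x|A. real_of_int (x m) * real_of_int (x n)) = walk_cov H m n" .
qed

section \<open>Gaussian families\<close>

lemma std_normal_integral_cos:
  "(LINT x|std_normal_distribution. cos (s * x + b)) = cos b * exp (- s\<^sup>2 / 2)"
proof -
  interpret N: real_distribution std_normal_distribution by (rule real_dist_normal_dist)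
  have i: "integrable std_normal_distribution (\<lambda>x. iexp (s * x + b))"
    by (rule N.integrable_const_bound[of _ 1]) auto
  have "(LINT x|std_normal_distribution. cos (s * x + b)) = (LINT x|std_normal_distribution. Re (iexp (s * x + b)))"
    by (simp add: Re_exp)
  also have "\<dots> = Re (LINT x|std_normal_distribution. iexp (s * x + b))"
    by (rule integral_Re[OF i])
  also have "(LINT x|std_normal_distribution. iexp (s * x + b)) = (LINT x|std_normal_distribution. iexp (s * x) * iexp b)"
    by (simp add: distrib_left exp_add)
  also have "\<dots> = char std_normal_distribution s * iexp b"
    unfolding char_def by simp
  also have "\<dots> = complex_of_real (exp (- s\<^sup>2 / 2)) * iexp b" by (simp add: char_std_normal_distribution)
  finally show ?thesis by (simp add: Re_exp mult.commute)
qed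

lemma (in prob_space) integral_cos_char:
  assumes [measurable]: "Y \<in> borel_measurable M"
  shows "(LINT w|M. cos (t * Y w + b)) = Re (iexp b * char (distr M borel Y) t)"
proof -
  have i: "integrable M (\<lambda>w. iexp (t * Y w + b))"
    by (rule integrable_const_bound[of _ 1]) auto
  have "(LINT w|M. cos (t * Y w + b)) = (LINT w|M. Re (iexp (t * Y w + b)))"
    by (simp add: Re_exp)
  also have "\<dots> = Re (LINT w|M. iexp (t * Y w + b))" by (rule integral_Re[OF i])
  also have "(LINT w|M. iexp (t * Y w + b)) = (LINT w|M. iexp b * iexp (t * Y w))"
    by (simp add: distrib_left exp_add mult.commute)
  also have "\<dots> = iexp b * char (distr M borel Y) t"
    unfolding char_def by (simp add: integral_distr)
  finally show ?thesis .
qed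

text \<open>\<open>gaussian_rv\<close> gives an equality of laws, so all integrals are moved to the
  affine image \<open>m + s * x\<close> of a standard normal; the zero mean forces
  \<open>m = 0\<close>, and \<open>s = 0\<close> is allowed.\<close>

lemma gaussian_rv_centered:
  assumes M: "prob_space M" and Y: "gaussian_rv M Y" and mean: "(LINT w|M. Y w) = 0"
  shows "integrable M (\<lambda>w. (Y w)\<^sup>2)"
    and "(LINT w|M. cos (Y w + b)) = cos b * exp (- (LINT w|M. (Y w)\<^sup>2) / 2)"
proof -
  define N where "N = std_normal_distribution"
  interpret N: real_distribution N unfolding N_def by (rule real_dist_normal_dist)
  have [measurable]: "Y \<in> borel_measurable M" using Y by (simp add: gaussian_rv_def)
  obtain m s where d: "distr M borel Y = distr N borel (\<lambda>x. m + s * x)"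
    using Y by (auto simp: gaussian_rv_def N_def)
  have tr: "(LINT w|M. f (Y w)) = (LINT x|N. f (m + s * x))" "integrable M (\<lambda>w. f (Y w)) \<longleftrightarrow> integrable N (\<lambda>x. f (m + s * x))"
    if [measurable]: "f \<in> borel_measurable borel" for f :: "real \<Rightarrow> real"
    using integral_distr[of Y M borel f] integral_distr[of "\<lambda>x. m + s * x" N borel f]
      integrable_distr_eq[of Y M borel f] integrable_distr_eq[of "\<lambda>x. m + s * x" N borel f] d by simp_all
  have i1: "integrable N (\<lambda>x. x)" "(LINT x|N. x) = 0"
    unfolding N_def using integrable_std_normal_distribution_moment[of 1] integral_std_normal_distribution_moment_odd[of 1] by auto
  have i2: "integrable N (\<lambda>x. x\<^sup>2)" "(LINT x|N. x\<^sup>2) = 1"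
    unfolding N_def using std_normal_distribution_even_moments[of 1] by (auto simp: fact_numeral)
  have "(LINT w|M. Y w) = (LINT x|N. m + s * x)" by (rule tr(1)) measurable
  also have "\<dots> = (LINT x|N. m) + (LINT x|N. s * x)"
    by (rule Bochner_Integration.integral_add) (use i1 in auto)
  also have "\<dots> = m" using i1(2) by (simp add: N.prob_space del: N.space_eq_univ)
  finally have "(LINT w|M. Y w) = m" .
  then have m: "m = 0" using mean by simp
  have "integrable N (\<lambda>x. (m + s * x)\<^sup>2)" using i2 by (simp add: m power_mult_distrib)
  then show "integrable M (\<lambda>w. (Y w)\<^sup>2)" using tr(2)[of "\<lambda>x. x\<^sup>2"] by simp
  have "(LINT w|M. (Y w)\<^sup>2) = s\<^sup>2" using tr(1)[of "\<lambda>x. x\<^sup>2"] i2 by (simp add: m power_mult_distrib)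
  moreover have "(LINT w|M. cos (Y w + b)) = cos b * exp (- s\<^sup>2 / 2)"
  proof -
    have "(\<lambda>x. cos (x + b)) \<in> borel_measurable borel" by measurable
    from tr(1)[OF this] show ?thesis using std_normal_integral_cos[of s b] by (simp add: m N_def)
  qed
  ultimately show "(LINT w|M. cos (Y w + b)) = cos b * exp (- (LINT w|M. (Y w)\<^sup>2) / 2)" by simp
qed

text \<open>Mixed terms vanish by independence and centring; integrability is part of the induction
  because the partial sums enter the products.\<close>

lemma (in prob_space) integral_square_indep_sum:
  fixes X :: "'i \<Rightarrow> 'a \<Rightarrow> real"
  assumes "finite I" "indep_vars (\<lambda>_. borel) X I"
    and "\<And>i. i \<in> I \<Longrightarrow> integrable M (\<lambda>w. (X i w)\<^sup>2)" "\<And>i. i \<in> I \<Longrightarrow> (LINT w|M. X i w) = 0"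
  shows "integrable M (\<lambda>w. (\<Sum>i\<in>I. X i w)\<^sup>2) \<and>
    (LINT w|M. (\<Sum>i\<in>I. X i w)\<^sup>2) = (\<Sum>i\<in>I. \<integral>w. (X i w)\<^sup>2 \<partial>M)"
  using assms
proof (induction I rule: finite_induct)
  case (insert i I)
  let ?S = "\<lambda>w. \<Sum>i\<in>I. X i w"
  have IH: "integrable M (\<lambda>w. (?S w)\<^sup>2)" "(LINT w|M. (?S w)\<^sup>2) = (\<Sum>i\<in>I. \<integral>w. (X i w)\<^sup>2 \<partial>M)"
    using insert.IH[OF indep_vars_subset[OF insert.prems(1)]] insert.prems by auto
  have rv: "X j \<in> borel_measurable M" if "j \<in> insert i I" for j
    using insert.prems(1) that by (auto simp: indep_vars_def)
  have i: "integrable M (X j)" if "j \<in> insert i I" for j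
    using square_integrable_imp_integrable[OF rv[OF that] insert.prems(2)[OF that]] .
  have iS: "integrable M ?S" using i by auto
  have ind: "indep_var borel (X i) borel ?S"
    by (rule indep_vars_sum[OF insert.hyps insert.prems(1)])
  have p: "integrable M (\<lambda>w. X i w * ?S w)" "(LINT w|M. X i w * ?S w) = 0"
    using indep_var_integrable[OF ind i iS] indep_var_lebesgue_integral[OF ind i iS] insert.prems(3) by auto
  have sq: "(\<Sum>j\<in>insert i I. X j w)\<^sup>2 = (X i w)\<^sup>2 + 2 * (X i w * ?S w) + (?S w)\<^sup>2" for w
    using insert.hyps by (simp add: power2_sum)
  show ?case unfolding sq using insert.hyps insert.prems(2) IH p by simp
qed simp

text \<open>Serves to renumber the walks, counted from 1, by all natural numbers, the index set in
  the central limit theorem.\<close>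

lemma (in prob_space) indep_vars_reindex:
  assumes "indep_vars M' X (f ` I)" "inj_on f I"
  shows "indep_vars (\<lambda>i. M' (f i)) (\<lambda>i. X (f i)) I"
  unfolding indep_vars_def2
proof (intro conjI ballI)
  show "random_variable (M' (f i)) (X (f i))" if "i \<in> I" for i
    using assms(1) that by (auto simp: indep_vars_def2)
  have ind: "indep_sets (\<lambda>i. {X i -` A \<inter> space M |A. A \<in> sets (M' i)}) (f ` I)"
    using assms(1) by (simp add: indep_vars_def2)
  show "indep_sets (\<lambda>i. {X (f i) -` A \<inter> space M |A. A \<in> sets (M' (f i))}) I"
  proof (rule indep_setsI)
    show "{X (f i) -` A \<inter> space M |A. A \<in> sets (M' (f i))} \<subseteq> events" if "i \<in> I" for i
      using assms(1) that by (auto simp: indep_vars_def2)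
    fix A J assume J: "J \<noteq> {}" "J \<subseteq> I" "finite J" and A: "\<forall>j\<in>J. A j \<in> {X (f j) -` B \<inter> space M |B. B \<in> sets (M' (f j))}"
    have inj: "inj_on f J" using assms(2) J(2) by (rule inj_on_subset)
    define B where "B k = A (inv_into J f k)" for k
    have B: "B (f j) = A j" if "j \<in> J" for j using inj that by (simp add: B_def)
    have "prob (\<Inter>k\<in>f ` J. B k) = (\<Prod>k\<in>f ` J. prob (B k))"
    proof (rule indep_setsD[OF ind])
      show "\<forall>j\<in>f ` J. B j \<in> {X j -` A \<inter> space M |A. A \<in> sets (M' j)}" using A B by auto
    qed (use J in auto)
    also have "(\<Prod>k\<in>f ` J. prob (B k)) = (\<Prod>j\<in>J. prob (A j))"
      using inj B by (simp add: prod.reindex)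
    also have "(\<Inter>k\<in>f ` J. B k) = (\<Inter>j\<in>J. A j)" using B by auto
    finally show "prob (\<Inter>j\<in>J. A j) = (\<Prod>j\<in>J. prob (A j))" .
  qed
qed

section \<open>Linear combinations of independent standard normals\<close>

text \<open>The coordinates are indexed by reals because the theorem asks for measures on
  \<open>real \<Rightarrow> real\<close>; for each \<open>N\<close> finitely many of them are
  used.\<close>

definition gauss_space :: "(real \<Rightarrow> real) measure" where
  "gauss_space = PiM UNIV (\<lambda>_. std_normal_distribution)"

lemma prob_space_std_normal: "prob_space std_normal_distribution"
  by (rule prob_space_normal_density) simp

lemma prob_space_gauss_space: "prob_space gauss_space"
  unfolding gauss_space_def by (intro prob_space_PiM prob_space_std_normal)

lemma measurable_gauss_coord [measurable]: "(\<lambda>w. w k) \<in> borel_measurable gauss_space"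
proof -
  have "(\<lambda>w. w k) \<in> gauss_space \<rightarrow>\<^sub>M std_normal_distribution"
    unfolding gauss_space_def by (rule measurable_component_singleton) simp
  then show ?thesis by (simp cong: measurable_cong_sets)
qed

lemma distr_gauss_coord: "distr gauss_space borel (\<lambda>w. w k) = std_normal_distribution"
proof -
  have "distr gauss_space std_normal_distribution (\<lambda>w. w k) = std_normal_distribution"
    unfolding gauss_space_def by (rule distr_PiM_component) (auto intro: prob_space_std_normal)
  then show ?thesis by (simp cong: distr_cong)
qed

lemma indep_gauss_coords: "prob_space.indep_vars gauss_space (\<lambda>_. borel) (\<lambda>k w. c k * w k) F"
proof -
  interpret prob_space gauss_space by (rule prob_space_gauss_space)
  have "indep_vars (\<lambda>_. std_normal_distribution) (\<lambda>i w. w i) UNIV"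
    unfolding gauss_space_def by (rule indep_vars_PiM_coordinates) (rule prob_space_std_normal)
  then have "indep_vars (\<lambda>_. borel) (\<lambda>k w. c k * w k) UNIV"
    by (rule indep_vars_compose2[where Y = "\<lambda>k x. c k * x"]) auto
  then show ?thesis by (rule indep_vars_subset) auto
qed

lemma gauss_linear_combination:
  assumes F: "finite F"
  shows "integrable gauss_space (\<lambda>w. (\<Sum>k\<in>F. c k * w k)\<^sup>2)"
    and "(LINT w|gauss_space. (\<Sum>k\<in>F. c k * w k)\<^sup>2) = (\<Sum>k\<in>F. (c k)\<^sup>2)"
    and "(LINT w|gauss_space. cos ((\<Sum>k\<in>F. c k * w k) + b)) = cos b * exp (- (\<Sum>k\<in>F. (c k)\<^sup>2) / 2)"
proof -
  let ?S = "\<lambda>w. \<Sum>k\<in>F. c k * w k"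
  let ?G = "gauss_space"
  interpret prob_space ?G by (rule prob_space_gauss_space)
  let ?N = std_normal_distribution
  have tr: "(LINT w|?G. f (w k)) = (LINT x|?N. f x)"
    "integrable ?G (\<lambda>w. f (w k)) \<longleftrightarrow> integrable ?N f"
    if "f \<in> borel_measurable borel" for f :: "real \<Rightarrow> real" and k
    using integral_distr[OF measurable_gauss_coord that, of k] integrable_distr_eq[OF measurable_gauss_coord that, of k]
    by (simp_all add: distr_gauss_coord)
  have i1: "(LINT w|?G. w k) = 0" for k
    using tr(1)[of "\<lambda>x. x" k] integral_std_normal_distribution_moment_odd[of 1] by auto
  have i2: "integrable ?G (\<lambda>w. (w k)\<^sup>2)" "(LINT w|?G. (w k)\<^sup>2) = 1" for k
    using tr[of "\<lambda>x. x\<^sup>2" k] std_normal_distribution_even_moments[of 1] by (auto simp: fact_numeral)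
  have "integrable ?G (\<lambda>w. (?S w)\<^sup>2) \<and>
    (LINT w|?G. (?S w)\<^sup>2) = (\<Sum>k\<in>F. \<integral>w. (c k * w k)\<^sup>2 \<partial>?G)"
    by (rule integral_square_indep_sum[OF F indep_gauss_coords]) (auto simp: power_mult_distrib i1 i2)
  then show "integrable ?G (\<lambda>w. (?S w)\<^sup>2)"
    "(LINT w|?G. (?S w)\<^sup>2) = (\<Sum>k\<in>F. (c k)\<^sup>2)"
    by (auto simp: power_mult_distrib i2)
  have "char (distr ?G borel (\<lambda>w. c k * w k)) 1 = complex_of_real (exp (- (c k)\<^sup>2 / 2))" for k
  proof -
    have "char (distr ?G borel (\<lambda>w. c k * w k)) 1 = (LINT w|?G. iexp (c k * w k))"
      unfolding char_def by (subst integral_distr) auto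
    also have "\<dots> = (LINT x|distr ?G borel (\<lambda>w. w k). iexp (c k * x))"
      by (subst integral_distr) auto
    also have "\<dots> = char ?N (c k)" unfolding distr_gauss_coord char_def ..
    finally show ?thesis by (simp add: char_std_normal_distribution)
  qed
  then have "char (distr ?G borel (\<lambda>w. \<Sum>k\<in>F. c k * w k)) 1 = (\<Prod>k\<in>F. complex_of_real (exp (- (c k)\<^sup>2 / 2)))"
    by (simp add: char_distr_sum[OF indep_gauss_coords])
  also have "\<dots> = complex_of_real (exp (\<Sum>k\<in>F. - (c k)\<^sup>2 / 2))"
    by (simp only: of_real_prod exp_sum[OF F])
  also have "(\<Sum>k\<in>F. - (c k)\<^sup>2 / 2) = - (\<Sum>k\<in>F. (c k)\<^sup>2) / 2"
    by (simp add: sum_negf sum_divide_distrib)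
  finally have ch: "char (distr ?G borel (\<lambda>w. \<Sum>k\<in>F. c k * w k)) 1 = complex_of_real (exp (- (\<Sum>k\<in>F. (c k)\<^sup>2) / 2))" .
  have "(\<lambda>w. \<Sum>k\<in>F. c k * w k) \<in> borel_measurable ?G" by measurable
  from integral_cos_char[OF this, of 1 b] show
    "(LINT w|?G. cos ((?S w) + b)) = cos b * exp (- (\<Sum>k\<in>F. (c k)\<^sup>2) / 2)"
    unfolding ch by (simp add: Re_exp)
qed

text \<open>
  The covariance of finitely many variables with finitely many joint values is a Gram matrix:
  weight each value by the square root of its probability.
\<close>

lemma (in prob_space) finite_valued_gram:
  fixes Y :: "nat \<Rightarrow> 'a \<Rightarrow> int"
  assumes Y: "\<And>n. Y n \<in> M \<rightarrow>\<^sub>M count_space UNIV" and b: "\<And>n. AE w in M. \<bar>Y n w\<bar> \<le> int n"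
  obtains F :: "real set" and c :: "nat \<Rightarrow> real \<Rightarrow> real" where "finite F"
    "\<And>m n. m \<le> N \<Longrightarrow> n \<le> N \<Longrightarrow> (LINT w|M. real_of_int (Y m w) * real_of_int (Y n w)) = (\<Sum>k\<in>F. c m k * c n k)"
proof -
  note [measurable] = Y
  have [measurable]: "(\<lambda>w. real_of_int (Y n w)) \<in> borel_measurable M" for n
    by (rule measurable_compose[OF Y]) simp
  define V where "V = PiE {..N} (\<lambda>k. {- int k..int k})"
  have V: "finite V" unfolding V_def by (intro finite_PiE) auto
  \<comment> \<open>\<open>F\<close> has to be a set of reals, the index set of
    \<open>gauss_space\<close>, so the finitely many joint values are numbered.\<close>
  obtain g :: "(nat \<Rightarrow> int) \<Rightarrow> nat" where g: "inj_on g V"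
    using finite_imp_inj_to_nat_seg[OF V] by blast
  define h :: "(nat \<Rightarrow> int) \<Rightarrow> real" where "h = (\<lambda>v. real (g v))"
  have h: "inj_on h V" using g by (auto simp: h_def inj_on_def)
  define E where "E v = {w \<in> space M. \<forall>k\<in>{..N}. Y k w = v k}" for v
  have Em [measurable]: "E v \<in> events" for v unfolding E_def by measurable
  define c where "c n x = sqrt (prob (E (the_inv_into V h x))) * real_of_int (the_inv_into V h x n)" for n x
  show ?thesis
  proof (rule that[of "h ` V" c])
    show "finite (h ` V)" using V by simp
    fix m n assume mn: "m \<le> N" "n \<le> N"
    have "AE w in M. \<forall>k\<in>{..N}. \<bar>Y k w\<bar> \<le> int k"
      using b by (intro AE_finite_allI) auto
    then have "AE w in M. real_of_int (Y m w) * real_of_int (Y n w) =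
      (\<Sum>v\<in>V. real_of_int (v m) * real_of_int (v n) * indicator (E v) w)"
      using AE_space
    proof eventually_elim
      case (elim w)
      define v' where "v' = (\<lambda>k\<in>{..N}. Y k w)"
      have "Y k w \<in> {- int k..int k}" if "k \<le> N" for k using bspec[OF elim(1), of k] that by auto
      then have v': "v' \<in> V" by (auto simp: v'_def V_def)
      have ind: "indicator (E v) w = (if v = v' then 1 else 0 :: real)" if "v \<in> V" for v
      proof -
        have "w \<in> E v \<longleftrightarrow> v = v'"
        proof
          assume "w \<in> E v"
          then have "v k = v' k" if "k \<in> {..N}" for k using that by (auto simp: E_def v'_def)
          then show "v = v'" by (intro PiE_ext[OF \<open>v \<in> V\<close>[unfolded V_def] v'[unfolded V_def]])
        qed (use elim in \<open>simp add: E_def v'_def\<close>)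
        then show ?thesis by (auto simp: indicator_def)
      qed
      have "(\<Sum>v\<in>V. real_of_int (v m) * real_of_int (v n) * indicator (E v) w) =
          (\<Sum>v\<in>V. if v = v' then real_of_int (v m) * real_of_int (v n) else 0)"
        by (rule sum.cong) (simp_all only: ind if_distrib[of "(*) _"] mult_1_right mult_zero_right)
      also have "\<dots> = real_of_int (v' m) * real_of_int (v' n)" using V v' by simp
      finally show ?case using mn by (simp add: v'_def)
    qed
    then have "(LINT w|M. real_of_int (Y m w) * real_of_int (Y n w)) =
      (LINT w|M. (\<Sum>v\<in>V. real_of_int (v m) * real_of_int (v n) * indicator (E v) w))"
      by (intro integral_cong_AE) auto
    also have "\<dots> = (\<Sum>v\<in>V. real_of_int (v m) * real_of_int (v n) * prob (E v))"
    proof -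
      have "integrable M (indicat_real (E v))" for v
        by (rule integrable_real_indicator) (simp_all add: less_top[symmetric])
      then show ?thesis by simp
    qed
    also have "\<dots> = (\<Sum>v\<in>V. c m (h v) * c n (h v))"
    proof (rule sum.cong)
      fix v assume "v \<in> V"
      then have "the_inv_into V h (h v) = v" using h by (simp add: the_inv_into_f_f)
      then show "real_of_int (v m) * real_of_int (v n) * prob (E v) = c m (h v) * c n (h v)"
      proof -
        have "c m (h v) * c n (h v) =
          (sqrt (prob (E v)) * sqrt (prob (E v))) * (real_of_int (v m) * real_of_int (v n))"
          unfolding c_def \<open>the_inv_into V h (h v) = v\<close> by (simp only: mult_ac)
        then show ?thesis by simp
      qed
    qed simp
    also have "\<dots> = (\<Sum>x\<in>h ` V. c m x * c n x)" using h by (simp add: sum.reindex)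
    finally show "(LINT w|M. real_of_int (Y m w) * real_of_int (Y n w)) = (\<Sum>k\<in>h ` V. c m k * c n k)" .
  qed
qed

section \<open>A maximal inequality by dyadic chaining\<close>

text \<open>A random bound \<open>D\<close> stands in for the maximum, so that the bounds of two
  halves can simply be added. A point of the second half is reached through the midpoint, and
  Young's inequality splits the square with weight \<open>e\<close>.\<close>

lemma dyadic_maximal:
  fixes x :: "nat \<Rightarrow> 'a \<Rightarrow> real"
  assumes q: "q > 2" and C: "C \<ge> 0"
    and int: "\<And>i j. integrable M (\<lambda>w. (x i w - x j w)\<^sup>2)"
    and incr: "\<And>a m. (LINT w|M. (x (a + 2 ^ m) w - x a w)\<^sup>2) \<le> C * q ^ m"
  shows "\<exists>D. integrable M D \<and> (\<forall>w. 0 \<le> D w) \<and> (\<forall>i\<le>2 ^ m. \<forall>w. (x (a + i) w - x a w)\<^sup>2 \<le> D w) \<and>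
    (LINT w|M. D w) \<le> (2 * (q + 2) / (q - 2)\<^sup>2 + 1) * C * q ^ m"
proof (induction m arbitrary: a)
  case 0
  let ?D = "\<lambda>w. (x (a + 1) w - x a w)\<^sup>2"
  have "(LINT w|M. ?D w) \<le> 1 * C" using incr[of a 0] by simp
  also have "\<dots> \<le> (2 * (q + 2) / (q - 2)\<^sup>2 + 1) * C" using q C by (intro mult_right_mono) auto
  finally have "(LINT w|M. ?D w) \<le> (2 * (q + 2) / (q - 2)\<^sup>2 + 1) * C * q ^ 0" by simp
  moreover have "(x (a + i) w - x a w)\<^sup>2 \<le> ?D w" if "i \<le> 2 ^ 0" for i w
    using that by (cases i) auto
  ultimately show ?case using int by (intro exI[of _ ?D]) auto
next
  case (Suc m)
  \<comment> \<open>Dictated by the recursion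
    \<open>(1 + 1 / e) + 2 * (1 + e) * K \<le> K * q\<close>; the summand 1 covers the base
    case.\<close>
  define K where "K = 2 * (q + 2) / (q - 2)\<^sup>2 + 1"
  \<comment> \<open>With this weight \<open>2 * (1 + e) = (q + 2) / 2\<close>, which is below
    \<open>q\<close> exactly because \<open>q > 2\<close>.\<close>
  define e where "e = (q - 2) / 4"
  have e: "e > 0" using q by (simp add: e_def)
  obtain D1 where D1: "integrable M D1" "\<And>w. 0 \<le> D1 w" "\<And>i w. i \<le> 2 ^ m \<Longrightarrow> (x (a + i) w - x a w)\<^sup>2 \<le> D1 w"
    "(LINT w|M. D1 w) \<le> K * C * q ^ m" using Suc[of a] unfolding K_def by blast
  obtain D2 where D2: "integrable M D2" "\<And>w. 0 \<le> D2 w" "\<And>i w. i \<le> 2 ^ m \<Longrightarrow> (x (a + 2 ^ m + i) w - x (a + 2 ^ m) w)\<^sup>2 \<le> D2 w"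
    "(LINT w|M. D2 w) \<le> K * C * q ^ m" using Suc[of "a + 2 ^ m"] unfolding K_def by blast
  define D where "D w = (1 + 1 / e) * (x (a + 2 ^ m) w - x a w)\<^sup>2 + (1 + e) * (D1 w + D2 w)" for w
  have young: "(x + y)\<^sup>2 \<le> (1 + 1 / e) * x\<^sup>2 + (1 + e) * y\<^sup>2" for x y :: real
  proof -
    have "0 \<le> (x - e * y)\<^sup>2 / e" using e by simp
    also have "\<dots> = x\<^sup>2 / e - 2 * x * y + e * y\<^sup>2"
      using e by (simp add: power2_eq_square field_simps)
    finally show ?thesis by (simp add: power2_eq_square algebra_simps)
  qed
  have "integrable M D" unfolding D_def using int D1(1) D2(1) by auto
  moreover have D0: "0 \<le> D w" for w
    unfolding D_def using e D1(2) D2(2) by (intro add_nonneg_nonneg mult_nonneg_nonneg) auto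
  moreover have "(x (a + i) w - x a w)\<^sup>2 \<le> D w" if i: "i \<le> 2 ^ Suc m" for i w
  proof (cases "i \<le> 2 ^ m")
    case True
    have "(x (a + i) w - x a w)\<^sup>2 \<le> 0 + 1 * (D1 w + 0)" using D1(3)[OF True] by simp
    also have "\<dots> \<le> D w" unfolding D_def using e D1(2)[of w] D2(2)[of w]
      by (intro add_mono mult_mono mult_nonneg_nonneg) auto
    finally show ?thesis .
  next
    case False
    define j where "j = i - 2 ^ m"
    have j: "j \<le> 2 ^ m" "i = 2 ^ m + j" using i False by (auto simp: j_def)
    have "(x (a + i) w - x a w)\<^sup>2 = ((x (a + 2 ^ m) w - x a w) + (x (a + 2 ^ m + j) w - x (a + 2 ^ m) w))\<^sup>2"
      by (simp add: j(2) add.assoc)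
    also have "\<dots> \<le> (1 + 1 / e) * (x (a + 2 ^ m) w - x a w)\<^sup>2 + (1 + e) * (x (a + 2 ^ m + j) w - x (a + 2 ^ m) w)\<^sup>2"
      by (rule young)
    also have "\<dots> \<le> D w" unfolding D_def using e D1(2)[of w] D2(3)[OF j(1), of w]
      by (intro add_left_mono mult_left_mono) auto
    finally show ?thesis .
  qed
  moreover have "(LINT w|M. D w) \<le> K * C * q ^ Suc m"
  proof -
    have "(LINT w|M. D w) = (1 + 1 / e) * (LINT w|M. (x (a + 2 ^ m) w - x a w)\<^sup>2) + (1 + e) * ((LINT w|M. D1 w) + (LINT w|M. D2 w))"
      unfolding D_def using int D1(1) D2(1) by simp
    also have "\<dots> \<le> (1 + 1 / e) * (C * q ^ m) + (1 + e) * (K * C * q ^ m + K * C * q ^ m)"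
      using e incr[of a m] D1(4) D2(4) by (intro add_mono mult_left_mono) auto
    also have "\<dots> = ((1 + 1 / e) + 2 * (1 + e) * K) * (C * q ^ m)" by (simp add: algebra_simps)
    also have "\<dots> \<le> (K * q) * (C * q ^ m)"
    proof (rule mult_right_mono)
      have "1 + 1 / e = (q + 2) / (q - 2)" using q by (simp add: e_def field_simps)
      also have "\<dots> = (2 * (q + 2) / (q - 2)\<^sup>2) * ((q - 2) / 2)"
      proof -
        have gen: "x / d = (2 * x / d\<^sup>2) * (d / 2)" if "d \<noteq> 0" for x d :: real
          using that by (simp add: power2_eq_square)
        show ?thesis by (rule gen) (use q in simp)
      qed
      also have "\<dots> \<le> K * ((q - 2) / 2)" unfolding K_def using q by (intro mult_right_mono) auto
      also have "\<dots> = K * q - 2 * (1 + e) * K" by (simp add: e_def field_simps)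
      finally show "(1 + 1 / e) + 2 * (1 + e) * K \<le> K * q" by simp
    qed (use q C in auto)
    finally show ?thesis by (simp add: mult_ac)
  qed
  ultimately show ?case unfolding K_def by blast
qed

section \<open>Superposition of independent walks\<close>

text \<open>The central limit theorem is read through characteristic functions at the frequency
  \<open>c * s\<close>, with \<open>s\<close> the standard deviation. The second moment is only
  bounded from above because for \<open>n = 0\<close> division by \<open>sqrt 0\<close> yields
  0.\<close>

lemma (in prob_space) iid_normalized_sum:
  fixes V :: "nat \<Rightarrow> 'a \<Rightarrow> real"
  assumes ind: "indep_vars (\<lambda>_. borel) V {1..}"
    and dist: "\<And>i. i \<ge> 1 \<Longrightarrow> distr M borel (V i) = \<mu>"
    and mean: "\<And>i. i \<ge> 1 \<Longrightarrow> expectation (V i) = 0"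
    and int: "\<And>i. i \<ge> 1 \<Longrightarrow> integrable M (\<lambda>w. (V i w)\<^sup>2)"
    and var: "\<And>i. i \<ge> 1 \<Longrightarrow> (LINT w|M. (V i w)\<^sup>2) = v"
  shows "integrable M (\<lambda>w. (c * (\<Sum>i=1..n. V i w) / sqrt (real n))\<^sup>2)"
    and "(LINT w|M. (c * (\<Sum>i=1..n. V i w) / sqrt (real n))\<^sup>2) \<le> c\<^sup>2 * v"
    and "(\<lambda>n. \<integral>w. cos (c * (\<Sum>i=1..n. V i w) / sqrt (real n) + b) \<partial>M) \<longlonglongrightarrow> cos b * exp (- (c\<^sup>2 * v) / 2)"
proof -
  let ?T = "\<lambda>n w. c * (\<Sum>i=1..n. V i w) / sqrt (real n)"
  have v0: "v \<ge> 0" using var[of 1] by (metis integral_nonneg_AE AE_I2 zero_le_power2 order_refl)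
  have rv [measurable]: "V (Suc i) \<in> borel_measurable M" for i
    using ind by (auto simp: indep_vars_def)
  have sum: "(\<Sum>i=1..n. V i w) = (\<Sum>i<n. V (Suc i) w)" for n w
    by (simp add: sum.atLeast1_atMost_eq)
  have "{1..} = range Suc" by (auto simp: image_iff Suc_le_eq gr0_conv_Suc)
  then have ind': "indep_vars (\<lambda>_. borel) (\<lambda>i. V (Suc i)) UNIV"
    using indep_vars_reindex[of "\<lambda>_. borel" V Suc UNIV] ind by simp
  have sq: "integrable M (\<lambda>w. (\<Sum>i<n. V (Suc i) w)\<^sup>2) \<and>
      (LINT w|M. (\<Sum>i<n. V (Suc i) w)\<^sup>2) = (\<Sum>i<n. \<integral>w. (V (Suc i) w)\<^sup>2 \<partial>M)" for n
    by (rule integral_square_indep_sum[OF _ indep_vars_subset[OF ind']]) (auto simp: int mean)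
  have rew: "(?T n w)\<^sup>2 = c\<^sup>2 / real n * (\<Sum>i<n. V (Suc i) w)\<^sup>2" for n w
    unfolding sum by (simp add: power_mult_distrib power_divide)
  show "integrable M (\<lambda>w. (?T n w)\<^sup>2)"
    unfolding rew using sq by auto
  have "(LINT w|M. (?T n w)\<^sup>2) = c\<^sup>2 / real n * (real n * v)"
    unfolding rew using sq[of n] by (simp add: var)
  also have "\<dots> \<le> c\<^sup>2 * v" using v0 by (cases "n = 0") auto
  finally show "(LINT w|M. (?T n w)\<^sup>2) \<le> c\<^sup>2 * v" .
  show "(\<lambda>n. \<integral>w. cos (?T n w + b) \<partial>M) \<longlonglongrightarrow> cos b * exp (- (c\<^sup>2 * v) / 2)"
  proof (cases "v = 0")
    \<comment> \<open>The central limit theorem requires positive variance; here all summands vanish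
      almost surely.\<close>
    case True
    have "AE w in M. V (Suc i) w = 0" for i
      using integral_nonneg_eq_0_iff_AE[OF int[of "Suc i"]] var[of "Suc i"] True by simp
    then have ae: "AE w in M. \<forall>i. V (Suc i) w = 0" by (simp add: AE_all_countable)
    have "(LINT w|M. cos (c * (\<Sum>i<n. V (Suc i) w) / sqrt (real n) + b)) = (LINT w|M. cos b)" for n
    proof (rule integral_cong_AE)
      show "AE w in M. cos (c * (\<Sum>i<n. V (Suc i) w) / sqrt (real n) + b) = cos b"
        using ae by eventually_elim simp
    qed measurable
    then show ?thesis unfolding sum using True by (simp add: prob_space)
  next
    case False
    define s where "s = sqrt v"
    have s: "s > 0" "s\<^sup>2 = v" using False v0 by (auto simp: s_def)
    let ?S = "\<lambda>n w. (\<Sum>i<n. V (Suc i) w) / sqrt (real n * s\<^sup>2)"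
    have "weak_conv_m (\<lambda>n. distr M borel (?S n)) std_normal_distribution"
    proof (rule central_limit_theorem_zero_mean[OF ind' _ s(1)])
      show "variance (V (Suc n)) = s\<^sup>2" for n
        using mean[of "Suc n"] var[of "Suc n"] s by simp
      show "distr M borel (V (Suc n)) = \<mu>" for n using dist by simp
    qed (auto simp: mean int)
    then have "(\<lambda>n. char (distr M borel (?S n)) (c * s)) \<longlonglongrightarrow> char std_normal_distribution (c * s)"
      by (intro levy_continuity1 real_dist_normal_dist real_distribution_distr) auto
    then have "(\<lambda>n. Re (iexp b * char (distr M borel (?S n)) (c * s))) \<longlonglongrightarrow> Re (iexp b * char std_normal_distribution (c * s))"
      by (intro tendsto_Re tendsto_mult tendsto_const)
    moreover have "Re (iexp b * char (distr M borel (?S n)) (c * s)) =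
      (LINT w|M. cos (?T n w + b))" for n
    proof -
      have "(c * s) * ?S n w = ?T n w" for w
        unfolding sum using s(1) by (simp add: real_sqrt_mult)
      then show ?thesis by (subst integral_cos_char[symmetric]) auto
    qed
    moreover have "Re (iexp b * char std_normal_distribution (c * s)) = cos b * exp (- (c\<^sup>2 * v) / 2)"
      unfolding char_std_normal_distribution using s by (simp add: Re_exp power_mult_distrib)
    ultimately show ?thesis by simp
  qed
qed

section \<open>Gaussian vectors with the covariance of the walk, as limits of superpositions\<close>

text \<open>Covariances are prescribed up to \<open>N\<close>, the positions seen at times in
  \<open>[0, 1]\<close>; beyond \<open>N\<close> the coefficients are arbitrary.\<close>

definition walk_gaussian :: "real \<Rightarrow> nat \<Rightarrow> (nat \<Rightarrow> (real \<Rightarrow> real) \<Rightarrow> real) \<Rightarrow> bool" where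
  "walk_gaussian H N g \<longleftrightarrow> (\<exists>F c. finite F \<and> g = (\<lambda>i w. \<Sum>k\<in>F. c i k * w k) \<and>
     (\<forall>m\<le>N. \<forall>n\<le>N. (\<Sum>k\<in>F. c m k * c n k) = walk_cov H m n))"

lemma walk_gaussian_exists:
  assumes H: "1/2 < H" "H < 1"
  shows "\<exists>g. walk_gaussian H N g"
proof -
  let ?A = "annealed_law (mu_H H)"
  interpret A: prob_space ?A by (rule annealed_moments[OF H])
  have m: "(\<lambda>x. x n) \<in> ?A \<rightarrow>\<^sub>M count_space UNIV" for n
    using measurable_walk_coord measurable_cong_sets[OF annealed_moments(2)[OF H] refl] by blast
  obtain F :: "real set" and c where "finite F"
    "\<And>m n. m \<le> N \<Longrightarrow> n \<le> N \<Longrightarrow> (LINT x|?A. real_of_int (x m) * real_of_int (x n)) = (\<Sum>k\<in>F. c m k * c n k)"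
    by (rule A.finite_valued_gram[of "\<lambda>n x. x n" N, OF m annealed_moments(3)[OF H]]) blast
  then show ?thesis unfolding walk_gaussian_def annealed_moments(5)[OF H]
    by (intro exI[of _ "\<lambda>i w. \<Sum>k\<in>F. c i k * w k"] exI[of _ F] exI[of _ c]) auto
qed

text \<open>The index map \<open>i\<close> may repeat values, as several times can fall into the
  same lattice cell. Expanding in the coordinates turns the sum of squared coefficients into the
  quadratic form of the covariance.\<close>

lemma walk_gaussian_combination:
  assumes G: "walk_gaussian H N g" and T: "finite T" "\<And>t. t \<in> T \<Longrightarrow> i t \<le> N"
  shows "integrable gauss_space (\<lambda>w. (\<Sum>t\<in>T. a t * g (i t) w)\<^sup>2)"
    and "(LINT w|gauss_space. (\<Sum>t\<in>T. a t * g (i t) w)\<^sup>2) = (\<Sum>s\<in>T. \<Sum>t\<in>T. a s * a t * walk_cov H (i s) (i t))"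
    and "(LINT w|gauss_space. cos ((\<Sum>t\<in>T. a t * g (i t) w) + b)) =
      cos b * exp (- (\<Sum>s\<in>T. \<Sum>t\<in>T. a s * a t * walk_cov H (i s) (i t)) / 2)"
proof -
  obtain F c where F: "finite F" and g: "g = (\<lambda>i w. \<Sum>k\<in>F. c i k * w k)"
    and c: "\<And>m n. m \<le> N \<Longrightarrow> n \<le> N \<Longrightarrow> (\<Sum>k\<in>F. c m k * c n k) = walk_cov H m n"
    using G unfolding walk_gaussian_def by blast
  have lin: "(\<Sum>t\<in>T. a t * g (i t) w) = (\<Sum>k\<in>F. (\<Sum>t\<in>T. a t * c (i t) k) * w k)" for w
  proof -
    have "(\<Sum>t\<in>T. a t * g (i t) w) = (\<Sum>t\<in>T. \<Sum>k\<in>F. a t * c (i t) k * w k)"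
      by (simp add: g sum_distrib_left mult.assoc)
    also have "\<dots> = (\<Sum>k\<in>F. \<Sum>t\<in>T. a t * c (i t) k * w k)" by (rule sum.swap)
    finally show ?thesis by (simp add: sum_distrib_right)
  qed
  have quad: "(\<Sum>k\<in>F. (\<Sum>t\<in>T. a t * c (i t) k)\<^sup>2) = (\<Sum>s\<in>T. \<Sum>t\<in>T. a s * a t * walk_cov H (i s) (i t))"
  proof -
    have "(\<Sum>k\<in>F. (\<Sum>t\<in>T. a t * c (i t) k)\<^sup>2) = (\<Sum>k\<in>F. \<Sum>s\<in>T. \<Sum>t\<in>T. a s * a t * (c (i s) k * c (i t) k))"
      by (simp add: power2_eq_square sum_product mult_ac)
    also have "\<dots> = (\<Sum>s\<in>T. \<Sum>k\<in>F. \<Sum>t\<in>T. a s * a t * (c (i s) k * c (i t) k))" by (rule sum.swap)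
    also have "\<dots> = (\<Sum>s\<in>T. \<Sum>t\<in>T. \<Sum>k\<in>F. a s * a t * (c (i s) k * c (i t) k))"
      by (intro sum.cong refl sum.swap)
    also have "\<dots> = (\<Sum>s\<in>T. \<Sum>t\<in>T. a s * a t * walk_cov H (i s) (i t))"
      using T(2) c by (intro sum.cong refl) (simp flip: sum_distrib_left)
    finally show ?thesis .
  qed
  show "integrable gauss_space (\<lambda>w. (\<Sum>t\<in>T. a t * g (i t) w)\<^sup>2)"
    unfolding lin by (rule gauss_linear_combination[OF F])
  show "(LINT w|gauss_space. (\<Sum>t\<in>T. a t * g (i t) w)\<^sup>2) = (\<Sum>s\<in>T. \<Sum>t\<in>T. a s * a t * walk_cov H (i s) (i t))"
    unfolding lin gauss_linear_combination(2)[OF F] by (rule quad)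
  show "(LINT w|gauss_space. cos ((\<Sum>t\<in>T. a t * g (i t) w) + b)) =
      cos b * exp (- (\<Sum>s\<in>T. \<Sum>t\<in>T. a s * a t * walk_cov H (i s) (i t)) / 2)"
    unfolding lin gauss_linear_combination(3)[OF F] quad ..
qed

lemma walk_gaussian_measurable: "walk_gaussian H N g \<Longrightarrow> g i \<in> borel_measurable gauss_space"
  by (auto simp: walk_gaussian_def)

lemma walk_cov_diag: "walk_cov H n n = walk_var H n"
  by (simp add: walk_cov_def walk_var_def)

lemma walk_cov_commute: "walk_cov H m n = walk_cov H n m"
  by (simp add: walk_cov_eq abs_minus_commute add.commute)

lemma walk_gaussian_square:
  assumes G: "walk_gaussian H N g" and i: "i \<le> N"
  shows "integrable gauss_space (\<lambda>w. (g i w)\<^sup>2)" "(LINT w|gauss_space. (g i w)\<^sup>2) = walk_var H i"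
  using walk_gaussian_combination(1,2)[OF G, of "{()}" "\<lambda>_. i" "\<lambda>_. 1"] i by (simp_all add: walk_cov_diag)

lemma walk_gaussian_increment:
  assumes G: "walk_gaussian H N g" and ij: "i \<le> N" "j \<le> N"
  shows "integrable gauss_space (\<lambda>w. (g i w - g j w)\<^sup>2)"
    and "(LINT w|gauss_space. (g i w - g j w)\<^sup>2) = walk_var H (nat \<bar>int i - int j\<bar>)"
proof -
  \<comment> \<open>Summing over \<open>bool\<close> keeps two terms even when
    \<open>i = j\<close>.\<close>
  have s: "(\<Sum>t\<in>UNIV. (if t then 1 else -1) * g (if t then i else j) w) = g i w - g j w" for w
    by (simp add: UNIV_bool)
  note c = walk_gaussian_combination(1,2)[OF G, of "UNIV :: bool set" "\<lambda>t. if t then i else j" "\<lambda>t. if t then 1 else -1", unfolded s]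
  show "integrable gauss_space (\<lambda>w. (g i w - g j w)\<^sup>2)" by (rule c) (use ij in auto)
  have "(LINT w|gauss_space. (g i w - g j w)\<^sup>2) = walk_cov H i i + walk_cov H j j - 2 * walk_cov H i j"
    using ij by (subst c) (auto simp: UNIV_bool walk_cov_commute[of H j i])
  also have "\<dots> = walk_var H (nat \<bar>int i - int j\<bar>)"
    unfolding walk_cov_diag by (simp add: walk_cov_eq field_simps)
  finally show "(LINT w|gauss_space. (g i w - g j w)\<^sup>2) = walk_var H (nat \<bar>int i - int j\<bar>)" .
qed

lemma annealed_combination:
  assumes H: "1/2 < H" "H < 1" and T: "finite T"
  defines "A \<equiv> annealed_law (mu_H H)"
  shows "(\<lambda>x. \<Sum>t\<in>T. a t * real_of_int (x (i t))) \<in> borel_measurable A"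
    and "(LINT x|A. (\<Sum>t\<in>T. a t * real_of_int (x (i t)))) = 0"
    and "integrable A (\<lambda>x. (\<Sum>t\<in>T. a t * real_of_int (x (i t)))\<^sup>2)"
    and "(LINT x|A. (\<Sum>t\<in>T. a t * real_of_int (x (i t)))\<^sup>2) = (\<Sum>s\<in>T. \<Sum>t\<in>T. a s * a t * walk_cov H (i s) (i t))"
proof -
  interpret A: prob_space A unfolding A_def by (rule annealed_moments[OF H])
  have "(\<lambda>x. x n) \<in> A \<rightarrow>\<^sub>M count_space UNIV" for n unfolding A_def
    using measurable_walk_coord measurable_cong_sets[OF annealed_moments(2)[OF H] refl] by blast
  then have m [measurable]: "(\<lambda>x. real_of_int (x n)) \<in> borel_measurable A" for n
    by (rule measurable_compose) simp
  have b: "AE x in A. \<bar>real_of_int (x n)\<bar> \<le> real n" for n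
    using annealed_moments(3)[OF H, of n] unfolding A_def by eventually_elim linarith
  have i1: "integrable A (\<lambda>x. real_of_int (x n))" for n
    by (rule A.integrable_const_bound[of _ "real n"]) (use b in auto)
  have i2: "integrable A (\<lambda>x. real_of_int (x m) * real_of_int (x n))" for m n
  proof (rule A.integrable_const_bound[of _ "real m * real n"])
    show "AE x in A. norm (real_of_int (x m) * real_of_int (x n)) \<le> real m * real n"
      using b[of m] b[of n] by eventually_elim (auto simp: abs_mult intro: mult_mono)
  qed auto
  show "(\<lambda>x. \<Sum>t\<in>T. a t * real_of_int (x (i t))) \<in> borel_measurable A" by measurable
  show "(LINT x|A. (\<Sum>t\<in>T. a t * real_of_int (x (i t)))) = 0"
    using i1 annealed_moments(4)[OF H] by (simp add: A_def)
  have sq: "(\<Sum>t\<in>T. a t * real_of_int (x (i t)))\<^sup>2 =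
    (\<Sum>s\<in>T. \<Sum>t\<in>T. a s * a t * (real_of_int (x (i s)) * real_of_int (x (i t))))" for x
    by (simp add: power2_eq_square sum_product mult_ac)
  show "integrable A (\<lambda>x. (\<Sum>t\<in>T. a t * real_of_int (x (i t)))\<^sup>2)" unfolding sq using i2 by auto
  show "(LINT x|A. (\<Sum>t\<in>T. a t * real_of_int (x (i t)))\<^sup>2) = (\<Sum>s\<in>T. \<Sum>t\<in>T. a s * a t * walk_cov H (i s) (i t))"
    unfolding sq using i2 annealed_moments(5)[OF H] by (simp add: A_def)
qed

lemma floor_index_le: "t \<in> {0..1} \<Longrightarrow> nat \<lfloor>real N * t\<rfloor> \<le> N"
  by (simp add: nat_le_iff floor_le_iff) (smt (verit) mult_left_le of_nat_0_le_iff)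

text \<open>Cramer-Wold: exchanging the sums over times and over walks turns a linear combination of
  coordinates into a normalised sum of independent, identically distributed variables, whose
  variance is the same quadratic form in \<open>walk_cov\<close> as for the Gaussian vector.\<close>

lemma superposition_fdd_converges:
  fixes \<Omega> :: "'a measure" and X :: "nat \<Rightarrow> nat \<Rightarrow> 'a \<Rightarrow> int"
  assumes H: "1/2 < H" "H < 1" and prob: "prob_space \<Omega>"
    and indep: "prob_space.indep_vars \<Omega> (\<lambda>_. walk_space) (\<lambda>i w n. X i n w) {1..}"
    and law: "\<And>i. i \<ge> 1 \<Longrightarrow> distr \<Omega> walk_space (\<lambda>w n. X i n w) = annealed_law (mu_H H)"
    and G: "walk_gaussian H N g"
  shows "fdd_converges {0..1} (\<lambda>_. \<Omega>)
    (\<lambda>M t w. c_H H * (\<Sum>i=1..M. real_of_int (X i (nat \<lfloor>real N * t\<rfloor>) w)) / (real N powr H * sqrt (real M)))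
    gauss_space (\<lambda>t w. c_H H / real N powr H * g (nat \<lfloor>real N * t\<rfloor>) w)"
  unfolding fdd_converges_def
proof (intro allI impI)
  let ?Y = "\<lambda>M t w. c_H H * (\<Sum>i=1..M. real_of_int (X i (nat \<lfloor>real N * t\<rfloor>) w)) / (real N powr H * sqrt (real M))"
  interpret prob_space \<Omega> by (rule prob)
  let ?A = "annealed_law (mu_H H)"
  let ?c = "c_H H / real N powr H"
  let ?n = "\<lambda>t. nat \<lfloor>real N * t\<rfloor>"
  fix J :: "real set" assume J: "finite J \<and> J \<subseteq> {0..1}"
  have Xm: "(\<lambda>w n. X i n w) \<in> \<Omega> \<rightarrow>\<^sub>M walk_space" if "i \<ge> 1" for i
    using indep that by (auto simp: indep_vars_def)
  \<comment> \<open>The share of walk \<open>i\<close> in the combination with coefficients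
    \<open>a\<close>; \<open>T = {t}\<close> recovers single coordinates for the moment
    bounds.\<close>
  define V where "V T a i w = (\<Sum>t\<in>T. a t * real_of_int (X i (?n t) w))" for T a i w
  have V: "indep_vars (\<lambda>_. borel) (V T a) {1..}"
    "i \<ge> 1 \<Longrightarrow> distr \<Omega> borel (V T a i) = distr ?A borel (\<lambda>x. \<Sum>t\<in>T. a t * real_of_int (x (?n t)))"
    "i \<ge> 1 \<Longrightarrow> expectation (V T a i) = 0"
    "i \<ge> 1 \<Longrightarrow> integrable \<Omega> (\<lambda>w. (V T a i w)\<^sup>2)"
    "i \<ge> 1 \<Longrightarrow> (LINT w|\<Omega>. (V T a i w)\<^sup>2) = (\<Sum>s\<in>T. \<Sum>t\<in>T. a s * a t * walk_cov H (?n s) (?n t))"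
    if T: "finite T" for T a i
  proof -
    let ?g = "\<lambda>x. \<Sum>t\<in>T. a t * real_of_int (x (?n t))"
    have "(\<lambda>x. real_of_int (x n)) \<in> borel_measurable walk_space" for n
      by (rule measurable_compose[OF measurable_walk_coord]) simp
    then have g [measurable]: "?g \<in> borel_measurable walk_space" by measurable
    show "indep_vars (\<lambda>_. borel) (V T a) {1..}"
      unfolding V_def[abs_def]
      by (rule indep_vars_compose2[OF indep, where Y = "\<lambda>_. ?g" and N = "\<lambda>_. borel"]) (rule g)
    note ac = annealed_combination[OF H T]
    assume i: "i \<ge> 1"
    note m [measurable] = Xm[OF i]
    have tr: "(LINT w|\<Omega>. f (V T a i w)) = (LINT x|?A. f (?g x))" "integrable \<Omega> (\<lambda>w. f (V T a i w)) \<longleftrightarrow> integrable ?A (\<lambda>x. f (?g x))"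
      if [measurable]: "f \<in> borel_measurable borel" for f :: "real \<Rightarrow> real"
      using integral_distr[OF m, of "\<lambda>x. f (?g x)"] integrable_distr_eq[OF m, of "\<lambda>x. f (?g x)"]
      unfolding law[OF i] V_def by simp_all
    show "distr \<Omega> borel (V T a i) = distr ?A borel ?g"
      unfolding law[OF i, symmetric] by (subst distr_distr[OF g m]) (simp add: comp_def V_def[abs_def])
    show "expectation (V T a i) = 0" using tr(1)[of "\<lambda>x. x"] ac(2) by simp
    show "integrable \<Omega> (\<lambda>w. (V T a i w)\<^sup>2)" using tr(2)[of "\<lambda>x. x\<^sup>2"] ac(3) by simp
    show "(LINT w|\<Omega>. (V T a i w)\<^sup>2) = (\<Sum>s\<in>T. \<Sum>t\<in>T. a s * a t * walk_cov H (?n s) (?n t))"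
      using tr(1)[of "\<lambda>x. x\<^sup>2"] ac(4) by simp
  qed
  note iid = iid_normalized_sum[OF V]
  have rew: "(\<Sum>t\<in>T. a t * (?Y M t w))
    = ?c * (\<Sum>i=1..M. V T a i w) / sqrt (real M)" for T a M w
  proof -
    have "(\<Sum>i=1..M. V T a i w) = (\<Sum>t\<in>T. a t * (\<Sum>i=1..M. real_of_int (X i (?n t) w)))"
      unfolding V_def by (subst sum.swap) (simp add: sum_distrib_left)
    then show ?thesis by (simp add: sum_distrib_left sum_divide_distrib mult_ac)
  qed
  have rew1: "?Y M t w
    = ?c * (\<Sum>i=1..M. V {t} (\<lambda>_. 1) i w) / sqrt (real M)" for t M w
    by (simp add: V_def)
  have idx: "?n t \<le> N" if "t \<in> J" for t using J that by (intro floor_index_le) auto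
  let ?C = "\<Sum>t\<in>J. ?c\<^sup>2 * \<bar>walk_var H (?n t)\<bar>"
  show "converges_in_law (powertop_real J) (\<lambda>_. \<Omega>)
     (\<lambda>M w. \<lambda>t\<in>J. ?Y M t w)
     gauss_space (\<lambda>w. \<lambda>t\<in>J. ?c * g (?n t) w)"
  proof (rule converges_in_law_product[where C = ?C])
    show "finite J" using J by simp
    show "prob_space \<Omega>" by (rule prob)
    show "prob_space gauss_space" by (rule prob_space_gauss_space)
    have coord: "(\<lambda>w. real_of_int (X i n w)) \<in> borel_measurable \<Omega>" if "i \<ge> 1" for i n
      by (rule measurable_compose[OF Xm[OF that] measurable_compose[OF measurable_walk_coord]]) simp
    then have [measurable]: "(\<lambda>w. \<Sum>i=1..M. real_of_int (X i n w)) \<in> borel_measurable \<Omega>" for M n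
      by (intro borel_measurable_sum) auto
    show "(\<lambda>w. ?Y M t w) \<in> borel_measurable \<Omega>" for M t
      by measurable
    show "(\<lambda>w. ?c * g (?n t) w) \<in> borel_measurable gauss_space" for t
      using walk_gaussian_measurable[OF G] by measurable
    show "integrable \<Omega> (\<lambda>w. (?Y M t w)\<^sup>2)" for M t
      unfolding rew1 by (rule iid(1)) auto
    show "(LINT w|\<Omega>. (?Y M t w)\<^sup>2) \<le> ?C" if t: "t \<in> J" for M t
    proof -
      have "(LINT w|\<Omega>. (?Y M t w)\<^sup>2)
        \<le> ?c\<^sup>2 * (\<Sum>s\<in>{t}. \<Sum>u\<in>{t}. 1 * 1 * walk_cov H (?n s) (?n u))"
        unfolding rew1 by (rule iid(2)) auto
      also have "\<dots> \<le> ?c\<^sup>2 * \<bar>walk_var H (?n t)\<bar>"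
        by (intro mult_left_mono) (auto simp: walk_cov_diag)
      also have "\<dots> \<le> ?C" using J t by (intro member_le_sum[of t J "\<lambda>t. ?c\<^sup>2 * \<bar>walk_var H (?n t)\<bar>"]) auto
      finally show ?thesis .
    qed
    show "integrable gauss_space (\<lambda>w. (?c * g (?n t) w)\<^sup>2)" if "t \<in> J" for t
      unfolding power_mult_distrib by (intro integrable_mult_right walk_gaussian_square(1)[OF G idx[OF that]])
    fix a :: "real \<Rightarrow> real" and b
    have "(LINT w|gauss_space. cos ((\<Sum>t\<in>J. a t * (?c * g (?n t) w)) + b)) =
      (LINT w|gauss_space. cos ((\<Sum>t\<in>J. (?c * a t) * g (?n t) w) + b))" by (simp add: mult_ac)
    also have "\<dots> = cos b * exp (- (\<Sum>s\<in>J. \<Sum>t\<in>J. (?c * a s) * (?c * a t) * walk_cov H (?n s) (?n t)) / 2)"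
      using J idx by (intro walk_gaussian_combination[OF G]) auto
    also have "(\<Sum>s\<in>J. \<Sum>t\<in>J. (?c * a s) * (?c * a t) * walk_cov H (?n s) (?n t)) =
      ?c\<^sup>2 * (\<Sum>s\<in>J. \<Sum>t\<in>J. a s * a t * walk_cov H (?n s) (?n t))"
      by (simp add: sum_distrib_left power2_eq_square mult_ac)
    finally have eq: "(LINT w|gauss_space. cos ((\<Sum>t\<in>J. a t * (?c * g (?n t) w)) + b)) =
      cos b * exp (- (?c\<^sup>2 * (\<Sum>s\<in>J. \<Sum>t\<in>J. a s * a t * walk_cov H (?n s) (?n t))) / 2)" .
    show "(\<lambda>M. \<integral>w. cos ((\<Sum>t\<in>J. a t * (?Y M t w)) + b) \<partial>\<Omega>)
      \<longlonglongrightarrow> (LINT w|gauss_space. cos ((\<Sum>t\<in>J. a t * (?c * g (?n t) w)) + b))"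
      unfolding rew eq by (rule iid(3)) (use J in auto)
  qed
qed

section \<open>Convergence to fractional Brownian motion\<close>

lemma walk_var_nonneg: "H < 1 \<Longrightarrow> walk_var H n \<ge> 0"
  unfolding walk_var_def by (intro sum_nonneg walk_corr_nonneg)

lemma powr_square: "(x powr a)\<^sup>2 = (x::real) powr (2 * a)"
  by (simp add: power2_eq_square powr_add[symmetric])

text \<open>For \<open>x > 0\<close> the indices tend to infinity and the asymptotics apply along
  them. For \<open>x = 0\<close> they may stay bounded, so \<open>walk_var_bound\<close> is used
  instead.\<close>

lemma walk_var_scaling:
  assumes H: "1/2 < H" "H < 1" and x: "x \<ge> 0" and lim: "(\<lambda>N. real (n N) / real N) \<longlonglongrightarrow> x"
  shows "(\<lambda>N. (c_H H / real N powr H)\<^sup>2 * walk_var H (n N)) \<longlonglongrightarrow> x powr (2 * H)"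
proof -
  have sq: "(c_H H / real N powr H)\<^sup>2 * w = (c_H H)\<^sup>2 * w / real N powr (2 * H)" for N w
    by (simp add: power_divide powr_square)
  show ?thesis
  proof (cases "x = 0")
    case True
    obtain C where C: "C \<ge> 0" "\<And>n. (c_H H)\<^sup>2 * walk_var H n \<le> C * real n powr (2 * H)"
      using walk_var_bound[OF H] by blast
    have "(\<lambda>N. C * (real (n N) / real N) powr (2 * H)) \<longlonglongrightarrow> C * 0"
      using H lim True by (intro tendsto_mult tendsto_const tendsto_zero_powrI[where b = "2 * H"]) auto
    then have up: "(\<lambda>N. C * (real (n N) / real N) powr (2 * H)) \<longlonglongrightarrow> 0" by simp
    have "(\<lambda>N. (c_H H / real N powr H)\<^sup>2 * walk_var H (n N)) \<longlonglongrightarrow> 0"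
    proof (rule tendsto_sandwich[OF _ _ tendsto_const up]; intro always_eventually allI)
      fix N
      show "0 \<le> (c_H H / real N powr H)\<^sup>2 * walk_var H (n N)" using walk_var_nonneg[OF H(2)] by simp
      show "(c_H H / real N powr H)\<^sup>2 * walk_var H (n N) \<le> C * (real (n N) / real N) powr (2 * H)"
        unfolding sq powr_divide times_divide_eq_right by (intro divide_right_mono C) simp
    qed
    then show ?thesis using True by simp
  next
    case False
    then have x0: "x > 0" using x by simp
    have "filterlim (\<lambda>N. real (n N) / real N * real N) at_top sequentially"
      by (rule filterlim_tendsto_pos_mult_at_top[OF lim x0 filterlim_real_sequentially])
    moreover have "eventually (\<lambda>N. real (n N) / real N * real N = real (n N)) sequentially"
      using eventually_gt_at_top[of 0] by eventually_elim simp
    ultimately have "filterlim (\<lambda>N. real (n N)) at_top sequentially"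
      using filterlim_cong[OF refl refl] by fast
    then have n: "filterlim n at_top sequentially" by (simp add: filterlim_sequentially_iff_filterlim_real)
    have "(\<lambda>N. (c_H H)\<^sup>2 * walk_var H (n N) / real (n N) powr (2 * H) * (real (n N) / real N) powr (2 * H)) \<longlonglongrightarrow> 1 * x powr (2 * H)"
      using x0 by (intro tendsto_mult tendsto_powr tendsto_const lim filterlim_compose[OF walk_var_asymptotics[OF H] n]) auto
    moreover have "eventually (\<lambda>N. (c_H H)\<^sup>2 * walk_var H (n N) / real (n N) powr (2 * H) * (real (n N) / real N) powr (2 * H)
        = (c_H H / real N powr H)\<^sup>2 * walk_var H (n N)) sequentially"
      using filterlim_at_top_dense[THEN iffD1, OF \<open>filterlim (\<lambda>N. real (n N)) at_top sequentially\<close>, rule_format, of 0] eventually_gt_at_top[of 0]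
    proof eventually_elim
      case (elim N)
      then show ?case unfolding sq powr_divide by simp
    qed
    ultimately show ?thesis by (simp add: Lim_transform_eventually)
  qed
qed

lemma floor_over_tendsto:
  assumes "t \<ge> 0" shows "(\<lambda>N. real (nat \<lfloor>real N * t\<rfloor>) / real N) \<longlonglongrightarrow> t"
proof (rule tendsto_sandwich)
  show "eventually (\<lambda>N. t - 1 / real N \<le> real (nat \<lfloor>real N * t\<rfloor>) / real N) sequentially"
    using eventually_gt_at_top[of 0]
  proof eventually_elim
    case (elim N)
    have "real N * t - 1 \<le> real (nat \<lfloor>real N * t\<rfloor>)" using assms by linarith
    then have "(real N * t - 1) / real N \<le> real (nat \<lfloor>real N * t\<rfloor>) / real N"
      by (rule divide_right_mono) simp
    then show ?case using elim by (simp add: diff_divide_distrib)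
  qed
  show "eventually (\<lambda>N. real (nat \<lfloor>real N * t\<rfloor>) / real N \<le> t) sequentially"
    using eventually_gt_at_top[of 0]
  proof eventually_elim
    case (elim N)
    have "real (nat \<lfloor>real N * t\<rfloor>) \<le> real N * t" using assms by simp
    then show ?case using elim by (simp add: field_simps)
  qed
  show "(\<lambda>N. t - 1 / real N) \<longlonglongrightarrow> t"
    using tendsto_diff[OF tendsto_const lim_const_over_n[of 1], of t] by simp
qed simp

text \<open>Through \<open>walk_cov_eq\<close> three variances scale separately; the distance of the
  two floors, divided by \<open>N\<close>, tends to \<open>\<bar>s - t\<bar>\<close>.\<close>

lemma walk_cov_scaling:
  assumes H: "1/2 < H" "H < 1" and st: "s \<ge> 0" "t \<ge> 0"
  shows "(\<lambda>N. (c_H H / real N powr H)\<^sup>2 * walk_cov H (nat \<lfloor>real N * s\<rfloor>) (nat \<lfloor>real N * t\<rfloor>))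
    \<longlonglongrightarrow> (s powr (2 * H) + t powr (2 * H) - \<bar>s - t\<bar> powr (2 * H)) / 2"
proof -
  let ?a = "\<lambda>N. nat \<lfloor>real N * s\<rfloor>" and ?b = "\<lambda>N. nat \<lfloor>real N * t\<rfloor>"
  have "(\<lambda>N. real (nat \<bar>int (?a N) - int (?b N)\<bar>) / real N) = (\<lambda>N. \<bar>real (?a N) / real N - real (?b N) / real N\<bar>)"
  proof
    fix N
    have "real (nat \<bar>int (?a N) - int (?b N)\<bar>) = \<bar>real (?a N) - real (?b N)\<bar>" by linarith
    then show "real (nat \<bar>int (?a N) - int (?b N)\<bar>) / real N = \<bar>real (?a N) / real N - real (?b N) / real N\<bar>"
      by (simp add: diff_divide_distrib[symmetric] abs_divide)
  qed
  moreover have "(\<lambda>N. \<bar>real (?a N) / real N - real (?b N) / real N\<bar>) \<longlonglongrightarrow> \<bar>s - t\<bar>"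
    by (intro tendsto_intros floor_over_tendsto st)
  ultimately have d: "(\<lambda>N. real (nat \<bar>int (?a N) - int (?b N)\<bar>) / real N) \<longlonglongrightarrow> \<bar>s - t\<bar>" by simp
  have "(\<lambda>N. ((c_H H / real N powr H)\<^sup>2 * walk_var H (?a N) + (c_H H / real N powr H)\<^sup>2 * walk_var H (?b N)
      - (c_H H / real N powr H)\<^sup>2 * walk_var H (nat \<bar>int (?a N) - int (?b N)\<bar>)) / 2)
    \<longlonglongrightarrow> (s powr (2 * H) + t powr (2 * H) - \<bar>s - t\<bar> powr (2 * H)) / 2"
    by (intro tendsto_divide tendsto_diff tendsto_add tendsto_const walk_var_scaling[OF H] floor_over_tendsto st d) auto
  then show ?thesis by (simp add: walk_cov_eq algebra_simps add_divide_distrib diff_divide_distrib)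
qed

section \<open>Oscillation between grid points, uniformly in \<open>N\<close>\<close>

text \<open>The block has to cover the lattice points of a cell of width \<open>1/k\<close>; the
  summand 2 absorbs the rounding at both ends. The factor 4 uses \<open>N div k \<ge> 1\<close>,
  which is where \<open>k \<le> N\<close> enters.\<close>

lemma exists_dyadic_block:
  assumes "k \<ge> 1" "k \<le> N"
  obtains m :: nat where "N div k + 2 \<le> 2 ^ m" "real (2 ^ m) \<le> 4 * real N / real k"
proof -
  have "N div k \<ge> 1" using assms by (simp add: div_greater_zero_iff Suc_le_eq)
  obtain n where n: "2 ^ n < N div k + 2" "N div k + 2 \<le> 2 ^ (n + 1)"
    using ex_power_ivl2[of 2 "N div k + 2"] by auto
  have "2 ^ (n + 1) \<le> 2 * (N div k + 1)" using n by simp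
  also have "\<dots> \<le> 4 * (N div k)" using \<open>N div k \<ge> 1\<close> by simp
  finally have "real (2 ^ (n + 1)) \<le> real (4 * (N div k))" by (rule of_nat_mono)
  also have "\<dots> \<le> 4 * (real N / real k)"
  proof -
    have "real (N div k * k) \<le> real N" by (rule of_nat_mono) simp
    then show ?thesis using assms(1) by (simp add: field_simps)
  qed
  finally show ?thesis using n by (intro that[of "n + 1"]) simp_all
qed

text \<open>Each of the \<open>k + 1\<close> grid points starts a dyadic block covering its cell,
  and the sum of the block bounds dominates all cells at once. The factor
  \<open>real N powr (2 * H)\<close> of a block cancels against the normalisation, so the bound does
  not involve \<open>N\<close>.\<close>

lemma walk_gaussian_oscillation:
  assumes H: "1/2 < H" "H < 1" and G: "walk_gaussian H N g" and k: "k \<ge> 1" "k \<le> N"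
    and C: "C \<ge> 0" "\<And>n. (c_H H)\<^sup>2 * walk_var H n \<le> C * real n powr (2 * H)"
  defines "q \<equiv> 2 powr (2 * H)"
  shows "\<exists>D. integrable gauss_space D \<and> (\<forall>w. 0 \<le> D w) \<and>
    (\<forall>w. \<forall>t\<in>{0..1}. (c_H H / real N powr H * g (nat \<lfloor>real N * t\<rfloor>) w -
       c_H H / real N powr H * g (nat \<lfloor>real N * (real (nat \<lfloor>real k * t\<rfloor>) / real k)\<rfloor>) w)\<^sup>2 \<le> D w) \<and>
    (LINT w|gauss_space. D w) \<le> (real k + 1) * ((2 * (q + 2) / (q - 2)\<^sup>2 + 1) * C * (4 / real k) powr (2 * H))"
proof -
  let ?G = "gauss_space"
  let ?p = "\<lambda>t. nat \<lfloor>real N * t\<rfloor>"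
  let ?c = "c_H H / real N powr H"
  define K where "K = 2 * (q + 2) / (q - 2)\<^sup>2 + 1"
  have q: "q > 2" unfolding q_def using H powr_less_mono[of 1 "2 * H" 2] by simp
  have K: "K \<ge> 0" using q by (simp add: K_def)
  have N: "N \<ge> 1" using k by simp
  obtain m where m: "N div k + 2 \<le> 2 ^ m" "real (2 ^ m) \<le> 4 * real N / real k"
    using exists_dyadic_block[OF k] .
  \<comment> \<open>Blocks may run past \<open>N\<close>, where \<open>g\<close> is uncontrolled;
    freezing the index at \<open>N\<close> can only shorten increments.\<close>
  define x where "x i w = ?c * g (min i N) w" for i w
  have diff: "(x i w - x j w)\<^sup>2 = ?c\<^sup>2 * (g (min i N) w - g (min j N) w)\<^sup>2" for i j w
    unfolding x_def by (simp add: power_mult_distrib[symmetric] right_diff_distrib)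
  have int: "integrable ?G (\<lambda>w. (x i w - x j w)\<^sup>2)" for i j
    unfolding diff by (intro integrable_mult_right walk_gaussian_increment(1)[OF G]) auto
  \<comment> \<open>Absorbs the normalisation, so that the increment bound takes the form
    \<open>C' * q ^ l\<close> asked for by \<open>dyadic_maximal\<close>.\<close>
  define C' where "C' = C / real N powr (2 * H)"
  have C': "C' \<ge> 0" using C by (simp add: C'_def)
  have incr: "(LINT w|?G. (x (a + 2 ^ l) w - x a w)\<^sup>2) \<le> C' * q ^ l" for a l
  proof -
    let ?d = "nat \<bar>int (min (a + 2 ^ l) N) - int (min a N)\<bar>"
    have d: "real ?d \<le> 2 ^ l"
    proof -
      have "nat \<bar>int (min (a + p) N) - int (min a N)\<bar> \<le> p" for p by (auto simp: min_def)
      then have "?d \<le> 2 ^ l" .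
      then have "real ?d \<le> real (2 ^ l)" by (rule of_nat_mono)
      then show ?thesis by simp
    qed
    have "(LINT w|?G. (x (a + 2 ^ l) w - x a w)\<^sup>2) = ?c\<^sup>2 * walk_var H ?d"
      unfolding diff integral_mult_right_zero by (subst walk_gaussian_increment(2)[OF G]) auto
    also have "\<dots> = (c_H H)\<^sup>2 * walk_var H ?d / real N powr (2 * H)"
      by (simp add: power_divide powr_square)
    also have "\<dots> \<le> C * real ?d powr (2 * H) / real N powr (2 * H)"
      by (intro divide_right_mono C) simp
    also have "\<dots> \<le> C * (2 ^ l) powr (2 * H) / real N powr (2 * H)"
      using C d H by (intro divide_right_mono mult_left_mono powr_mono2) auto
    also have "(2 ^ l) powr (2 * H) = q ^ l"
      by (simp add: q_def powr_powr powr_realpow[symmetric] mult.commute)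
    finally show ?thesis by (simp add: C'_def)
  qed
  have "\<exists>D. integrable ?G D \<and> (\<forall>w. 0 \<le> D w) \<and> (\<forall>i\<le>2 ^ m. \<forall>w. (x (a + i) w - x a w)\<^sup>2 \<le> D w) \<and>
    (LINT w|?G. D w) \<le> K * C' * q ^ m" for a
    unfolding K_def by (rule dyadic_maximal[OF q C' int incr])
  then obtain D where D: "\<And>a. integrable ?G (D a)" "\<And>a w. 0 \<le> D a w"
    "\<And>a i w. i \<le> 2 ^ m \<Longrightarrow> (x (a + i) w - x a w)\<^sup>2 \<le> D a w" "\<And>a. (LINT w|?G. D a w) \<le> K * C' * q ^ m"
    by metis
  define a where "a j = nat \<lfloor>real N * (real j / real k)\<rfloor>" for j
  define E where "E w = (\<Sum>j\<in>{..k}. D (a j) w)" for w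
  show ?thesis
  proof (intro exI[of _ E] conjI allI ballI)
    show "integrable ?G E" unfolding E_def using D(1) by auto
    show "0 \<le> E w" for w unfolding E_def using D(2) by (intro sum_nonneg) auto
    fix w and t :: real assume t: "t \<in> {0..1}"
    define j where "j = nat \<lfloor>real k * t\<rfloor>"
    have j: "j \<le> k" unfolding j_def using t by (rule floor_index_le)
    have jt: "real j \<le> real k * t" "real k * t < real j + 1" using t by (auto simp: j_def)
    have le: "?p t \<le> N" using t by (rule floor_index_le)
    have s: "real j / real k \<le> t" "t < (real j + 1) / real k" using jt k by (auto simp: field_simps)
    have ajt: "a j \<le> ?p t" unfolding a_def
      using s N by (intro nat_mono floor_mono mult_left_mono) auto
    have "?p t - a j \<le> 2 ^ m"
    proof -
      have "real N * t < real N * ((real j + 1) / real k)" using s N by (intro mult_strict_left_mono) auto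
      also have "\<dots> = real N * (real j / real k) + real N / real k"
        by (simp add: add_divide_distrib distrib_left)
      also have "\<dots> < (real (a j) + 1) + (real (N div k) + 1)"
      proof (rule add_strict_mono)
        show "real N * (real j / real k) < real (a j) + 1" unfolding a_def
          using N k by (simp add: algebra_simps) linarith
        show "real N / real k < real (N div k) + 1"
        proof -
          have "N < k + N div k * k" using k by (intro dividend_less_div_times) simp
          then have "real N < real (k + N div k * k)" by (rule of_nat_less_iff[THEN iffD2])
          then show ?thesis using k by (simp add: field_simps)
        qed
      qed
      finally have "?p t \<le> a j + (N div k + 2)" by linarith
      then show ?thesis using m(1) by linarith
    qed
    from D(3)[OF this, of "a j" w] have "(x (?p t) w - x (a j) w)\<^sup>2 \<le> D (a j) w"
      using ajt by simp
    also have "\<dots> \<le> E w" unfolding E_def using j D(2) by (intro member_le_sum[of j "{..k}" "\<lambda>j. D (a j) w"]) auto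
    finally show "(?c * g (?p t) w - ?c * g (nat \<lfloor>real N * (real (nat \<lfloor>real k * t\<rfloor>) / real k)\<rfloor>) w)\<^sup>2 \<le> E w"
      using le ajt unfolding x_def j_def[symmetric] a_def[symmetric] by (simp add: min_absorb1)
  next
    have "(LINT w|?G. E w) = (\<Sum>j\<in>{..k}. \<integral>w. D (a j) w \<partial>?G)"
      unfolding E_def using D(1) by simp
    also have "\<dots> \<le> (\<Sum>j\<in>{..k}. K * C' * q ^ m)" by (intro sum_mono D)
    also have "\<dots> = (real k + 1) * (K * C' * q ^ m)" by simp
    also have "\<dots> \<le> (real k + 1) * (K * C * (4 / real k) powr (2 * H))"
    proof (intro mult_left_mono)
      have "q ^ m = (2 ^ m) powr (2 * H)" by (simp add: q_def powr_powr powr_realpow[symmetric] mult.commute)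
      also have "\<dots> \<le> (4 * real N / real k) powr (2 * H)" using m(2) H by (intro powr_mono2) auto
      also have "\<dots> = (4 / real k) powr (2 * H) * real N powr (2 * H)"
        using powr_mult[of "4 / real k" "real N" "2 * H"] by simp
      finally have "C' * q ^ m \<le> C' * ((4 / real k) powr (2 * H) * real N powr (2 * H))"
        using C' by (rule mult_left_mono)
      also have "\<dots> = C * (4 / real k) powr (2 * H)" using N by (simp add: C'_def)
      finally have "K * (C' * q ^ m) \<le> K * (C * (4 / real k) powr (2 * H))" using K by (rule mult_left_mono)
      then show "K * C' * q ^ m \<le> K * C * (4 / real k) powr (2 * H)" by (simp add: mult.assoc)
    qed simp
    finally show "(LINT w|?G. E w) \<le> (real k + 1) * ((2 * (q + 2) / (q - 2)\<^sup>2 + 1) * C * (4 / real k) powr (2 * H))"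
      unfolding K_def .
  qed
qed

lemma oscillation_bound_tendsto:
  assumes H: "1/2 < H"
  shows "(\<lambda>k. (real k + 1) * (A * (4 / real k) powr (2 * H))) \<longlonglongrightarrow> 0"
proof -
  have p: "(\<lambda>n. real n powr (- (2 * H - 1))) \<longlonglongrightarrow> 0"
    using H by (intro tendsto_neg_powr filterlim_real_sequentially) auto
  have "(\<lambda>k. A * 4 powr (2 * H) * (1 + 1 / real k) * real k powr (- (2 * H - 1))) \<longlonglongrightarrow> A * 4 powr (2 * H) * (1 + 0) * 0"
    by (intro tendsto_intros lim_const_over_n p)
  moreover have "eventually (\<lambda>k. A * 4 powr (2 * H) * (1 + 1 / real k) * real k powr (- (2 * H - 1)) =
    (real k + 1) * (A * (4 / real k) powr (2 * H))) sequentially"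
    using eventually_gt_at_top[of 0]
  proof eventually_elim
    case (elim k)
    have "real k powr (- (2 * H - 1)) = real k / real k powr (2 * H)"
      using elim powr_diff[of "real k" 1 "2 * H"] by simp
    moreover have "(1 + 1 / real k) * (real k / x) = (real k + 1) / x" for x
    proof -
      have "1 + 1 / real k = (real k + 1) / real k" using elim by (simp add: field_simps)
      then show ?thesis using elim by simp
    qed
    ultimately show ?case by (simp add: powr_divide mult_ac)
  qed
  ultimately show ?thesis by (simp add: Lim_transform_eventually)
qed

lemma fbm_square_integrable:
  assumes fbm: "fractional_brownian_motion H I W B" and t: "t \<in> I"
  shows "B t \<in> borel_measurable W" "integrable W (\<lambda>w. (B t w)\<^sup>2)"
proof -
  have W: "prob_space W" and mean: "(LINT w|W. B t w) = 0"
    and gp: "\<And>J a. finite J \<Longrightarrow> J \<subseteq> I \<Longrightarrow> gaussian_rv W (\<lambda>w. \<Sum>t\<in>J. a t * B t w)"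
    using fbm t unfolding fractional_brownian_motion_def gaussian_process_def by auto
  have "gaussian_rv W (B t)" using gp[of "{t}" "\<lambda>_. 1"] t by simp
  then show "B t \<in> borel_measurable W" "integrable W (\<lambda>w. (B t w)\<^sup>2)"
    using gaussian_rv_centered(1)[OF W _ mean] by (auto simp: gaussian_rv_def)
qed

text \<open>A centred Gaussian variable is governed by its variance, which the covariance
  prescribes; square integrability of each \<open>B t\<close> justifies expanding the
  square.\<close>

lemma fbm_combination:
  assumes fbm: "fractional_brownian_motion H I W B" and J: "finite J" "J \<subseteq> I"
  shows "(LINT w|W. cos ((\<Sum>t\<in>J. a t * B t w) + b)) =
    cos b * exp (- (\<Sum>s\<in>J. \<Sum>t\<in>J. a s * a t * ((s powr (2 * H) + t powr (2 * H) - \<bar>s - t\<bar> powr (2 * H)) / 2)) / 2)"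
proof -
  let ?R = "\<lambda>s t. (s powr (2 * H) + t powr (2 * H) - \<bar>s - t\<bar> powr (2 * H)) / 2 :: real"
  let ?S = "\<lambda>w. \<Sum>t\<in>J. a t * B t w"
  have W: "prob_space W" and gp: "\<And>J a. finite J \<Longrightarrow> J \<subseteq> I \<Longrightarrow> gaussian_rv W (\<lambda>w. \<Sum>t\<in>J. a t * B t w)"
    and mean: "\<And>t. t \<in> I \<Longrightarrow> (LINT w|W. B t w) = 0"
    and cov: "\<And>s t. s \<in> I \<Longrightarrow> t \<in> I \<Longrightarrow> (LINT w|W. B s w * B t w) = (s powr (2 * H) + t powr (2 * H) - \<bar>s - t\<bar> powr (2 * H)) / 2"
    using fbm unfolding fractional_brownian_motion_def gaussian_process_def by auto
  interpret W: prob_space W by (rule W)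
  note m = fbm_square_integrable(1)[OF fbm] and sq = fbm_square_integrable(2)[OF fbm]
  have i1: "integrable W (B t)" if "t \<in> I" for t
    by (rule W.square_integrable_imp_integrable[OF m sq]) (use that in auto)
  have i2: "integrable W (\<lambda>w. B s w * B t w)" if "s \<in> I" "t \<in> I" for s t
  proof (rule Bochner_Integration.integrable_bound)
    show "integrable W (\<lambda>w. (B s w)\<^sup>2 + (B t w)\<^sup>2)" using sq that by auto
    show "(\<lambda>w. B s w * B t w) \<in> borel_measurable W" using m that by auto
    have "\<bar>x * y\<bar> \<le> x\<^sup>2 + y\<^sup>2" for x y :: real
    proof -
      have "2 * (\<bar>x\<bar> * \<bar>y\<bar>) \<le> x\<^sup>2 + y\<^sup>2" using sum_squares_bound[of "\<bar>x\<bar>" "\<bar>y\<bar>"] by (simp add: mult.assoc)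
      moreover have "0 \<le> \<bar>x\<bar> * \<bar>y\<bar>" by simp
      ultimately show ?thesis unfolding abs_mult by linarith
    qed
    then show "AE w in W. norm (B s w * B t w) \<le> norm ((B s w)\<^sup>2 + (B t w)\<^sup>2)" by auto
  qed
  have mean_sum: "(LINT w|W. (?S w)) = 0"
  proof -
    have "(LINT w|W. (?S w)) = (\<Sum>t\<in>J. \<integral>w. a t * B t w \<partial>W)"
      using i1 J by (intro Bochner_Integration.integral_sum) auto
    also have "\<dots> = 0" using mean J by (intro sum.neutral) auto
    finally show ?thesis .
  qed
  have "(LINT w|W. (?S w)\<^sup>2) = (LINT w|W. (\<Sum>s\<in>J. \<Sum>t\<in>J. a s * a t * (B s w * B t w)))"
    by (simp add: power2_eq_square sum_product mult_ac)
  also have "\<dots> = (\<Sum>s\<in>J. \<integral>w. (\<Sum>t\<in>J. a s * a t * (B s w * B t w)) \<partial>W)"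
    using i2 J by (intro Bochner_Integration.integral_sum Bochner_Integration.integrable_sum integrable_mult_right) auto
  also have "\<dots> = (\<Sum>s\<in>J. \<Sum>t\<in>J. \<integral>w. a s * a t * (B s w * B t w) \<partial>W)"
    using i2 J by (intro sum.cong refl Bochner_Integration.integral_sum integrable_mult_right) auto
  also have "\<dots> = (\<Sum>s\<in>J. \<Sum>t\<in>J. a s * a t * ?R s t)"
    using cov J by (intro sum.cong refl) (auto simp: subset_iff)
  finally have var: "(LINT w|W. (?S w)\<^sup>2) =
    (\<Sum>s\<in>J. \<Sum>t\<in>J. a s * a t * ?R s t)" .
  show "(LINT w|W. cos ((?S w) + b)) =
    cos b * exp (- (\<Sum>s\<in>J. \<Sum>t\<in>J. a s * a t * ?R s t) / 2)"
    unfolding var[symmetric] by (rule gaussian_rv_centered(2)[OF W gp mean_sum]) (use J in auto)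
qed

lemma grid_point: "j \<le> k \<Longrightarrow> real j / real k \<in> {0..1}"
  by (cases "k = 0") (auto simp: field_simps)

text \<open>Uniform continuity on the compact interval makes the discretised paths converge
  uniformly; it is here that continuity of the limit process enters.\<close>

lemma step_path_converges:
  fixes x :: "real \<Rightarrow> real"
  assumes x: "continuous_on {0..1} x"
  shows "(\<lambda>k. skorohod_dist (step_path k (\<lambda>j. if j \<le> k then x (real j / real k) else 0)) (restrict x {0..1})) \<longlonglongrightarrow> 0"
proof (rule LIMSEQ_I)
  let ?y = "\<lambda>k. step_path k (\<lambda>j. if j \<le> k then x (real j / real k) else 0)"
  fix e :: real assume e: "e > 0"
  have "uniformly_continuous_on {0..1} x" by (rule compact_uniformly_continuous[OF x]) simp
  then obtain d where d: "d > 0" "\<And>s t. s \<in> {0..1} \<Longrightarrow> t \<in> {0..1} \<Longrightarrow> dist s t < d \<Longrightarrow> dist (x s) (x t) < e / 2"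
    using e unfolding uniformly_continuous_on_def by (meson half_gt_zero)
  obtain k0 :: nat where k0: "1 / d < real k0" using reals_Archimedean2 by blast
  have "norm (skorohod_dist (?y k) (restrict x {0..1}) - 0) < e" if k: "k \<ge> k0" for k
  proof -
    have "0 < 1 / d" using d by simp
    then have kd: "1 / d < real k" "real k > 0" using k0 k by linarith+
    have "skorohod_dist (?y k) (restrict x {0..1}) \<le> e / 2"
    proof (rule skorohod_dist_le_sup[OF step_path_cadlag continuous_on_restrict_cadlag[OF x]])
      fix t :: real assume t: "t \<in> {0..1}"
      let ?j = "nat \<lfloor>real k * t\<rfloor>"
      have j: "?j \<le> k" by (rule floor_index_le[OF t])
      have "real k * t - 1 < real ?j" using t by linarith
      moreover have "real ?j \<le> real k * t" using t by simp
      ultimately have "\<bar>real ?j - real k * t\<bar> \<le> 1" by linarith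
      then have "\<bar>real ?j - real k * t\<bar> / real k \<le> 1 / real k" by (rule divide_right_mono) simp
      also have "\<bar>real ?j - real k * t\<bar> / real k = \<bar>(real ?j - real k * t) / real k\<bar>" by (simp add: abs_divide)
      also have "(real ?j - real k * t) / real k = real ?j / real k - t" using kd by (simp add: diff_divide_distrib)
      also have "1 / real k < d" using kd d by (simp add: field_simps)
      finally have "dist (real ?j / real k) t < d" by (simp only: dist_real_def)
      then have "dist (x (real ?j / real k)) (x t) < e / 2"
        by (intro d(2) grid_point j t)
      then show "\<bar>?y k t - restrict x {0..1} t\<bar> \<le> e / 2"
        using t j by (simp add: step_path_def dist_real_def)
    qed (use e in simp)
    then show ?thesis using skorohod_dist_nonneg e by simp
  qed
  then show "\<exists>k0. \<forall>k\<ge>k0. norm (skorohod_dist (?y k) (restrict x {0..1}) - 0) < e"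
    by blast
qed

section \<open>Passage to the limit in the Skorohod space\<close>

text \<open>With \<open>k\<close> fixed, a functional of the \<open>k + 1\<close> grid values falls
  under the Levy lemma: the cosines converge by the scaling of \<open>walk_cov\<close>, and the
  second moments are bounded by \<open>C\<close>.\<close>

lemma walk_gaussian_grid_converges:
  fixes W :: "'b measure" and B :: "real \<Rightarrow> 'b \<Rightarrow> real" and f :: "(nat \<Rightarrow> real) \<Rightarrow> real"
  assumes H: "1/2 < H" "H < 1" and G: "\<And>N. walk_gaussian H N (g N)"
    and fbm: "fractional_brownian_motion H {0..1} W B" and k: "k \<ge> 1"
    and f: "continuous_on UNIV f" and dep: "\<And>x y. (\<And>j. j \<in> {..k} \<Longrightarrow> x j = y j) \<Longrightarrow> f x = f y"
    and bd: "\<And>x. \<bar>f x\<bar> \<le> b"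
  shows "(\<lambda>N. \<integral>w. f (\<lambda>j. if j \<le> k then c_H H / real N powr H * g N (nat \<lfloor>real N * (real j / real k)\<rfloor>) w else 0) \<partial>gauss_space)
    \<longlonglongrightarrow> (LINT w|W. f (\<lambda>j. if j \<le> k then B (real j / real k) w else 0))"
proof -
  let ?c = "\<lambda>N. c_H H / real N powr H"
  let ?n = "\<lambda>N j. nat \<lfloor>real N * (real j / real k)\<rfloor>"
  let ?Y = "\<lambda>N j w. if j \<le> k then ?c N * g N (?n N j) w else 0"
  let ?Z = "\<lambda>j w. if j \<le> k then B (real j / real k) w else 0"
  note B = fbm_square_integrable[OF fbm]
  obtain C where C: "C \<ge> 0" "\<And>n. (c_H H)\<^sup>2 * walk_var H n \<le> C * real n powr (2 * H)"
    using walk_var_bound[OF H] by blast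
  have idx: "?n N j \<le> N" if "j \<le> k" for N j by (rule floor_index_le[OF grid_point[OF that]])
  have W: "prob_space W" using fbm unfolding fractional_brownian_motion_def gaussian_process_def by blast
  show ?thesis
  proof (rule levy_continuity_multivariate[where J = "{..k}" and B = b and C = C
        and Y = "?Y"
        and Z = "?Z", OF _ f dep bd])
    show "(\<lambda>w. ?Y N j w) \<in> borel_measurable gauss_space" for N j
      using borel_measurable_times[OF borel_measurable_const walk_gaussian_measurable[OF G]] by (cases "j \<le> k") simp_all
    show "(\<lambda>w. ?Z j w) \<in> borel_measurable W" for j
      by (cases "j \<le> k") (auto intro: B(1) grid_point)
    fix N j assume j: "j \<in> {..k}"
    have sq: "(?c N * z)\<^sup>2 = (?c N)\<^sup>2 * z\<^sup>2" for z by (rule power_mult_distrib)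
    show "integrable gauss_space (\<lambda>w. (?Y N j w)\<^sup>2)"
      using j idx[of j N] by (simp only: atMost_iff if_True sq) (intro integrable_mult_right walk_gaussian_square(1)[OF G], simp)
    have "(LINT w|gauss_space. (?Y N j w)\<^sup>2) = (?c N)\<^sup>2 * walk_var H (?n N j)"
      using j idx[of j N] by (simp only: atMost_iff if_True sq integral_mult_right_zero walk_gaussian_square(2)[OF G])
    also have "\<dots> = (c_H H)\<^sup>2 * walk_var H (?n N j) / real N powr (2 * H)"
      by (simp add: power_divide powr_square)
    also have "\<dots> \<le> C * real (?n N j) powr (2 * H) / real N powr (2 * H)"
      by (intro divide_right_mono C) simp
    also have "\<dots> \<le> C * real N powr (2 * H) / real N powr (2 * H)"
      using idx[of j N] j H C by (intro divide_right_mono mult_left_mono powr_mono2) auto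
    also have "\<dots> \<le> C" using C by (cases "N = 0") auto
    finally show "(LINT w|gauss_space. (?Y N j w)\<^sup>2) \<le> C" .
  next
    fix j assume "j \<in> {..k}"
    then show "integrable W (\<lambda>w. (?Z j w)\<^sup>2)"
      using B(2)[OF grid_point[of j k]] by simp
  next
    fix a :: "nat \<Rightarrow> real" and b
    let ?R = "\<lambda>s t. (s powr (2 * H) + t powr (2 * H) - \<bar>s - t\<bar> powr (2 * H)) / 2"
    have "(LINT w|gauss_space. cos ((\<Sum>j\<le>k. a j * ?Y N j w) + b)) =
      cos b * exp (- (\<Sum>i\<le>k. \<Sum>j\<le>k. a i * a j * ((?c N)\<^sup>2 * walk_cov H (?n N i) (?n N j))) / 2)" for N
    proof -
      have "(\<Sum>j\<le>k. a j * ?Y N j w) = (\<Sum>j\<le>k. (?c N * a j) * g N (?n N j) w)" for w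
        by (intro sum.cong) auto
      moreover have "(LINT w|gauss_space. cos ((\<Sum>j\<le>k. (?c N * a j) * g N (?n N j) w) + b)) =
        cos b * exp (- (\<Sum>i\<le>k. \<Sum>j\<le>k. (?c N * a i) * (?c N * a j) * walk_cov H (?n N i) (?n N j)) / 2)"
        by (rule walk_gaussian_combination(3)[OF G]) (use idx in auto)
      moreover have "(?c N * a i) * (?c N * a j) * w = a i * a j * ((?c N)\<^sup>2 * w)" for i j w
        by (simp only: power2_eq_square mult_ac)
      ultimately show ?thesis by (simp only:)
    qed
    moreover have "(\<lambda>N. cos b * exp (- (\<Sum>i\<le>k. \<Sum>j\<le>k. a i * a j * ((?c N)\<^sup>2 * walk_cov H (?n N i) (?n N j))) / 2))
      \<longlonglongrightarrow> cos b * exp (- (\<Sum>i\<le>k. \<Sum>j\<le>k. a i * a j * ?R (real i / real k) (real j / real k)) / 2)"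
      by (intro tendsto_mult tendsto_const tendsto_exp tendsto_divide tendsto_minus tendsto_sum walk_cov_scaling[OF H]) auto
    moreover have "(LINT w|W. cos ((\<Sum>j\<le>k. a j * ?Z j w) + b)) =
      cos b * exp (- (\<Sum>i\<le>k. \<Sum>j\<le>k. a i * a j * ?R (real i / real k) (real j / real k)) / 2)"
    proof -
      let ?g = "\<lambda>j. real j / real k"
      have inj: "inj_on ?g {..k}" using k by (auto simp: inj_on_def)
      \<comment> \<open>Coefficients are moved from indices to grid times; the floor recovers
        \<open>j\<close> exactly from \<open>real j / real k\<close>.\<close>
      define a' where "a' t = a (nat \<lfloor>real k * t\<rfloor>)" for t
      have a': "a' (?g j) = a j" for j using k by (simp add: a'_def)
      have "(\<Sum>t\<in>?g ` {..k}. a' t * B t w) = (\<Sum>j\<le>k. a j * ?Z j w)" for w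
        unfolding sum.reindex[OF inj] by (intro sum.cong) (auto simp: a')
      moreover have "(\<Sum>s\<in>?g ` {..k}. \<Sum>t\<in>?g ` {..k}. a' s * a' t * ?R s t) =
        (\<Sum>i\<le>k. \<Sum>j\<le>k. a i * a j * ?R (?g i) (?g j))"
        unfolding sum.reindex[OF inj] by (simp only: comp_def a')
      moreover have "?g ` {..k} \<subseteq> {0..1}" using grid_point by auto
      ultimately show ?thesis using fbm_combination[OF fbm, of "?g ` {..k}" a' b] by (simp only: finite_imageI finite_atMost)
    qed
    ultimately show "(\<lambda>N. \<integral>w. cos ((\<Sum>j\<le>k. a j * ?Y N j w) + b) \<partial>gauss_space)
      \<longlonglongrightarrow> (LINT w|W. cos ((\<Sum>j\<le>k. a j * ?Z j w) + b))"
      by (simp only:)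
  qed (use W prob_space_gauss_space in auto)
qed

text \<open>The oscillation bound concerns squares, while a Lipschitz functional needs the distance
  itself: \<open>\<bar>z\<bar> \<le> d + z\<^sup>2 / d\<close> trades one for the other, with
  \<open>d\<close> left free.\<close>

lemma walk_gaussian_grid_approx:
  assumes H: "1/2 < H" "H < 1" and G: "walk_gaussian H N g" and k: "k \<ge> 1" "k \<le> N"
    and C: "C \<ge> 0" "\<And>n. (c_H H)\<^sup>2 * walk_var H n \<le> C * real n powr (2 * H)"
    and f: "L \<ge> 0" "\<And>x. x \<in> cadlag \<Longrightarrow> \<bar>f x\<bar> \<le> b"
      "\<And>x y. x \<in> cadlag \<Longrightarrow> y \<in> cadlag \<Longrightarrow> \<bar>f x - f y\<bar> \<le> L * skorohod_dist x y"
    and d: "d > 0"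
  defines "q \<equiv> 2 powr (2 * H)"
  shows "\<bar>(LINT w|gauss_space. f (step_path N (\<lambda>i. c_H H / real N powr H * g i w))) -
      (LINT w|gauss_space. f (step_path k (\<lambda>j. if j \<le> k then c_H H / real N powr H * g (nat \<lfloor>real N * (real j / real k)\<rfloor>) w else 0)))\<bar>
    \<le> L * (d + (real k + 1) * ((2 * (q + 2) / (q - 2)\<^sup>2 + 1) * C * (4 / real k) powr (2 * H)) / d)"
proof -
  let ?G = "gauss_space"
  let ?c = "c_H H / real N powr H"
  let ?x = "\<lambda>w. step_path N (\<lambda>i. ?c * g i w)"
  let ?y = "\<lambda>w. step_path k (\<lambda>j. if j \<le> k then ?c * g (nat \<lfloor>real N * (real j / real k)\<rfloor>) w else 0)"
  let ?E = "(real k + 1) * ((2 * (q + 2) / (q - 2)\<^sup>2 + 1) * C * (4 / real k) powr (2 * H))"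
  interpret S: prob_space ?G by (rule prob_space_gauss_space)
  obtain D where D: "integrable ?G D" "\<And>w. 0 \<le> D w"
    "\<And>w t. t \<in> {0..1} \<Longrightarrow> (?c * g (nat \<lfloor>real N * t\<rfloor>) w - ?c * g (nat \<lfloor>real N * (real (nat \<lfloor>real k * t\<rfloor>) / real k)\<rfloor>) w)\<^sup>2 \<le> D w"
    "(LINT w|?G. D w) \<le> ?E"
    using walk_gaussian_oscillation[OF H G k C] unfolding q_def by blast
  have fc: "continuous_map skorohod_topology euclideanreal f"
    unfolding skorohod_topology_def by (rule skorohod.continuous_map_lipschitz[OF f(3)])
  have fm: "(\<lambda>w. f (step_path n (\<lambda>i. Y i w))) \<in> borel_measurable ?G"
    if "\<And>i. Y i \<in> borel_measurable ?G" for n Y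
    by (rule measurable_compose[OF measurable_euclidean_continuous_map[OF that continuous_map_step_path] continuous_map_borel_of_real[OF fc]])
  have "(\<lambda>w. f (?x w)) \<in> borel_measurable ?G"
    by (rule fm) (intro borel_measurable_times borel_measurable_const walk_gaussian_measurable[OF G])
  then have xi: "integrable ?G (\<lambda>w. f (?x w))"
    by (intro S.integrable_const_bound[of _ b]) (use f(2)[OF step_path_cadlag] in auto)
  have "(\<lambda>w. f (?y w)) \<in> borel_measurable ?G"
  proof (rule fm)
    show "(\<lambda>w. if j \<le> k then ?c * g (nat \<lfloor>real N * (real j / real k)\<rfloor>) w else 0) \<in> borel_measurable ?G" for j
      using borel_measurable_times[OF borel_measurable_const walk_gaussian_measurable[OF G]] by (cases "j \<le> k") simp_all
  qed
  then have yi: "integrable ?G (\<lambda>w. f (?y w))"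
    by (intro S.integrable_const_bound[of _ b]) (use f(2)[OF step_path_cadlag] in auto)
  have pt: "\<bar>f (?x w) - f (?y w)\<bar> \<le> L * (d + D w / d)" for w
  proof -
    have "skorohod_dist (?x w) (?y w) \<le> d + D w / d"
    proof (rule skorohod_dist_le_sup[OF step_path_cadlag step_path_cadlag])
      show "0 \<le> d + D w / d" using d D(2) by (intro add_nonneg_nonneg) auto
      fix t :: real assume t: "t \<in> {0..1}"
      let ?z = "?c * g (nat \<lfloor>real N * t\<rfloor>) w - ?c * g (nat \<lfloor>real N * (real (nat \<lfloor>real k * t\<rfloor>) / real k)\<rfloor>) w"
      have "\<bar>z\<bar> \<le> d + z\<^sup>2 / d" for z :: real
      proof (cases "\<bar>z\<bar> \<le> d")
        case True
        then show ?thesis using d by (smt (verit) divide_nonneg_pos zero_le_power2)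
      next
        case False
        then have "\<bar>z\<bar> * d \<le> \<bar>z\<bar> * \<bar>z\<bar>" by (intro mult_left_mono) auto
        then have "\<bar>z\<bar> \<le> z\<^sup>2 / d" using d by (simp add: pos_le_divide_eq power2_eq_square)
        then show ?thesis using d by simp
      qed
      from this[of ?z] have "\<bar>?z\<bar> \<le> d + ?z\<^sup>2 / d" .
      also have "\<dots> \<le> d + D w / d" using D(3)[OF t] d by (intro add_left_mono divide_right_mono) auto
      finally show "\<bar>?x w t - ?y w t\<bar> \<le> d + D w / d"
        using t floor_index_le[OF t, of k] by (simp add: step_path_def)
    qed
    then have "L * skorohod_dist (?x w) (?y w) \<le> L * (d + D w / d)" using f(1) by (rule mult_left_mono)
    then show ?thesis using f(3)[OF step_path_cadlag step_path_cadlag] by (rule order_trans[rotated])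
  qed
  have "\<bar>(LINT w|?G. f (?x w)) - (LINT w|?G. f (?y w))\<bar> = \<bar>\<integral>w. f (?x w) - f (?y w) \<partial>?G\<bar>"
    using xi yi by simp
  also have "\<dots> \<le> (LINT w|?G. \<bar>f (?x w) - f (?y w)\<bar>)" by (rule integral_abs_bound)
  also have "\<dots> \<le> (LINT w|?G. L * (d + D w / d))"
    using xi yi D(1) pt by (intro integral_mono) auto
  also have "\<dots> = L * (d + (LINT w|?G. D w) / d)"
    using D(1) by (simp add: S.prob_space)
  also have "\<dots> \<le> L * (d + ?E / d)"
    using D(4) d f(1) by (intro mult_left_mono add_left_mono divide_right_mono) auto
  finally show ?thesis .
qed

text \<open>Three comparisons: the walk with its \<open>k\<close>-grid version, uniformly in
  \<open>N \<ge> k\<close>; the grid version with the discretised \<open>B\<close> as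
  \<open>N\<close> grows; the discretised \<open>B\<close> with \<open>B\<close> as \<open>k\<close>
  grows. So \<open>k\<close> is chosen first and \<open>N\<close> afterwards.\<close>

lemma walk_gaussian_skorohod_converges:
  fixes W :: "'b measure" and B :: "real \<Rightarrow> 'b \<Rightarrow> real"
  assumes H: "1/2 < H" "H < 1" and G: "\<And>N. walk_gaussian H N (g N)"
    and fbm: "fractional_brownian_motion H {0..1} W B"
  shows "skorohod_converges (\<lambda>_. gauss_space)
    (\<lambda>N t w. c_H H / real N powr H * g N (nat \<lfloor>real N * t\<rfloor>) w) W B"
proof -
  let ?B = "\<lambda>w. \<lambda>t\<in>{0..1}. B t w"
  let ?x = "\<lambda>N w. step_path N (\<lambda>i. c_H H / real N powr H * g N i w)"
  let ?y = "\<lambda>k N w. step_path k (\<lambda>j. if j \<le> k then c_H H / real N powr H * g N (nat \<lfloor>real N * (real j / real k)\<rfloor>) w else 0)"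
  let ?b = "\<lambda>k w. step_path k (\<lambda>j. if j \<le> k then B (real j / real k) w else 0)"
  have W: "prob_space W" and cont: "\<And>w. w \<in> space W \<Longrightarrow> continuous_on {0..1} (\<lambda>t. B t w)"
    using fbm unfolding fractional_brownian_motion_def gaussian_process_def by blast+
  interpret W: prob_space W by (rule W)
  have x: "(\<lambda>w. \<lambda>t\<in>{0..1}. c_H H / real N powr H * g N (nat \<lfloor>real N * t\<rfloor>) w) = ?x N" for N
    by (simp add: step_path_def)
  have bm: "?b k \<in> W \<rightarrow>\<^sub>M borel_of skorohod_topology" for k
  proof (rule measurable_euclidean_continuous_map[OF _ continuous_map_step_path])
    show "(\<lambda>w. if j \<le> k then B (real j / real k) w else 0) \<in> borel_measurable W" for j
      by (cases "j \<le> k") (auto intro: fbm_square_integrable(1)[OF fbm] grid_point)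
  qed
  have blim: "(\<lambda>k. skorohod_dist (?b k w) (?B w)) \<longlonglongrightarrow> 0" if "w \<in> space W" for w
    by (rule step_path_converges[OF cont[OF that]])
  have Bc: "(?B w) \<in> cadlag" if "w \<in> space W" for w
    by (rule continuous_on_restrict_cadlag[OF cont[OF that]])
  have Bm: "?B \<in> W \<rightarrow>\<^sub>M borel_of skorohod_topology"
    unfolding skorohod_topology_def
    by (rule skorohod.borel_of_measurable_LIMSEQ[OF bm[unfolded skorohod_topology_def] Bc blim])
  have xm: "?x N \<in> gauss_space \<rightarrow>\<^sub>M borel_of skorohod_topology" for N
    by (rule measurable_euclidean_continuous_map[OF _ continuous_map_step_path])
      (intro borel_measurable_times borel_measurable_const walk_gaussian_measurable[OF G])
  obtain C where C: "C \<ge> 0" "\<And>n. (c_H H)\<^sup>2 * walk_var H n \<le> C * real n powr (2 * H)"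
    using walk_var_bound[OF H] by blast
  define A where "A = (2 * (2 powr (2 * H) + 2) / (2 powr (2 * H) - 2)\<^sup>2 + 1) * C"
  show ?thesis
    unfolding skorohod_converges_def x skorohod_topology_def
  proof (rule skorohod.converges_in_law_lipschitzI)
    fix f b L assume f: "L \<ge> 0" "\<And>x. x \<in> cadlag \<Longrightarrow> \<bar>f x\<bar> \<le> b"
      "\<And>x y. x \<in> cadlag \<Longrightarrow> y \<in> cadlag \<Longrightarrow> \<bar>f x - f y\<bar> \<le> L * skorohod_dist x y"
    have fc: "continuous_map skorohod_topology euclideanreal f"
      unfolding skorohod_topology_def by (rule skorohod.continuous_map_lipschitz[OF f(3)])
    have "(\<lambda>k. \<integral>w. f (?b k w) \<partial>W) \<longlonglongrightarrow> (LINT w|W. f (?B w))"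
    proof (rule integral_dominated_convergence[where w = "\<lambda>_. b"])
      show "(\<lambda>w. f (?B w)) \<in> borel_measurable W"
        by (rule measurable_compose[OF Bm continuous_map_borel_of_real[OF fc]])
      show "(\<lambda>w. f (?b k w)) \<in> borel_measurable W" for k
        by (rule measurable_compose[OF bm continuous_map_borel_of_real[OF fc]])
      show "AE w in W. norm (f (?b k w)) \<le> b" for k using f(2)[OF step_path_cadlag] by simp
      have "(\<lambda>k. f (?b k w)) \<longlonglongrightarrow> f (?B w)" if w: "w \<in> space W" for w
      proof (rule Lim_null_comparison[THEN LIM_zero_cancel])
        show "eventually (\<lambda>k. norm (f (?b k w) - f (?B w)) \<le> L * skorohod_dist (?b k w) (?B w)) sequentially"
          using f(3)[OF step_path_cadlag Bc[OF w]] by simp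
        show "(\<lambda>k. L * skorohod_dist (?b k w) (?B w)) \<longlonglongrightarrow> 0"
          using tendsto_mult[OF tendsto_const blim[OF w], of L] by simp
      qed
      then show "AE w in W. (\<lambda>k. f (?b k w)) \<longlonglongrightarrow> f (?B w)" by simp
    qed simp
    note lim1 = this
    have lim2: "(\<lambda>N. \<integral>w. f (?y k N w) \<partial>gauss_space) \<longlonglongrightarrow> (LINT w|W. f (?b k w))" if k: "k \<ge> 1" for k
    proof (rule walk_gaussian_grid_converges[OF H G fbm k, where f = "\<lambda>y. f (step_path k y)" and b = b])
      show "continuous_on UNIV (\<lambda>y. f (step_path k y))"
        using continuous_map_compose[OF continuous_map_step_path fc] by (simp add: o_def)
      show "\<bar>f (step_path k y)\<bar> \<le> b" for y by (rule f(2)[OF step_path_cadlag])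
      show "f (step_path k y) = f (step_path k y')" if "\<And>j. j \<in> {..k} \<Longrightarrow> y j = y' j" for y y'
      proof -
        have "step_path k y = step_path k y'"
          unfolding step_path_def by (intro restrict_ext that) (use floor_index_le in auto)
        then show ?thesis by simp
      qed
    qed
    show "(\<lambda>N. \<integral>w. f (?x N w) \<partial>gauss_space) \<longlonglongrightarrow> (LINT w|W. f (?B w))"
    proof (rule LIMSEQ_I)
      fix e :: real assume e: "e > 0"
      \<comment> \<open>Makes \<open>L * d\<close> at most \<open>e / 6\<close>; then
        \<open>k\<close> is taken so large that the term divided by \<open>d\<close> is below
        \<open>e / 6\<close> too. Using \<open>L + 1\<close> avoids division by 0.\<close>
      define d where "d = e / (6 * (L + 1))"
      have d: "d > 0" "L * d \<le> e / 6" using e f(1) by (auto simp: d_def field_simps)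
      have "(\<lambda>k. L * ((real k + 1) * (A * (4 / real k) powr (2 * H)) / d)) \<longlonglongrightarrow> L * (0 / d)"
        using d by (intro tendsto_mult tendsto_divide tendsto_const oscillation_bound_tendsto H) auto
      then have "eventually (\<lambda>k. L * ((real k + 1) * (A * (4 / real k) powr (2 * H)) / d) < e / 6) sequentially"
        by (rule order_tendstoD) (use e in simp)
      moreover have "eventually (\<lambda>k. dist (LINT w|W. f (?b k w)) (LINT w|W. f (?B w)) < e / 3) sequentially"
        by (rule tendstoD[OF lim1]) (use e in simp)
      ultimately have "eventually (\<lambda>k. k \<ge> 1 \<and> L * ((real k + 1) * (A * (4 / real k) powr (2 * H)) / d) < e / 6 \<and>
          dist (LINT w|W. f (?b k w)) (LINT w|W. f (?B w)) < e / 3) sequentially"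
        using eventually_ge_at_top[of 1] by (intro eventually_conj)
      then obtain k where k: "k \<ge> 1" and k2: "L * ((real k + 1) * (A * (4 / real k) powr (2 * H)) / d) < e / 6"
        and k3: "\<bar>(LINT w|W. f (?b k w)) - (LINT w|W. f (?B w))\<bar> < e / 3"
        unfolding dist_real_def using eventually_happens'[OF sequentially_bot] by fast
      have "eventually (\<lambda>N. dist (LINT w|gauss_space. f (?y k N w)) (LINT w|W. f (?b k w)) < e / 3) sequentially"
        by (rule tendstoD[OF lim2[OF k]]) (use e in simp)
      then have "eventually (\<lambda>N. norm ((LINT w|gauss_space. f (?x N w)) - (LINT w|W. f (?B w))) < e) sequentially"
        using eventually_ge_at_top[of k]
      proof eventually_elim
        case (elim N)
        have "\<bar>(LINT w|gauss_space. f (?x N w)) - (LINT w|gauss_space. f (?y k N w))\<bar>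
          \<le> L * (d + (real k + 1) * (A * (4 / real k) powr (2 * H)) / d)"
          unfolding A_def by (rule walk_gaussian_grid_approx[OF H G k elim(2) C f d(1)])
        also have "\<dots> < e / 3" unfolding distrib_left using d(2) k2 by linarith
        finally show ?case using elim(1) k3 unfolding dist_real_def real_norm_def by linarith
      qed
      then show "\<exists>n0. \<forall>N\<ge>n0. norm ((LINT w|gauss_space. f (?x N w)) - (LINT w|W. f (?B w))) < e"
        by (simp add: eventually_sequentially)
    qed
  qed (use W prob_space_gauss_space xm Bm in \<open>auto simp: skorohod_topology_def\<close>)
qed

theorem theorem1:
  fixes H :: real
    and \<Omega> :: "'a measure"
    and X :: "nat \<Rightarrow> nat \<Rightarrow> 'a \<Rightarrow> int"
    and W :: "'b measure"
    and B :: "real \<Rightarrow> 'b \<Rightarrow> real"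
  assumes H: "1/2 < H" "H < 1"
    and prob: "prob_space \<Omega>"
    and indep: "prob_space.indep_vars \<Omega> (\<lambda>_. walk_space) (\<lambda>i \<omega> n. X i n \<omega>) {1..}"
    and law: "\<And>i. i \<ge> 1 \<Longrightarrow> distr \<Omega> walk_space (\<lambda>\<omega> n. X i n \<omega>) = annealed_law (mu_H H)"
    and fbm: "fractional_brownian_motion H {0..1} W B"
  shows "\<exists>(S :: nat \<Rightarrow> (real \<Rightarrow> real) measure) (Z :: nat \<Rightarrow> real \<Rightarrow> (real \<Rightarrow> real) \<Rightarrow> real).
    (\<forall>N\<ge>1. fdd_converges {0..1}
       (\<lambda>_. \<Omega>)
       (\<lambda>M t \<omega>. c_H H * (\<Sum>i=1..M. real_of_int (X i (nat \<lfloor>real N * t\<rfloor>) \<omega>)) / (real N powr H * sqrt (real M)))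
       (S N) (Z N)) \<and>
    skorohod_converges S Z W B"
proof -
  \<comment> \<open>One family \<open>g\<close> serves both limits, so the process reached as
    \<open>M\<close> grows is literally the one that converges as \<open>N\<close> grows.\<close>
  obtain g where G: "\<And>N. walk_gaussian H N (g N)" using walk_gaussian_exists[OF H] by metis
  show ?thesis
    using superposition_fdd_converges[OF H prob indep law G] walk_gaussian_skorohod_converges[OF H G fbm]
    by (intro exI[of _ "\<lambda>_. gauss_space"] exI[of _ "\<lambda>N t w. c_H H / real N powr H * g N (nat \<lfloor>real N * t\<rfloor>) w"]) blast
qed

end
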